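(* Let $(A,\tau)$ be a tracial $*$-algebra generated (as a unital algebra) by $n$ hermitian elements, and let $\omega$ be a non-principal ultrafilter on $\mathbb{N}=\{1,2,\dots\}$. Then there exist, for each $k\in\mathbb{N}$, a complex-linear functional $\tau_k\colon A_{n,k}\to\mathbb{C}$ making $(A_{n,k},\tau_k)$ into a tracial $*$-algebra, where $A_{n,k}$ is the algebra of $n$ generic self-adjoint $k\times k$-matrices, and a tracial $*$-algebra homomorphism into the metric ultraproduct $$\varphi\colon (A,\tau)\to\prod_{k\to\omega}(A_{n,k},\tau_k).$$
   Context: A tracial $*$-algebra $(A,\tau)$ is a unital complex algebra $A$ with involution together with a $\mathbb{C}$-linear functional $\tau\colon A\to\mathbb{C}$ with $\tau(1)=1$, $\tau(a^*a)\ge 0$ and $\tau(ab)=\tau(ba)$ for all $a,b\in A$. A homomorphism of tracial $*$-algebras $(A,\tau)\to(B,\rho)$ is a $*$-algebra homomorphism $\varphi$ with $\rho(\varphi(a))=\tau(a)$ for all $a\in A$. $\mathbb{C}\langle X\rangle=\mathbb{C}\langle X_1,\dots,X_n\rangle$ is the algebra of non-commutative polynomials with the involution determined by $X_i^*=X_i$ and $\lambda^*=\overline\lambda$ for $\lambda\in\mathbb{C}$. $J_k$ is the two-sided $*$-ideal of all $P\in\mathbb{C}\langle X\rangle$ vanishing under every substitution of self-adjoint complex $k\times k$-matrices for $X_1,\dots,X_n$. The algebra of $n$ generic self-adjoint $k\times k$-matrices is the quotient $*$-algebra $A_{n,k}:=\mathbb{C}\langle X\rangle/J_k$. For even $p\ge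 2$ put $\|a\|_p=\tau((a^*a)^{p/2})^{1/p}$. Metric ultraproduct: given tracial $*$-algebras $(A_i,\tau_i)$, $i\in I$, and an ultrafilter $\omega$ on $I$, let $\widetilde{\prod}_{i}(A_i,\tau_i)$ be the $*$-algebra of all $(a_i)_i\in\prod_i A_i$ such that $(\|a_i\|_p)_{i\in I}$ is bounded for every even $p$. On it, $\tau_\omega((a_i)_i)=\lim_{i\to\omega}\tau_i(a_i)$ is a positive trace, $Z_{\tau_\omega}=\{x : \tau_\omega(x^*x)=0\}$ is a two-sided $*$-ideal on which $\tau_\omega$ vanishes, and the metric ultraproduct is $\prod_{i\to\omega}(A_i,\tau_i):=\widetilde{\prod}_i(A_i,\tau_i)/Z_{\tau_\omega}$ with the trace induced by $\tau_\omega$. *)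

theory Defs
  imports
    "HOL-Algebra.QuotRing"
    "HOL-Library.Poly_Mapping"
    "Jordan_Normal_Form.Schur_Decomposition"
begin

section \<open>Tracial star-algebras\<close>

record 'a star_alg = "'a ring" +
  cscale :: "complex \<Rightarrow> 'a \<Rightarrow> 'a"
  star :: "'a \<Rightarrow> 'a"

locale star_algebra = ring A for A :: "('a, 'm) star_alg_scheme" (structure) +
  assumes cscale_closed: "a \<in> carrier A \<Longrightarrow> cscale A c a \<in> carrier A"
    and cscale_add_left:
      "a \<in> carrier A \<Longrightarrow> cscale A (c + d) a = cscale A c a \<oplus> cscale A d a"
    and cscale_add_right:
      "a \<in> carrier A \<Longrightarrow> b \<in> carrier A \<Longrightarrow> cscale A c (a \<oplus> b) = cscale A c a \<oplus> cscale A c b"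
    and cscale_assoc: "a \<in> carrier A \<Longrightarrow> cscale A (c * d) a = cscale A c (cscale A d a)"
    and cscale_one: "a \<in> carrier A \<Longrightarrow> cscale A 1 a = a"
    and cscale_mult_left:
      "a \<in> carrier A \<Longrightarrow> b \<in> carrier A \<Longrightarrow> cscale A c a \<otimes> b = cscale A c (a \<otimes> b)"
    and cscale_mult_right:
      "a \<in> carrier A \<Longrightarrow> b \<in> carrier A \<Longrightarrow> a \<otimes> cscale A c b = cscale A c (a \<otimes> b)"
    and star_closed: "a \<in> carrier A \<Longrightarrow> star A a \<in> carrier A"
    and star_star: "a \<in> carrier A \<Longrightarrow> star A (star A a) = a"
    and star_add:
      "a \<in> carrier A \<Longrightarrow> b \<in> carrier A \<Longrightarrow> star A (a \<oplus> b) = star A a \<oplus> star A b"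
    and star_cscale: "a \<in> carrier A \<Longrightarrow> star A (cscale A c a) = cscale A (cnj c) (star A a)"
    and star_mult:
      "a \<in> carrier A \<Longrightarrow> b \<in> carrier A \<Longrightarrow> star A (a \<otimes> b) = star A b \<otimes> star A a"

text \<open>The order on \<^typ>\<open>complex\<close> is that of Complex_Order, so \<open>0 \<le> z\<close> means that \<open>z\<close> is real
  and nonnegative.\<close>

locale tracial_star_algebra = star_algebra A for A :: "('a, 'm) star_alg_scheme" (structure) +
  fixes \<tau> :: "'a \<Rightarrow> complex"
  assumes trace_add: "a \<in> carrier A \<Longrightarrow> b \<in> carrier A \<Longrightarrow> \<tau> (a \<oplus> b) = \<tau> a + \<tau> b"
    and trace_cscale: "a \<in> carrier A \<Longrightarrow> \<tau> (cscale A c a) = c * \<tau> a"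
    and trace_one: "\<tau> \<one> = 1"
    and trace_pos: "a \<in> carrier A \<Longrightarrow> 0 \<le> \<tau> (star A a \<otimes> a)"
    and trace_comm: "a \<in> carrier A \<Longrightarrow> b \<in> carrier A \<Longrightarrow> \<tau> (a \<otimes> b) = \<tau> (b \<otimes> a)"

locale tracial_star_hom =
  source: tracial_star_algebra A \<tau> + target: tracial_star_algebra B \<rho>
  for A :: "('a, 'm) star_alg_scheme" and \<tau> and B :: "('b, 'k) star_alg_scheme" and \<rho> +
  fixes \<phi> :: "'a \<Rightarrow> 'b"
  assumes hom_ring: "\<phi> \<in> Ring.ring_hom A B"
    and hom_cscale: "a \<in> carrier A \<Longrightarrow> \<phi> (cscale A c a) = cscale B c (\<phi> a)"
    and hom_star: "a \<in> carrier A \<Longrightarrow> \<phi> (star A a) = star B (\<phi> a)"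
    and hom_trace: "a \<in> carrier A \<Longrightarrow> \<rho> (\<phi> a) = \<tau> a"

inductive_set generate_algebra :: "('a, 'm) star_alg_scheme \<Rightarrow> 'a set \<Rightarrow> 'a set"
  for A and S where
  one: "\<one>\<^bsub>A\<^esub> \<in> generate_algebra A S"
| incl: "a \<in> S \<Longrightarrow> a \<in> generate_algebra A S"
| cscale: "a \<in> generate_algebra A S \<Longrightarrow> cscale A c a \<in> generate_algebra A S"
| add: "a \<in> generate_algebra A S \<Longrightarrow> b \<in> generate_algebra A S \<Longrightarrow>
    a \<oplus>\<^bsub>A\<^esub> b \<in> generate_algebra A S"
| mult: "a \<in> generate_algebra A S \<Longrightarrow> b \<in> generate_algebra A S \<Longrightarrow>
    a \<otimes>\<^bsub>A\<^esub> b \<in> generate_algebra A S"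

text \<open>Quotient by a two-sided star-ideal \<open>I\<close>. As for multiplication in \<^const>\<open>FactRing\<close>, the
  operations on cosets are unions over representatives.\<close>

definition star_quotient :: "('a, 'm) star_alg_scheme \<Rightarrow> 'a set \<Rightarrow> 'a set star_alg" where
  "star_quotient A I = ring.extend (A Quot I)
     (star_alg.fields
       (\<lambda>c X. \<Union>a\<in>X. I +>\<^bsub>A\<^esub> cscale A c a)
       (\<lambda>X. \<Union>a\<in>X. I +>\<^bsub>A\<^esub> star A a))"


section \<open>Non-commutative polynomials\<close>

text \<open>Words form the free monoid, written additively so that the convolution product of
  Poly_Mapping on finitely supported functions is that of non-commutative polynomials.\<close>

datatype word = Word (letters: "nat list")

instantiation word :: monoid_add
begin

definition zero_word where "0 = Word []"
definition plus_word where "v + w = Word (letters v @ letters w)"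

instance
  by standard (simp_all add: zero_word_def plus_word_def)

end

definition rev_word :: "word \<Rightarrow> word" where
  "rev_word w = Word (rev (letters w))"

type_synonym ncpoly = "word \<Rightarrow>\<^sub>0 complex"

text \<open>The algebra of non-commutative polynomials in variables \<open>X\<^sub>0, \<dots>, X\<^sub>n\<^sub>-\<^sub>1\<close>.\<close>

definition nc_polys :: "nat \<Rightarrow> ncpoly star_alg" where
  "nc_polys n =
    \<lparr>carrier = {P. \<forall>w\<in>Poly_Mapping.keys P. set (letters w) \<subseteq> {..<n}},
     monoid.mult = (*), one = 1, zero = 0, add = (+),
     cscale = (\<lambda>c. Poly_Mapping.map ((*) c)),
     star = (\<lambda>P. Poly_Mapping.map_key rev_word (Poly_Mapping.map cnj P))\<rparr>"


section \<open>Generic self-adjoint matrices\<close>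

definition word_mat :: "nat \<Rightarrow> (nat \<Rightarrow> complex mat) \<Rightarrow> word \<Rightarrow> complex mat" where
  "word_mat k M w = foldr (\<lambda>i B. M i * B) (letters w) (1\<^sub>m k)"

definition eval_mat :: "nat \<Rightarrow> (nat \<Rightarrow> complex mat) \<Rightarrow> ncpoly \<Rightarrow> complex mat" where
  "eval_mat k M P = mat k k (\<lambda>(i, j).
     \<Sum>w\<in>Poly_Mapping.keys P. Poly_Mapping.lookup P w * word_mat k M w $$ (i, j))"

definition vanishing_ideal :: "nat \<Rightarrow> nat \<Rightarrow> ncpoly set" where
  "vanishing_ideal n k = {P \<in> carrier (nc_polys n).
     \<forall>M. (\<forall>i<n. M i \<in> carrier_mat k k \<and> mat_adjoint (M i) = M i) \<longrightarrow> eval_mat k M P = 0\<^sub>m k k}"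

definition generic_matrices :: "nat \<Rightarrow> nat \<Rightarrow> ncpoly set star_alg" where
  "generic_matrices n k = star_quotient (nc_polys n) (vanishing_ideal n k)"


section \<open>Metric ultraproducts\<close>

text \<open>An ultrafilter on the set \<open>I\<close>, represented as a filter on the ambient type that is
  concentrated on \<open>I\<close>.\<close>

definition ultrafilter_on :: "'i set \<Rightarrow> 'i filter \<Rightarrow> bool" where
  "ultrafilter_on I \<omega> \<longleftrightarrow> \<omega> \<noteq> bot \<and> eventually (\<lambda>i. i \<in> I) \<omega> \<and>
     (\<forall>P. eventually P \<omega> \<or> eventually (\<lambda>i. \<not> P i) \<omega>)"

definition nonprincipal :: "'i filter \<Rightarrow> bool" where
  "nonprincipal \<omega> \<longleftrightarrow> (\<forall>i. \<omega> \<noteq> principal {i})"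

definition trace_norm :: "('a, 'm) star_alg_scheme \<Rightarrow> ('a \<Rightarrow> complex) \<Rightarrow> nat \<Rightarrow> 'a \<Rightarrow> real" where
  "trace_norm A \<tau> p a = root p (Re (\<tau> ((star A a \<otimes>\<^bsub>A\<^esub> a) [^]\<^bsub>A\<^esub> (p div 2))))"

definition bounded_product ::
  "'i set \<Rightarrow> ('i \<Rightarrow> ('a, 'm) star_alg_scheme) \<Rightarrow> ('i \<Rightarrow> 'a \<Rightarrow> complex) \<Rightarrow> ('i \<Rightarrow> 'a) star_alg" where
  "bounded_product I A \<tau> =
    \<lparr>carrier = {a \<in> \<Pi>\<^sub>E i\<in>I. carrier (A i).
        \<forall>p. even p \<and> p \<ge> 2 \<longrightarrow> (\<exists>C. \<forall>i\<in>I. \<bar>trace_norm (A i) (\<tau> i) p (a i)\<bar> \<le> C)},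
     monoid.mult = (\<lambda>a b. \<lambda>i\<in>I. a i \<otimes>\<^bsub>A i\<^esub> b i), one = (\<lambda>i\<in>I. \<one>\<^bsub>A i\<^esub>),
     zero = (\<lambda>i\<in>I. \<zero>\<^bsub>A i\<^esub>), add = (\<lambda>a b. \<lambda>i\<in>I. a i \<oplus>\<^bsub>A i\<^esub> b i),
     cscale = (\<lambda>c a. \<lambda>i\<in>I. cscale (A i) c (a i)), star = (\<lambda>a. \<lambda>i\<in>I. star (A i) (a i))\<rparr>"

definition limit_trace :: "'i filter \<Rightarrow> ('i \<Rightarrow> 'a \<Rightarrow> complex) \<Rightarrow> ('i \<Rightarrow> 'a) \<Rightarrow> complex" where
  "limit_trace \<omega> \<tau> a = Lim \<omega> (\<lambda>i. \<tau> i (a i))"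

definition null_ideal ::
  "'i set \<Rightarrow> 'i filter \<Rightarrow> ('i \<Rightarrow> ('a, 'm) star_alg_scheme) \<Rightarrow> ('i \<Rightarrow> 'a \<Rightarrow> complex) \<Rightarrow> ('i \<Rightarrow> 'a) set"
  where
  "null_ideal I \<omega> A \<tau> = {a \<in> carrier (bounded_product I A \<tau>).
     limit_trace \<omega> \<tau> (star (bounded_product I A \<tau>) a \<otimes>\<^bsub>bounded_product I A \<tau>\<^esub> a) = 0}"

definition ultraproduct ::
  "'i set \<Rightarrow> 'i filter \<Rightarrow> ('i \<Rightarrow> ('a, 'm) star_alg_scheme) \<Rightarrow> ('i \<Rightarrow> 'a \<Rightarrow> complex) \<Rightarrow>
     ('i \<Rightarrow> 'a) set star_alg"
  where
  "ultraproduct I \<omega> A \<tau> = star_quotient (bounded_product I A \<tau>) (null_ideal I \<omega> A \<tau>)"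

text \<open>The limit trace takes a single value on each coset of the null ideal.\<close>

definition ultraproduct_trace ::
  "'i filter \<Rightarrow> ('i \<Rightarrow> 'a \<Rightarrow> complex) \<Rightarrow> ('i \<Rightarrow> 'a) set \<Rightarrow> complex" where
  "ultraproduct_trace \<omega> \<tau> X = the_elem (limit_trace \<omega> \<tau> ` X)"

end

theory Submission
  imports Defs "HOL-Analysis.Elementary_Topology" "HOL-Analysis.L2_Norm"
begin

text \<open>
  A tracial star-algebra generated by hermitian \<open>x\<^sub>0, \<dots>, x\<^sub>n\<^sub>-\<^sub>1\<close> is determined by the moments
  \<open>f w = \<tau> (w(x))\<close>, and it suffices to find traces on the algebras of generic \<open>k \<times> k\<close> matrices whose
  moments converge to \<open>f\<close>. Truncating \<open>f\<close> to words of length at most \<open>2 d\<close> is compatible with the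
  relations of large generic matrices, since these relations are homogeneous and of high degree, but
  it destroys positivity. Positivity is restored by adding \<open>c\<^sub>j tr(w(M))\<close> on words \<open>w\<close> of length
  \<open>2 j\<close>, for a fixed tuple \<open>M\<close> of self-adjoint matrices whose words of equal length at most \<open>2 d\<close> are
  linearly independent (truncated Fock space operators). With weights \<open>c\<^sub>j = R ^ (2 j\<^sup>2 - 2 d)\<close> the
  graded form is diagonally dominant for large \<open>R\<close>, while the weights of the low degrees are
  negligible.

  That the metric ultraproduct is a tracial star-algebra at all rests on a substitute for Hoelder's
  inequality in a tracial star-algebra, obtained by reflections of words.
\<close>

section \<open>Star-algebras and positive traces\<close>

text \<open>Approximating the moments of \<open>A\<close> by normalised matrix traces alone would be
  an embedding statement of Connes type, which cannot be expected for arbitrary \<open>A\<close>. A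
  trace on generic matrices is a weaker object: it only has to kill
  \<open>vanishing_ideal n k\<close>, and this ideal says nothing below a degree that grows with
  \<open>k\<close>. Truncation spoils positivity because blocks pairing degrees \<open>a\<close> and
  \<open>b\<close> with \<open>a + b \<le> 2 * d\<close> survive even when \<open>a > d\<close>,
  where the diagonal block of degree \<open>a\<close> has been cut away. In high degree the
  functionals known to kill the ideal are the \<open>tr (w(M))\<close>, and since the ideal is
  homogeneous each degree may carry its own weight. The exponent is quadratic in \<open>j\<close> so
  that the weight at \<open>(a + b) / 2\<close>, divided by the geometric mean of the weights at
  \<open>a\<close> and \<open>b\<close>, is R to the power -(a - b)^2 / 2. The offset
  \<open>2 * d\<close> serves two demands: a block with \<open>a > d\<close> or \<open>b > d\<close>
  meets a mean weight of exponent a^2 + b^2 - 2 d, at least 1, whereas words whose length is small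
  against the square root of \<open>d\<close> get a negative exponent and are hardly
  disturbed.\<close>

context star_algebra
begin

lemma cscale_zero_left: "a \<in> carrier A \<Longrightarrow> cscale A 0 a = \<zero>"
  using cscale_add_left[of a 0 0] cscale_closed[of a 0]
  by (metis add.r_cancel_one' add_0)

lemma cscale_minus_one: "a \<in> carrier A \<Longrightarrow> cscale A (-1) a = \<ominus> a"
  using cscale_add_left[of a "-1" 1] cscale_closed[of a "-1"] cscale_zero_left[of a] cscale_one[of a]
  by (metis add.inv_equality add.left_inverse)

lemma star_zero: "star A \<zero> = \<zero>"
  using star_add[of \<zero> \<zero>] star_closed[of \<zero>]
  by (metis add.r_cancel_one' l_zero zero_closed)

lemma star_one: "star A \<one> = \<one>"
  by (metis l_one one_closed star_closed star_mult star_star)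

lemma star_nat_pow:
  assumes "a \<in> carrier A"
  shows "star A (a [^] (k::nat)) = star A a [^] k"
proof (induction k)
  case (Suc k)
  show ?case
    using Suc assms by (simp add: star_mult star_closed nat_pow_Suc2[symmetric])
qed (simp add: star_one)

end

context tracial_star_algebra
begin

lemma trace_zero: "\<tau> \<zero> = 0"
  using trace_add[of \<zero> \<zero>] by simp

text \<open>Hermitian symmetry is not an axiom of the trace. It comes from the reality of the trace
  of \<open>star A b \<otimes> b\<close> at \<open>b = \<one> \<oplus> cscale A c a\<close>, for
  \<open>c = 1\<close> and \<open>c = \<i>\<close>.\<close>

lemma trace_star:
  assumes a: "a \<in> carrier A"
  shows "\<tau> (star A a) = cnj (\<tau> a)"
proof -
  have sa: "star A a \<in> carrier A" by (rule star_closed[OF a])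
  have exp: "\<tau> (star A (\<one> \<oplus> cscale A c a) \<otimes> (\<one> \<oplus> cscale A c a))
      = 1 + c * \<tau> a + cnj c * \<tau> (star A a) + (c * cnj c) * \<tau> (star A a \<otimes> a)" for c
  proof -
    have "star A (\<one> \<oplus> cscale A c a) \<otimes> (\<one> \<oplus> cscale A c a)
      = (\<one> \<oplus> cscale A (cnj c) (star A a)) \<otimes> (\<one> \<oplus> cscale A c a)"
      using a sa by (simp add: star_add star_one star_cscale cscale_closed)
    also have "\<dots> = (\<one> \<oplus> cscale A c a) \<oplus>
        (cscale A (cnj c) (star A a) \<oplus> cscale A (c * cnj c) (star A a \<otimes> a))"
      using a sa
      by (simp add: l_distr r_distr cscale_closed cscale_mult_left cscale_mult_right cscale_assoc
        cscale_add_right a_ac)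
    finally show ?thesis
      using a sa by (simp add: trace_add trace_cscale trace_one cscale_closed)
  qed
  have pos: "0 \<le> 1 + c * \<tau> a + cnj c * \<tau> (star A a) + (c * cnj c) * \<tau> (star A a \<otimes> a)" for c
    using trace_pos[of "\<one> \<oplus> cscale A c a"] a exp[of c] by (simp add: cscale_closed)
  have im0: "Im (\<tau> (star A a \<otimes> a)) = 0"
    using trace_pos[OF a] by (simp add: less_eq_complex_def)
  from pos[of 1] im0 have "Im (\<tau> a) + Im (\<tau> (star A a)) = 0"
    by (simp add: less_eq_complex_def)
  moreover from pos[of \<i>] im0 have "Re (\<tau> a) = Re (\<tau> (star A a))"
    by (simp add: less_eq_complex_def)
  ultimately show ?thesis by (simp add: complex_eq_iff)
qed

lemma trace_Cauchy_Schwarz: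
  assumes a: "a \<in> carrier A" and b: "b \<in> carrier A"
  shows "(cmod (\<tau> (star A a \<otimes> b)))\<^sup>2 \<le> Re (\<tau> (star A a \<otimes> a)) * Re (\<tau> (star A b \<otimes> b))"
proof -
  define p q z where "p = Re (\<tau> (star A a \<otimes> a))" and "q = Re (\<tau> (star A b \<otimes> b))"
    and "z = \<tau> (star A a \<otimes> b)"
  have sa: "star A a \<in> carrier A" and sb: "star A b \<in> carrier A" using a b by (auto simp: star_closed)
  have z': "\<tau> (star A b \<otimes> a) = cnj z"
    using trace_star[of "star A a \<otimes> b"] a b sa sb by (simp add: z_def star_mult star_star)
  have pq: "\<tau> (star A a \<otimes> a) = complex_of_real p" "\<tau> (star A b \<otimes> b) = complex_of_real q" "q \<ge> 0"
    using trace_pos[OF a] trace_pos[OF b]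
    by (auto simp: p_def q_def less_eq_complex_def complex_eq_iff)
  have exp: "\<tau> (star A (a \<oplus> cscale A c b) \<otimes> (a \<oplus> cscale A c b))
      = p + c * z + cnj c * cnj z + (c * cnj c) * q" for c
  proof -
    have "star A (a \<oplus> cscale A c b) \<otimes> (a \<oplus> cscale A c b)
      = (star A a \<oplus> cscale A (cnj c) (star A b)) \<otimes> (a \<oplus> cscale A c b)"
      using a b sa sb by (simp add: star_add star_cscale cscale_closed)
    also have "\<dots> = (star A a \<otimes> a \<oplus> cscale A (cnj c) (star A b \<otimes> a)) \<oplus>
        (cscale A c (star A a \<otimes> b) \<oplus> cscale A (c * cnj c) (star A b \<otimes> b))"
      using a b sa sb
      by (simp add: l_distr r_distr cscale_closed cscale_mult_left cscale_mult_right cscale_assoc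
        cscale_add_right a_ac)
    finally show ?thesis
      using a b sa sb z' pq by (simp add: trace_add trace_cscale cscale_closed z_def)
  qed
  have pos: "0 \<le> p - 2 * s * (cmod z)\<^sup>2 + s\<^sup>2 * (cmod z)\<^sup>2 * q" for s
  proof -
    \<comment> \<open>This choice removes the phase of \<open>z\<close> and leaves a real quadratic
      in \<open>s\<close>, minimal at \<open>s = 1 / q\<close> when \<open>q > 0\<close>.\<close>
    define c where "c = - (s * cnj z)"
    have cz: "c * z = - (complex_of_real (s * (cmod z)\<^sup>2))"
      using complex_norm_square[of z] by (simp add: c_def mult.commute mult.left_commute)
    have "c * cnj c = complex_of_real (s\<^sup>2 * (cmod z)\<^sup>2)"
      using complex_norm_square[of z] by (simp add: c_def power2_eq_square mult.commute mult.left_commute)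
    moreover have "cnj c * cnj z = - (complex_of_real (s * (cmod z)\<^sup>2))"
      using arg_cong[OF cz, of cnj] by simp
    moreover have "0 \<le> p + c * z + cnj c * cnj z + (c * cnj c) * q"
      using trace_pos[of "a \<oplus> cscale A c b"] a b exp[of c] by (simp add: cscale_closed)
    ultimately have "0 \<le> complex_of_real (p - 2 * s * (cmod z)\<^sup>2 + s\<^sup>2 * (cmod z)\<^sup>2 * q)"
      by (simp add: cz mult.assoc)
    then show ?thesis by (simp add: less_eq_complex_def)
  qed
  have "(cmod z)\<^sup>2 \<le> p * q"
  proof (cases "q = 0")
    case True
    show ?thesis
    proof (rule ccontr)
      assume "\<not> ?thesis"
      then have "(cmod z)\<^sup>2 > 0" using True by simp
      \<comment> \<open>With \<open>q = 0\<close> the quadratic is affine: this \<open>s\<close>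
        gives the value \<open>- p - 2\<close>, while \<open>s = 0\<close> gives
        \<open>0 \<le> p\<close>.\<close>
      then show False using pos[of "(p + 1) / (cmod z)\<^sup>2"] pos[of 0] True by simp
    qed
  next
    case False
    then have "q > 0" using pq by simp
    then show ?thesis using pos[of "1 / q"]
      by (simp add: power2_eq_square field_simps)
  qed
  then show ?thesis by (simp add: p_def q_def z_def)
qed

end

section \<open>Quotients\<close>

text \<open>Yields the axioms of a quotient without going through representatives.\<close>

lemma star_algebra_image:
  fixes A :: "('a, 'm) star_alg_scheme" and B :: "('b, 'k) star_alg_scheme"
  assumes "star_algebra A"
    and carrier: "carrier B = h ` carrier A"
    and one: "\<one>\<^bsub>B\<^esub> = h \<one>\<^bsub>A\<^esub>" and zero: "\<zero>\<^bsub>B\<^esub> = h \<zero>\<^bsub>A\<^esub>"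
    and add: "\<And>a b. a \<in> carrier A \<Longrightarrow> b \<in> carrier A \<Longrightarrow> h a \<oplus>\<^bsub>B\<^esub> h b = h (a \<oplus>\<^bsub>A\<^esub> b)"
    and mult: "\<And>a b. a \<in> carrier A \<Longrightarrow> b \<in> carrier A \<Longrightarrow> h a \<otimes>\<^bsub>B\<^esub> h b = h (a \<otimes>\<^bsub>A\<^esub> b)"
    and cscale: "\<And>c a. a \<in> carrier A \<Longrightarrow> cscale B c (h a) = h (cscale A c a)"
    and star: "\<And>a. a \<in> carrier A \<Longrightarrow> star B (h a) = h (star A a)"
  shows "star_algebra B"
proof -
  interpret star_algebra A by fact
  have rngB: "ring B"
  proof (rule ringI)
    show "abelian_group B"
    proof (rule abelian_groupI)
      fix x assume "x \<in> carrier B"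
      then obtain a where a: "a \<in> carrier A" "x = h a" using carrier by auto
      then show "\<exists>y\<in>carrier B. y \<oplus>\<^bsub>B\<^esub> x = \<zero>\<^bsub>B\<^esub>"
        by (intro bexI[of _ "h (\<ominus>\<^bsub>A\<^esub> a)"]) (auto simp: carrier add zero l_neg)
        next
      fix x y z assume "x \<in> carrier B" "y \<in> carrier B" "z \<in> carrier B"
      then show "x \<oplus>\<^bsub>B\<^esub> y \<oplus>\<^bsub>B\<^esub> z = x \<oplus>\<^bsub>B\<^esub> (y \<oplus>\<^bsub>B\<^esub> z)"
        by (auto simp: carrier add a_assoc)
    next
      fix x y assume "x \<in> carrier B" "y \<in> carrier B"
      then show "x \<oplus>\<^bsub>B\<^esub> y = y \<oplus>\<^bsub>B\<^esub> x"
        by (auto simp: carrier add a_comm)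
    qed (auto simp: carrier zero add)
    show "monoid B"
      by (rule monoidI) (auto simp: carrier one mult m_assoc)
  qed (auto simp: carrier add mult l_distr r_distr)
  show ?thesis
    by (intro star_algebra.intro rngB star_algebra_axioms.intro)
      (auto simp: carrier add mult cscale star cscale_closed cscale_add_left cscale_add_right
        cscale_assoc cscale_one cscale_mult_left cscale_mult_right star_closed star_star star_add
        star_cscale star_mult)
qed

locale star_ideal = star_algebra A for A :: "('a, 'm) star_alg_scheme" (structure) +
  fixes I :: "'a set"
  assumes ideal: "ideal I A"
    and star_mem: "a \<in> I \<Longrightarrow> star A a \<in> I"
begin

sublocale ideal I A by (rule ideal)

text \<open>Scaling by \<open>c\<close> is multiplication by \<open>cscale A c \<one>\<close>, so a
  ring ideal is automatically a complex subspace.\<close>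

lemma cscale_mem:
  assumes "a \<in> I"
  shows "cscale A c a \<in> I"
proof -
  have a: "a \<in> carrier A" by (rule a_Hcarr[OF assms])
  then have "cscale A c a = cscale A c \<one> \<otimes> a" by (simp add: cscale_mult_left)
  then show ?thesis using assms by (simp add: I_l_closed cscale_closed)
qed

lemma coset_eq_iff:
  assumes "a \<in> carrier A" "b \<in> carrier A"
  shows "I +> a = I +> b \<longleftrightarrow> a \<ominus> b \<in> I"
  using quotient_eq_iff_same_a_r_cos[OF ideal assms] by simp

lemma coset_memD:
  assumes "a \<in> carrier A" "b \<in> I +> a"
  shows "b \<in> carrier A" "b \<ominus> a \<in> I"
proof -
  show b: "b \<in> carrier A" using a_elemrcos_carrier[OF assms] .
  have "I +> b = I +> a"
    using a_repr_independence[OF assms(2,1) a_subgroup] ..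
  then show "b \<ominus> a \<in> I" using assms b coset_eq_iff by blast
qed

text \<open>Collapses the union over representatives in \<open>star_quotient\<close>: scaling
  preserves \<open>I\<close>, so all representatives contribute the same coset.\<close>

lemma coset_cscale_eq:
  assumes a: "a \<in> carrier A"
  shows "(\<Union>b\<in>I +> a. I +> cscale A c b) = I +> cscale A c a"
proof -
  have "I +> cscale A c b = I +> cscale A c a" if b: "b \<in> I +> a" for b
  proof -
    have b': "b \<in> carrier A" "b \<ominus> a \<in> I" using coset_memD[OF a b] .
    have "cscale A c (b \<ominus> a) = cscale A c b \<ominus> cscale A c a"
      using a b'
      by (simp add: a_minus_def cscale_add_right cscale_minus_one[symmetric] cscale_closed
        cscale_assoc[symmetric] mult.commute)
    then show ?thesis using cscale_mem[OF b'(2), of c] a b' by (simp add: coset_eq_iff cscale_closed)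
  qed
  moreover have "a \<in> I +> a" using a by (rule a_rcos_self)
  ultimately show ?thesis by blast
qed

lemma coset_star_eq:
  assumes a: "a \<in> carrier A"
  shows "(\<Union>b\<in>I +> a. I +> star A b) = I +> star A a"
proof -
  have "I +> star A b = I +> star A a" if b: "b \<in> I +> a" for b
  proof -
    have b': "b \<in> carrier A" "b \<ominus> a \<in> I" using coset_memD[OF a b] .
    have "star A (b \<ominus> a) = star A b \<ominus> star A a"
      using a b'
      by (simp add: a_minus_def star_add cscale_minus_one[symmetric] cscale_closed star_closed
        star_cscale)
    then show ?thesis using star_mem[OF b'(2)] a b' by (simp add: coset_eq_iff star_closed)
  qed
  moreover have "a \<in> I +> a" using a by (rule a_rcos_self)
  ultimately show ?thesis by blast
qed

lemma star_quotient_simps: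
  "carrier (star_quotient A I) = (+>) I ` carrier A"
  "\<one>\<^bsub>star_quotient A I\<^esub> = I +> \<one>"
  "\<zero>\<^bsub>star_quotient A I\<^esub> = I +> \<zero>"
  "a \<in> carrier A \<Longrightarrow> b \<in> carrier A \<Longrightarrow> (I +> a) \<oplus>\<^bsub>star_quotient A I\<^esub> (I +> b) = I +> (a \<oplus> b)"
  "a \<in> carrier A \<Longrightarrow> b \<in> carrier A \<Longrightarrow> (I +> a) \<otimes>\<^bsub>star_quotient A I\<^esub> (I +> b) = I +> (a \<otimes> b)"
  "a \<in> carrier A \<Longrightarrow> cscale (star_quotient A I) c (I +> a) = I +> cscale A c a"
  "a \<in> carrier A \<Longrightarrow> star (star_quotient A I) (I +> a) = I +> star A a"
proof -
  note defs = star_quotient_def ring.defs star_alg.defs FactRing_def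
  show "carrier (star_quotient A I) = (+>) I ` carrier A"
    by (auto simp: defs A_RCOSETS_def RCOSETS_def a_r_coset_def)
  show "\<zero>\<^bsub>star_quotient A I\<^esub> = I +> \<zero>"
    using a_rcos_zero[OF ideal zero_closed] by (simp add: defs a_rcos_const)
  show "a \<in> carrier A \<Longrightarrow> b \<in> carrier A \<Longrightarrow> (I +> a) \<oplus>\<^bsub>star_quotient A I\<^esub> (I +> b) = I +> (a \<oplus> b)"
    by (simp add: defs a_rcos_sum)
  show "\<one>\<^bsub>star_quotient A I\<^esub> = I +> \<one>"
    by (simp add: defs)
  show "a \<in> carrier A \<Longrightarrow> b \<in> carrier A \<Longrightarrow> (I +> a) \<otimes>\<^bsub>star_quotient A I\<^esub> (I +> b) = I +> (a \<otimes> b)"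
    by (simp add: defs rcoset_mult_add)
  show "a \<in> carrier A \<Longrightarrow> cscale (star_quotient A I) c (I +> a) = I +> cscale A c a"
    using coset_cscale_eq[of a c] by (simp add: defs)
  show "a \<in> carrier A \<Longrightarrow> star (star_quotient A I) (I +> a) = I +> star A a"
    using coset_star_eq[of a] by (simp add: defs)
qed

lemma coset_nat_pow:
  assumes "a \<in> carrier A"
  shows "(I +> a) [^]\<^bsub>star_quotient A I\<^esub> (q::nat) = I +> (a [^] q)"
  by (induction q) (simp_all add: nat_pow_def star_quotient_simps nat_pow_closed[unfolded nat_pow_def] assms)

lemma star_algebra_quotient: "star_algebra (star_quotient A I)"
  by (rule star_algebra_image[of A _ "(+>) I"]) 
    (rule star_algebra_axioms star_quotient_simps | assumption)+

end

locale tracial_star_ideal = tracial_star_algebra A \<tau> + star_ideal A I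
  for A :: "('a, 'm) star_alg_scheme" (structure) and \<tau> and I +
  assumes trace_ideal: "a \<in> I \<Longrightarrow> \<tau> a = 0"
begin

text \<open>The encoding is that of \<open>ultraproduct_trace\<close>, so the ultraproduct becomes
  an instance of the general quotient.\<close>

definition quotient_trace :: "'a set \<Rightarrow> complex" where
  "quotient_trace X = the_elem (\<tau> ` X)"

lemma quotient_trace_coset:
  assumes a: "a \<in> carrier A"
  shows "quotient_trace (I +> a) = \<tau> a"
proof -
  have "\<tau> b = \<tau> a" if b: "b \<in> I +> a" for b
  proof -
    have b': "b \<in> carrier A" "b \<ominus> a \<in> I" using coset_memD[OF a b] .
    have "\<tau> (b \<ominus> a) = \<tau> b - \<tau> a"
      using a b' by (simp add: a_minus_def trace_add cscale_minus_one[symmetric] cscale_closed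
        trace_cscale)
    then show ?thesis using trace_ideal[OF b'(2)] by simp
  qed
  then have "\<tau> ` (I +> a) = {\<tau> a}" using a_rcos_self[OF a] by blast
  then show ?thesis by (simp add: quotient_trace_def)
qed

lemma tracial_quotient: "tracial_star_algebra (star_quotient A I) quotient_trace"
proof -
  interpret Q: star_algebra "star_quotient A I" by (rule star_algebra_quotient)
  show ?thesis
    by (intro tracial_star_algebra.intro star_algebra_quotient tracial_star_algebra_axioms.intro)
      (auto simp: star_quotient_simps quotient_trace_coset cscale_closed star_closed trace_add
        trace_cscale trace_one trace_pos intro: trace_comm)
qed

end

section \<open>The null ideal of a positive trace\<close>

context tracial_star_algebra
begin

definition trace_kernel :: "'a set" where
  "trace_kernel = {a \<in> carrier A. \<tau> (star A a \<otimes> a) = 0}"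

text \<open>By Cauchy-Schwarz a null vector is orthogonal to everything, which turns the quadratic
  condition in \<open>trace_kernel\<close> into a linear one.\<close>

lemma trace_kernel_mult:
  assumes "a \<in> trace_kernel" "b \<in> carrier A"
  shows "\<tau> (b \<otimes> a) = 0"
proof -
  have a: "a \<in> carrier A" "\<tau> (star A a \<otimes> a) = 0" using assms by (auto simp: trace_kernel_def)
  then show ?thesis using trace_Cauchy_Schwarz[of "star A b" a] assms(2)
    by (simp add: star_star star_closed)
qed

text \<open>For left multiplication, \<open>star A a \<otimes> star A b \<otimes> b\<close> pairs to
  zero with \<open>a\<close>. Closure under the star is the trace property, and the two together
  give right multiplication.\<close>

lemma tracial_star_ideal_trace_kernel: "tracial_star_ideal A \<tau> trace_kernel"
proof -
  have sub: "a \<in> trace_kernel \<Longrightarrow> a \<in> carrier A" for a by (simp add: trace_kernel_def)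
  have left: "b \<otimes> a \<in> trace_kernel" if "a \<in> trace_kernel" "b \<in> carrier A" for a b
    using that trace_kernel_mult[of a "star A a \<otimes> star A b \<otimes> b"] sub[of a]
    by (simp add: trace_kernel_def star_mult star_closed m_assoc)
  have st: "star A a \<in> trace_kernel" if "a \<in> trace_kernel" for a
    using that trace_comm[of a "star A a"] by (simp add: trace_kernel_def star_star star_closed)
  have right: "a \<otimes> b \<in> trace_kernel" if "a \<in> trace_kernel" "b \<in> carrier A" for a b
    using st[OF left[OF st[OF that(1)], of "star A b"]] that sub
    by (simp add: star_mult star_star star_closed)
  have add: "a \<oplus> b \<in> trace_kernel" if "a \<in> trace_kernel" "b \<in> trace_kernel" for a b
  proof -
    have "\<tau> (star A (a \<oplus> b) \<otimes> (a \<oplus> b)) = \<tau> (star A (a \<oplus> b) \<otimes> a) + \<tau> (star A (a \<oplus> b) \<otimes> b)"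
      using sub[OF that(1)] sub[OF that(2)] by (simp add: r_distr trace_add star_closed)
    also have "\<dots> = 0"
      using that sub[OF that(1)] sub[OF that(2)] by (simp add: trace_kernel_mult star_closed)
    finally show ?thesis using sub[OF that(1)] sub[OF that(2)] by (simp add: trace_kernel_def)
  qed
  have zero: "\<zero> \<in> trace_kernel" by (simp add: trace_kernel_def star_zero trace_zero)
  have "subgroup trace_kernel (add_monoid A)"
  proof (rule add.subgroupI)
    show "\<ominus> a \<in> trace_kernel" if "a \<in> trace_kernel" for a
      using left[OF that, of "\<ominus> \<one>"] sub[OF that] by (simp add: l_minus)
  qed (use sub add zero in auto)
  then have "ideal trace_kernel A"
    by (intro idealI ring_axioms left right)
  moreover have "\<tau> a = 0" if "a \<in> trace_kernel" for a
    using trace_kernel_mult[OF that one_closed] sub[OF that] by simp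
  ultimately show ?thesis
    by (intro tracial_star_ideal.intro tracial_star_algebra_axioms star_ideal.intro
      star_algebra_axioms star_ideal_axioms.intro tracial_star_ideal_axioms.intro st)
qed

end

section \<open>Bounds on words in a tracial star-algebra\<close>

definition list_prod :: "('a, 'm) monoid_scheme \<Rightarrow> 'a list \<Rightarrow> 'a" where
  "list_prod G ys = foldr (\<otimes>\<^bsub>G\<^esub>) ys \<one>\<^bsub>G\<^esub>"

context monoid
begin

lemma list_prod_simps [simp]:
  "list_prod G [] = \<one>" "list_prod G (y # ys) = y \<otimes> list_prod G ys"
  by (simp_all add: list_prod_def)

lemma list_prod_closed: "set ys \<subseteq> carrier G \<Longrightarrow> list_prod G ys \<in> carrier G"
  by (induction ys) auto

lemma list_prod_append:
  "set us \<subseteq> carrier G \<Longrightarrow> set vs \<subseteq> carrier G \<Longrightarrow>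
    list_prod G (us @ vs) = list_prod G us \<otimes> list_prod G vs"
  by (induction us) (simp_all add: list_prod_closed m_assoc)

lemma list_prod_append_ones:
  "set us \<subseteq> carrier G \<Longrightarrow> list_prod G (us @ replicate k \<one>) = list_prod G us"
proof -
  have "list_prod G (replicate k \<one>) = \<one>" by (induction k) auto
  then show "set us \<subseteq> carrier G \<Longrightarrow> ?thesis" by (subst list_prod_append) (auto simp: list_prod_closed)
qed

lemma pow_mult_shift:
  assumes "a \<in> carrier G" "b \<in> carrier G"
  shows "(a \<otimes> b) [^] Suc q = a \<otimes> (b \<otimes> a) [^] q \<otimes> b"
proof (induction q)
  case (Suc q)
  have "(a \<otimes> b) [^] Suc (Suc q) = (a \<otimes> (b \<otimes> a) [^] q \<otimes> b) \<otimes> (a \<otimes> b)"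
    using Suc by (metis nat_pow_Suc)
  also have "\<dots> = a \<otimes> ((b \<otimes> a) [^] q \<otimes> (b \<otimes> a)) \<otimes> b"
    using assms by (simp add: m_assoc)
  finally show ?case by simp
qed (use assms in simp)

end

section \<open>Words, their mirror images and alternating blocks\<close>

context star_algebra
begin

definition star_list :: "'a list \<Rightarrow> 'a list" where
  "star_list ys = rev (map (star A) ys)"

lemma star_list_append: "star_list (us @ vs) = star_list vs @ star_list us"
  by (simp add: star_list_def)

lemma length_star_list [simp]: "length (star_list ys) = length ys"
  by (simp add: star_list_def)

lemma set_star_list: "(\<And>y. y \<in> Y \<Longrightarrow> star A y \<in> Y) \<Longrightarrow> set ys \<subseteq> Y \<Longrightarrow> set (star_list ys) \<subseteq> Y"
  by (auto simp: star_list_def)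

lemma list_prod_star_list:
  assumes "set ys \<subseteq> carrier A"
  shows "list_prod A (star_list ys) = star A (list_prod A ys)"
  using assms
proof (induction ys)
  case (Cons y ys)
  then have "set (star_list ys) \<subseteq> carrier A" by (intro set_star_list) (auto simp: star_closed)
  then show ?case
    using Cons by (simp add: star_list_def list_prod_append star_mult list_prod_closed star_closed)
qed (simp add: star_list_def star_one)

text \<open>From \<open>s = 1\<close> on this is the alternating word y* y y* y ... of length
  \<open>2 ^ s\<close>. It is written as an iterated reflection because reflecting a word is how it
  arises in the chessboard argument.\<close>

primrec block :: "'a \<Rightarrow> nat \<Rightarrow> 'a list" where
  "block y 0 = [y]"
| "block y (Suc s) = star_list (block y s) @ block y s"

lemma length_block [simp]: "length (block y s) = 2 ^ s"
  by (induction s) auto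

lemma set_block: "(\<And>y. y \<in> Y \<Longrightarrow> star A y \<in> Y) \<Longrightarrow> y \<in> Y \<Longrightarrow> set (block y s) \<subseteq> Y"
proof (induction s)
  case (Suc s)
  then show ?case using set_star_list[of Y "block y s"] by simp
qed simp

lemma list_prod_block:
  assumes "y \<in> carrier A"
  shows "list_prod A (block y (Suc s)) = (star A y \<otimes> y) [^] (2 ^ s :: nat)"
proof (induction s)
  case 0
  show ?case using assms by (simp add: star_list_def star_closed)
next
  case (Suc s)
  have c: "set (block y t) \<subseteq> carrier A" for t using assms by (intro set_block) (auto simp: star_closed)
  have "list_prod A (block y (Suc (Suc s)))
    = star A (list_prod A (block y (Suc s))) \<otimes> list_prod A (block y (Suc s))"
    using c[of "Suc s"] set_star_list[OF _ c[of "Suc s"]]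
    by (simp add: list_prod_append list_prod_star_list star_closed del: block.simps
      add: block.simps(2)[of y "Suc s"])
  also have "\<dots> = (star A y \<otimes> y) [^] (2 ^ s :: nat) \<otimes> (star A y \<otimes> y) [^] (2 ^ s :: nat)"
    unfolding Suc using assms by (simp add: star_nat_pow star_closed star_mult star_star)
  also have "\<dots> = (star A y \<otimes> y) [^] (2 ^ Suc s :: nat)"
    using assms by (simp add: nat_pow_mult star_closed mult_2)
  finally show ?case .
qed

end

section \<open>Reflection and chessboard estimates\<close>

context tracial_star_algebra
begin

text \<open>Follows from \<open>pow_mult_shift\<close> by one cyclic rotation. It lets a letter and
  its adjoint share their moment bounds, as alphabets closed under the star require.\<close>

lemma trace_star_power:
  assumes "a \<in> carrier A"
  shows "\<tau> ((a \<otimes> star A a) [^] (q::nat)) = \<tau> ((star A a \<otimes> a) [^] q)"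
proof (cases q)
  case (Suc k)
  have sa: "star A a \<in> carrier A" using assms by (rule star_closed)
  have "\<tau> ((a \<otimes> star A a) [^] Suc k) = \<tau> (a \<otimes> ((star A a \<otimes> a) [^] k \<otimes> star A a))"
    unfolding pow_mult_shift[OF assms sa] using assms sa by (simp add: m_assoc)
  also have "\<dots> = \<tau> ((star A a \<otimes> a) [^] k \<otimes> star A a \<otimes> a)"
    using assms sa by (intro trace_comm) auto
  also have "\<dots> = \<tau> ((star A a \<otimes> a) [^] Suc k)"
    using assms sa by (simp add: m_assoc)
  finally show ?thesis using Suc by simp
qed simp

lemma trace_list_prod_rotate:
  "set us \<subseteq> carrier A \<Longrightarrow> set vs \<subseteq> carrier A \<Longrightarrow>
    \<tau> (list_prod A (us @ vs)) = \<tau> (list_prod A (vs @ us))"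
  by (simp add: list_prod_append list_prod_closed trace_comm)

text \<open>Cauchy-Schwarz for a word cut in two: each piece is completed by its own mirror
  image.\<close>

lemma trace_reflection:
  assumes u: "set us \<subseteq> carrier A" and v: "set vs \<subseteq> carrier A"
  shows "(cmod (\<tau> (list_prod A (us @ vs))))\<^sup>2 \<le>
    cmod (\<tau> (list_prod A (us @ star_list us))) * cmod (\<tau> (list_prod A (star_list vs @ vs)))"
proof -
  let ?u = "list_prod A us" and ?v = "list_prod A vs"
  have c: "?u \<in> carrier A" "?v \<in> carrier A" using u v by (auto simp: list_prod_closed)
  have st: "set (star_list us) \<subseteq> carrier A" "set (star_list vs) \<subseteq> carrier A"
    using set_star_list[OF star_closed u] set_star_list[OF star_closed v] by auto
  have "(cmod (\<tau> (?u \<otimes> ?v)))\<^sup>2 \<le> Re (\<tau> (?u \<otimes> star A ?u)) * Re (\<tau> (star A ?v \<otimes> ?v))"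
    using trace_Cauchy_Schwarz[of "star A ?u" ?v] c by (simp add: star_star star_closed)
  also have "\<dots> \<le> cmod (\<tau> (?u \<otimes> star A ?u)) * cmod (\<tau> (star A ?v \<otimes> ?v))"
    using trace_pos[OF c(2)] by (intro mult_mono complex_Re_le_cmod) (auto simp: less_eq_complex_def)
  finally show ?thesis using u v st by (simp add: list_prod_append list_prod_star_list)
qed

text \<open>A chessboard estimate: among all words of length \<open>2\<^sup>r\<^sup>+\<^sup>1\<close> pick one of maximal trace.
  Reflecting half of the word at the midpoint preserves maximality, and doubles the length of an
  alternating block \<open>y\<^sup>* y y\<^sup>* y \<dots>\<close> until the block is the whole word.\<close>

lemma trace_word_bound:
  assumes Y: "Y \<subseteq> carrier A" "finite Y" "\<And>y. y \<in> Y \<Longrightarrow> star A y \<in> Y"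
    and C: "\<And>y. y \<in> Y \<Longrightarrow> Re (\<tau> ((star A y \<otimes> y) [^] (2 ^ r :: nat))) \<le> C"
    and ys: "length ys = 2 ^ Suc r" "set ys \<subseteq> Y"
  shows "cmod (\<tau> (list_prod A ys)) \<le> C"
proof -
  define L where "L = {ys. set ys \<subseteq> Y \<and> length ys = 2 ^ Suc r}"
  define F where "F = (\<lambda>ys. cmod (\<tau> (list_prod A ys)))"
  define N where "N = Max (F ` L)"
  have fin: "finite (F ` L)" unfolding L_def using finite_lists_length_eq[OF Y(2)] by blast
  have le: "F w \<le> N" if "w \<in> L" for w unfolding N_def using fin that by simp
  have "ys \<in> L" using ys by (simp add: L_def)
  then have "N \<in> F ` L" unfolding N_def using fin by (intro Max_in) auto
  have block: "\<exists>y\<in>Y. \<exists>w. block y s @ w \<in> L \<and> F (block y s @ w) = N" if "s \<le> Suc r" for s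
    using that
  proof (induction s)
    case 0
    obtain w where w: "w \<in> L" "F w = N" using \<open>N \<in> F ` L\<close> by blast
    then obtain y v where "w = y # v" by (cases w) (auto simp: L_def)
    then show ?case using w by (intro bexI[of _ y] exI[of _ v]) (auto simp: L_def)
  next
    case (Suc s)
    then obtain y w where y: "y \<in> Y" and w: "block y s @ w \<in> L" "F (block y s @ w) = N" by auto
    have le_half: "(2::nat) ^ s \<le> 2 ^ r" using Suc.prems by (intro power_increasing) auto
    \<comment> \<open>The cut is at the midpoint; as \<open>s \<le> r\<close>, the block lies
      entirely in the left half \<open>u\<close>.\<close>
    define u' u v where "u' = take (2 ^ r - 2 ^ s) w" and "u = block y s @ u'"
      and "v = drop (2 ^ r - 2 ^ s) w"
    have uv: "block y s @ w = u @ v" by (simp add: u_def u'_def v_def)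
    have len: "length u = 2 ^ r" "length v = 2 ^ r"
      using w(1) le_half by (auto simp: L_def u_def u'_def v_def)
    have sub: "set u \<subseteq> Y" "set v \<subseteq> Y" using w(1) unfolding uv by (auto simp: L_def)
    have sub': "set (star_list u) \<subseteq> Y" "set (star_list v) \<subseteq> Y"
      using set_star_list[OF Y(3) sub(1)] set_star_list[OF Y(3) sub(2)] by auto
    have mem: "u @ star_list u \<in> L" "star_list v @ v \<in> L"
      using len sub sub' by (auto simp: L_def)
    have "N\<^sup>2 \<le> F (u @ star_list u) * F (star_list v @ v)"
      unfolding w(2)[symmetric] uv unfolding F_def
      by (rule trace_reflection) (use sub Y in auto)
    \<comment> \<open>One reflected word is at most the maximum \<open>N\<close>, which forces the
      other to attain it.\<close>
    also have "\<dots> \<le> F (u @ star_list u) * N"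
      using le[OF mem(2)] by (intro mult_left_mono) (auto simp: F_def)
    finally have "N\<^sup>2 \<le> F (u @ star_list u) * N" .
    moreover have "0 \<le> F (u @ star_list u)" by (simp add: F_def)
    ultimately have "N \<le> F (u @ star_list u)"
      by (cases "N > 0") (auto simp: power2_eq_square)
    then have eq: "F (u @ star_list u) = N" using le[OF mem(1)] by simp
    \<comment> \<open>The mirror image of the block stands at the far end; a cyclic rotation moves
      it in front of the block and thereby doubles the block.\<close>
    have split: "u @ star_list u = (block y s @ u' @ star_list u') @ star_list (block y s)"
      by (simp add: u_def star_list_append)
    have "set ((block y s @ u' @ star_list u') @ star_list (block y s)) \<subseteq> carrier A"
      using mem(1) Y(1) unfolding split by (auto simp: L_def)
    then have "F (block y (Suc s) @ (u' @ star_list u')) = N"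
      using eq trace_list_prod_rotate[of "block y s @ u' @ star_list u'" "star_list (block y s)"]
      by (simp add: F_def split)
    moreover have "block y (Suc s) @ (u' @ star_list u') \<in> L"
      using mem(1) unfolding split by (auto simp: L_def)
    ultimately show ?case using y by blast
  qed
  obtain y w where y: "y \<in> Y" and w: "block y (Suc r) @ w \<in> L" "F (block y (Suc r) @ w) = N"
    using block[of "Suc r"] by auto
  \<comment> \<open>The block has length \<open>2 ^ Suc r\<close> and fills the word, so
    \<open>N\<close> is a moment of the single letter \<open>y\<close>.\<close>
  have "w = []" using w(1) by (auto simp: L_def)
  have yc: "y \<in> carrier A" using y Y by auto
  define P where "P = list_prod A (block y r)"
  have c: "set (block y r) \<subseteq> carrier A" using yc by (intro set_block) (auto simp: star_closed)
  have P: "P \<in> carrier A" unfolding P_def using c by (rule list_prod_closed)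
  have "list_prod A (block y (Suc r)) = star A P \<otimes> P"
    using c set_star_list[OF _ c] by (simp add: P_def list_prod_append list_prod_star_list star_closed)
  then have "N = cmod (\<tau> (star A P \<otimes> P))" "(star A y \<otimes> y) [^] (2 ^ r :: nat) = star A P \<otimes> P"
    using w(2) \<open>w = []\<close> list_prod_block[OF yc, of r] by (auto simp: F_def)
  moreover have "cmod (\<tau> (star A P \<otimes> P)) = Re (\<tau> (star A P \<otimes> P))"
    using trace_pos[OF P] by (simp add: less_eq_complex_def cmod_eq_Re)
  ultimately have "N \<le> C" using C[OF y] by simp
  then show ?thesis using le[OF \<open>ys \<in> L\<close>] by (simp add: F_def)
qed

end

section \<open>Bounded products and metric ultraproducts\<close>

locale tracial_family =
  fixes I :: "'i set" and A :: "'i \<Rightarrow> ('a, 'm) star_alg_scheme" and \<tau> :: "'i \<Rightarrow> 'a \<Rightarrow> complex"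
  assumes tracial: "i \<in> I \<Longrightarrow> tracial_star_algebra (A i) (\<tau> i)"
begin

lemma star_alg: "i \<in> I \<Longrightarrow> star_algebra (A i)"
  using tracial tracial_star_algebra.axioms(1) by blast

lemma rng: "i \<in> I \<Longrightarrow> ring (A i)"
  using star_alg star_algebra.axioms(1) by blast

lemma mon: "i \<in> I \<Longrightarrow> monoid (A i)"
  using rng ring.is_monoid by blast

abbreviation BP where "BP \<equiv> bounded_product I A \<tau>"

text \<open>With \<open>p = 2 * q\<close>, taking roots or powers preserves boundedness, so the
  norms may be replaced by moments, which are traces of words.\<close>

lemma carrier_BP_iff:
  "a \<in> carrier BP \<longleftrightarrow> a \<in> (\<Pi>\<^sub>E i\<in>I. carrier (A i)) \<and>
    (\<forall>q\<ge>1. \<exists>C. \<forall>i\<in>I. \<bar>Re (\<tau> i ((star (A i) (a i) \<otimes>\<^bsub>A i\<^esub> a i) [^]\<^bsub>A i\<^esub> (q::nat)))\<bar> \<le> C)"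
proof -
  define f where "f q i = Re (\<tau> i ((star (A i) (a i) \<otimes>\<^bsub>A i\<^esub> a i) [^]\<^bsub>A i\<^esub> (q::nat)))" for q i
  have "(\<exists>C. \<forall>i\<in>I. \<bar>root (2 * q) (f q i)\<bar> \<le> C) \<longleftrightarrow> (\<exists>C. \<forall>i\<in>I. \<bar>f q i\<bar> \<le> C)" if "q \<ge> 1" for q
  proof
    assume "\<exists>C. \<forall>i\<in>I. \<bar>root (2 * q) (f q i)\<bar> \<le> C"
    then obtain C where C: "\<And>i. i \<in> I \<Longrightarrow> \<bar>root (2 * q) (f q i)\<bar> \<le> C" by blast
    have "\<bar>f q i\<bar> \<le> C ^ (2 * q)" if "i \<in> I" for i
    proof -
      have "\<bar>f q i\<bar> = root (2 * q) \<bar>f q i\<bar> ^ (2 * q)"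
        using \<open>q \<ge> 1\<close> by (intro real_root_pow_pos2[symmetric]) auto
      also have "\<dots> \<le> C ^ (2 * q)"
        using C[OF that] \<open>q \<ge> 1\<close> by (intro power_mono) (auto simp: real_root_abs)
      finally show ?thesis .
    qed
    then show "\<exists>C. \<forall>i\<in>I. \<bar>f q i\<bar> \<le> C" by blast
  next
    assume "\<exists>C. \<forall>i\<in>I. \<bar>f q i\<bar> \<le> C"
    then obtain C where C: "\<And>i. i \<in> I \<Longrightarrow> \<bar>f q i\<bar> \<le> C" by blast
    have "\<bar>root (2 * q) (f q i)\<bar> \<le> root (2 * q) C" if "i \<in> I" for i
      using C[OF that] \<open>q \<ge> 1\<close> by (simp add: real_root_abs[symmetric])
    then show "\<exists>C. \<forall>i\<in>I. \<bar>root (2 * q) (f q i)\<bar> \<le> C" by blast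
  qed
  then have "(\<forall>p. even p \<and> p \<ge> 2 \<longrightarrow> (\<exists>C. \<forall>i\<in>I. \<bar>root p (f (p div 2) i)\<bar> \<le> C)) \<longleftrightarrow>
      (\<forall>q\<ge>1. \<exists>C. \<forall>i\<in>I. \<bar>f q i\<bar> \<le> C)"
    by (auto elim!: evenE) (metis One_nat_def Suc_le_eq dvd_triv_left mult_le_mono2 nat_mult_1_right
      nonzero_mult_div_cancel_left zero_neq_numeral)
  then show ?thesis by (simp add: bounded_product_def trace_norm_def f_def)
qed

lemma BP_mem: "a \<in> carrier BP \<Longrightarrow> i \<in> I \<Longrightarrow> a i \<in> carrier (A i)"
  by (auto simp: carrier_BP_iff)

lemma BP_ext: "a \<in> carrier BP \<Longrightarrow> b \<in> carrier BP \<Longrightarrow> (\<And>i. i \<in> I \<Longrightarrow> a i = b i) \<Longrightarrow> a = b"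
  unfolding carrier_BP_iff by (rule PiE_ext) auto

lemma BP_simps:
  "\<one>\<^bsub>BP\<^esub> = (\<lambda>i\<in>I. \<one>\<^bsub>A i\<^esub>)" "\<zero>\<^bsub>BP\<^esub> = (\<lambda>i\<in>I. \<zero>\<^bsub>A i\<^esub>)"
  "a \<otimes>\<^bsub>BP\<^esub> b = (\<lambda>i\<in>I. a i \<otimes>\<^bsub>A i\<^esub> b i)" "a \<oplus>\<^bsub>BP\<^esub> b = (\<lambda>i\<in>I. a i \<oplus>\<^bsub>A i\<^esub> b i)"
  "cscale BP c a = (\<lambda>i\<in>I. cscale (A i) c (a i))" "star BP a = (\<lambda>i\<in>I. star (A i) (a i))"
  by (simp_all add: bounded_product_def)

section \<open>Uniform moment bounds and multipliers\<close>

definition letter_family :: "('i \<Rightarrow> 'a set) \<Rightarrow> bool" where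
  "letter_family Y \<longleftrightarrow> (\<forall>i\<in>I. Y i \<subseteq> carrier (A i) \<and> finite (Y i) \<and> \<one>\<^bsub>A i\<^esub> \<in> Y i \<and>
      (\<forall>y\<in>Y i. star (A i) y \<in> Y i)) \<and>
    (\<forall>q\<ge>1. \<exists>C. \<forall>i\<in>I. \<forall>y\<in>Y i.
      Re (\<tau> i ((star (A i) y \<otimes>\<^bsub>A i\<^esub> y) [^]\<^bsub>A i\<^esub> (q::nat))) \<le> C)"

definition word_bounded :: "('i \<Rightarrow> 'a set) \<Rightarrow> ('i \<Rightarrow> 'a) \<Rightarrow> bool" where
  "word_bounded Y f \<longleftrightarrow> (\<forall>i\<in>I. f i \<in> carrier (A i)) \<and>
    (\<forall>m. \<exists>C. \<forall>i\<in>I. \<forall>ys. length ys = m \<longrightarrow> set ys \<subseteq> Y i \<longrightarrow>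
      cmod (\<tau> i (list_prod (A i) ys \<otimes>\<^bsub>A i\<^esub> f i)) \<le> C)"

text \<open>Stated through its action on \<open>word_bounded\<close> families so that products, sums
  and scalar multiples of multipliers are again multipliers without expanding anything into
  words.\<close>

definition multiplier :: "('i \<Rightarrow> 'a set) \<Rightarrow> ('i \<Rightarrow> 'a) \<Rightarrow> bool" where
  "multiplier Y z \<longleftrightarrow> (\<forall>i\<in>I. z i \<in> carrier (A i)) \<and>
    (\<forall>f. word_bounded Y f \<longrightarrow> word_bounded Y (\<lambda>i. z i \<otimes>\<^bsub>A i\<^esub> f i))"

lemma letter_familyD:
  assumes "letter_family Y" "i \<in> I"
  shows "Y i \<subseteq> carrier (A i)" "finite (Y i)" "\<one>\<^bsub>A i\<^esub> \<in> Y i" "y \<in> Y i \<Longrightarrow> star (A i) y \<in> Y i"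
  using assms by (simp_all add: letter_family_def)

lemma word_bounded_carrier: "word_bounded Y f \<Longrightarrow> i \<in> I \<Longrightarrow> f i \<in> carrier (A i)"
  by (simp add: word_bounded_def)

lemma multiplier_carrier: "multiplier Y z \<Longrightarrow> i \<in> I \<Longrightarrow> z i \<in> carrier (A i)"
  by (simp add: multiplier_def)

lemma word_bounded_one:
  assumes Y: "letter_family Y"
  shows "word_bounded Y (\<lambda>i. \<one>\<^bsub>A i\<^esub>)"
  unfolding word_bounded_def
proof (intro conjI ballI allI)
  fix m
  have "(1::nat) \<le> 2 ^ m" by simp
  then obtain C where C: "\<And>i y. i \<in> I \<Longrightarrow> y \<in> Y i \<Longrightarrow>
      Re (\<tau> i ((star (A i) y \<otimes>\<^bsub>A i\<^esub> y) [^]\<^bsub>A i\<^esub> (2 ^ m :: nat))) \<le> C"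
    using Y unfolding letter_family_def by blast
  have "cmod (\<tau> i (list_prod (A i) ys \<otimes>\<^bsub>A i\<^esub> \<one>\<^bsub>A i\<^esub>)) \<le> C"
    if i: "i \<in> I" and ys: "length ys = m" "set ys \<subseteq> Y i" for i ys
  proof -
    interpret tracial_star_algebra "A i" "\<tau> i" using i by (rule tracial)
    note Yi = letter_familyD[OF Y i]
    \<comment> \<open>Padding with the letter one brings a word of length \<open>m\<close> to a
      power of two, as \<open>trace_word_bound\<close> requires; here its \<open>r\<close> is
      \<open>m\<close>.\<close>
    have m: "m \<le> 2 ^ Suc m" using less_exp[of "Suc m"] by linarith
    let ?zs = "ys @ replicate (2 ^ Suc m - m) \<one>\<^bsub>A i\<^esub>"
    have "cmod (\<tau> i (list_prod (A i) ?zs)) \<le> C"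
      using m ys Yi by (intro trace_word_bound[OF Yi(1,2,4) C[OF i]]) auto
    then show ?thesis using ys Yi by (simp add: list_prod_append_ones list_prod_closed subset_trans)
  qed
  then show "\<exists>C. \<forall>i\<in>I. \<forall>ys. length ys = m \<longrightarrow> set ys \<subseteq> Y i \<longrightarrow>
      cmod (\<tau> i (list_prod (A i) ys \<otimes>\<^bsub>A i\<^esub> \<one>\<^bsub>A i\<^esub>)) \<le> C" by blast
next
  fix i assume "i \<in> I" then show "\<one>\<^bsub>A i\<^esub> \<in> carrier (A i)" by (simp add: mon monoid.one_closed)
qed

lemma multiplier_letter:
  assumes Y: "letter_family Y" and z: "\<And>i. i \<in> I \<Longrightarrow> z i \<in> Y i"
  shows "multiplier Y z"
  unfolding multiplier_def
proof (intro conjI ballI allI impI)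
  fix i assume "i \<in> I" then show "z i \<in> carrier (A i)" using z letter_familyD(1)[OF Y] by auto
next
  fix f assume f: "word_bounded Y f"
  show "word_bounded Y (\<lambda>i. z i \<otimes>\<^bsub>A i\<^esub> f i)"
    unfolding word_bounded_def
  proof (intro conjI ballI allI)
    fix i assume i: "i \<in> I"
    interpret tracial_star_algebra "A i" "\<tau> i" using i by (rule tracial)
    show "z i \<otimes>\<^bsub>A i\<^esub> f i \<in> carrier (A i)"
      using z[OF i] letter_familyD(1)[OF Y i] word_bounded_carrier[OF f i] by auto
  next
    fix m
    obtain C where C: "\<And>i ys. i \<in> I \<Longrightarrow> length ys = Suc m \<Longrightarrow> set ys \<subseteq> Y i \<Longrightarrow>
        cmod (\<tau> i (list_prod (A i) ys \<otimes>\<^bsub>A i\<^esub> f i)) \<le> C"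
      using f unfolding word_bounded_def by meson
    have "cmod (\<tau> i (list_prod (A i) ys \<otimes>\<^bsub>A i\<^esub> (z i \<otimes>\<^bsub>A i\<^esub> f i))) \<le> C"
      if i: "i \<in> I" and ys: "length ys = m" "set ys \<subseteq> Y i" for i ys
    proof -
      interpret tracial_star_algebra "A i" "\<tau> i" using i by (rule tracial)
      have "set ys \<subseteq> carrier (A i)" "z i \<in> carrier (A i)" "f i \<in> carrier (A i)"
        using z[OF i] letter_familyD(1)[OF Y i] word_bounded_carrier[OF f i] ys by auto
      then have "list_prod (A i) ys \<otimes>\<^bsub>A i\<^esub> (z i \<otimes>\<^bsub>A i\<^esub> f i) = list_prod (A i) (ys @ [z i]) \<otimes>\<^bsub>A i\<^esub> f i"
        by (simp add: list_prod_append list_prod_closed m_assoc)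
      then show ?thesis using C[OF i, of "ys @ [z i]"] ys z[OF i] by simp
    qed
    then show "\<exists>C. \<forall>i\<in>I. \<forall>ys. length ys = m \<longrightarrow> set ys \<subseteq> Y i \<longrightarrow>
        cmod (\<tau> i (list_prod (A i) ys \<otimes>\<^bsub>A i\<^esub> (z i \<otimes>\<^bsub>A i\<^esub> f i))) \<le> C" by blast
  qed
qed

lemma word_bounded_cong:
  "(\<And>i. i \<in> I \<Longrightarrow> f i = g i) \<Longrightarrow> word_bounded Y f \<longleftrightarrow> word_bounded Y g"
  by (simp add: word_bounded_def)

lemma multiplier_mult:
  assumes "multiplier Y z" "multiplier Y w"
  shows "multiplier Y (\<lambda>i. z i \<otimes>\<^bsub>A i\<^esub> w i)"
  unfolding multiplier_def
proof (intro conjI ballI allI impI)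
  fix i assume i: "i \<in> I"
  interpret tracial_star_algebra "A i" "\<tau> i" using i by (rule tracial)
  show "z i \<otimes>\<^bsub>A i\<^esub> w i \<in> carrier (A i)" using assms i by (auto dest: multiplier_carrier)
next
  fix f assume f: "word_bounded Y f"
  then have "word_bounded Y (\<lambda>i. z i \<otimes>\<^bsub>A i\<^esub> (w i \<otimes>\<^bsub>A i\<^esub> f i))"
    using assms unfolding multiplier_def by blast
  moreover have "z i \<otimes>\<^bsub>A i\<^esub> (w i \<otimes>\<^bsub>A i\<^esub> f i) = z i \<otimes>\<^bsub>A i\<^esub> w i \<otimes>\<^bsub>A i\<^esub> f i" if i: "i \<in> I" for i
    using assms f i by (simp add: monoid.m_assoc[OF mon] multiplier_carrier word_bounded_carrier)
  ultimately show "word_bounded Y (\<lambda>i. z i \<otimes>\<^bsub>A i\<^esub> w i \<otimes>\<^bsub>A i\<^esub> f i)"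
    by (subst word_bounded_cong) auto
qed

lemma word_bounded_add:
  assumes Y: "letter_family Y" and f: "word_bounded Y f" and g: "word_bounded Y g"
  shows "word_bounded Y (\<lambda>i. f i \<oplus>\<^bsub>A i\<^esub> g i)"
  unfolding word_bounded_def
proof (intro conjI ballI allI)
  fix i assume i: "i \<in> I"
  interpret tracial_star_algebra "A i" "\<tau> i" using i by (rule tracial)
  show "f i \<oplus>\<^bsub>A i\<^esub> g i \<in> carrier (A i)" using f g i by (auto dest: word_bounded_carrier)
next
  fix m
  obtain C where C: "\<And>i ys. i \<in> I \<Longrightarrow> length ys = m \<Longrightarrow> set ys \<subseteq> Y i \<Longrightarrow>
      cmod (\<tau> i (list_prod (A i) ys \<otimes>\<^bsub>A i\<^esub> f i)) \<le> C"
    using f unfolding word_bounded_def by meson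
  obtain D where D: "\<And>i ys. i \<in> I \<Longrightarrow> length ys = m \<Longrightarrow> set ys \<subseteq> Y i \<Longrightarrow>
      cmod (\<tau> i (list_prod (A i) ys \<otimes>\<^bsub>A i\<^esub> g i)) \<le> D"
    using g unfolding word_bounded_def by meson
  have "cmod (\<tau> i (list_prod (A i) ys \<otimes>\<^bsub>A i\<^esub> (f i \<oplus>\<^bsub>A i\<^esub> g i))) \<le> C + D"
    if i: "i \<in> I" and ys: "length ys = m" "set ys \<subseteq> Y i" for i ys
  proof -
    interpret tracial_star_algebra "A i" "\<tau> i" using i by (rule tracial)
    have "set ys \<subseteq> carrier (A i)" "f i \<in> carrier (A i)" "g i \<in> carrier (A i)"
      using letter_familyD(1)[OF Y i] word_bounded_carrier[OF f i] word_bounded_carrier[OF g i] ys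
      by auto
    then show ?thesis
      using norm_triangle_mono[OF C[OF i ys] D[OF i ys]]
      by (simp add: r_distr list_prod_closed trace_add)
  qed
  then show "\<exists>C. \<forall>i\<in>I. \<forall>ys. length ys = m \<longrightarrow> set ys \<subseteq> Y i \<longrightarrow>
      cmod (\<tau> i (list_prod (A i) ys \<otimes>\<^bsub>A i\<^esub> (f i \<oplus>\<^bsub>A i\<^esub> g i))) \<le> C" by blast
qed

lemma word_bounded_cscale:
  assumes Y: "letter_family Y" and f: "word_bounded Y f"
  shows "word_bounded Y (\<lambda>i. cscale (A i) c (f i))"
  unfolding word_bounded_def
proof (intro conjI ballI allI)
  fix i assume i: "i \<in> I"
  interpret tracial_star_algebra "A i" "\<tau> i" using i by (rule tracial)
  show "cscale (A i) c (f i) \<in> carrier (A i)"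
    using f i by (auto dest: word_bounded_carrier intro: cscale_closed)
next
  fix m
  obtain C where C: "\<And>i ys. i \<in> I \<Longrightarrow> length ys = m \<Longrightarrow> set ys \<subseteq> Y i \<Longrightarrow>
      cmod (\<tau> i (list_prod (A i) ys \<otimes>\<^bsub>A i\<^esub> f i)) \<le> C"
    using f unfolding word_bounded_def by meson
  have "cmod (\<tau> i (list_prod (A i) ys \<otimes>\<^bsub>A i\<^esub> cscale (A i) c (f i))) \<le> cmod c * C"
    if i: "i \<in> I" and ys: "length ys = m" "set ys \<subseteq> Y i" for i ys
  proof -
    interpret tracial_star_algebra "A i" "\<tau> i" using i by (rule tracial)
    have "set ys \<subseteq> carrier (A i)" "f i \<in> carrier (A i)"
      using letter_familyD(1)[OF Y i] word_bounded_carrier[OF f i] ys by auto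
    then show ?thesis
      using C[OF i ys]
      by (simp add: cscale_mult_right list_prod_closed trace_cscale norm_mult mult_left_mono)
  qed
  then show "\<exists>C. \<forall>i\<in>I. \<forall>ys. length ys = m \<longrightarrow> set ys \<subseteq> Y i \<longrightarrow>
      cmod (\<tau> i (list_prod (A i) ys \<otimes>\<^bsub>A i\<^esub> cscale (A i) c (f i))) \<le> C" by blast
qed

lemma multiplier_add:
  assumes Y: "letter_family Y" and "multiplier Y z" "multiplier Y w"
  shows "multiplier Y (\<lambda>i. z i \<oplus>\<^bsub>A i\<^esub> w i)"
  unfolding multiplier_def
proof (intro conjI ballI allI impI)
  fix i assume i: "i \<in> I"
  interpret tracial_star_algebra "A i" "\<tau> i" using i by (rule tracial)
  show "z i \<oplus>\<^bsub>A i\<^esub> w i \<in> carrier (A i)" using assms i by (auto dest: multiplier_carrier)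
next
  fix f assume f: "word_bounded Y f"
  then have "word_bounded Y (\<lambda>i. z i \<otimes>\<^bsub>A i\<^esub> f i \<oplus>\<^bsub>A i\<^esub> w i \<otimes>\<^bsub>A i\<^esub> f i)"
    using assms unfolding multiplier_def by (intro word_bounded_add) auto
  moreover have "z i \<otimes>\<^bsub>A i\<^esub> f i \<oplus>\<^bsub>A i\<^esub> w i \<otimes>\<^bsub>A i\<^esub> f i = (z i \<oplus>\<^bsub>A i\<^esub> w i) \<otimes>\<^bsub>A i\<^esub> f i"
    if i: "i \<in> I" for i
    using assms f i
    by (simp add: ring.ring_simprules(13)[OF rng] multiplier_carrier word_bounded_carrier)
  ultimately show "word_bounded Y (\<lambda>i. (z i \<oplus>\<^bsub>A i\<^esub> w i) \<otimes>\<^bsub>A i\<^esub> f i)"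
    by (subst word_bounded_cong) auto
qed

lemma multiplier_cscale:
  assumes Y: "letter_family Y" and "multiplier Y z"
  shows "multiplier Y (\<lambda>i. cscale (A i) c (z i))"
  unfolding multiplier_def
proof (intro conjI ballI allI impI)
  fix i assume i: "i \<in> I"
  interpret tracial_star_algebra "A i" "\<tau> i" using i by (rule tracial)
  show "cscale (A i) c (z i) \<in> carrier (A i)"
    using assms i by (auto dest: multiplier_carrier intro: cscale_closed)
next
  fix f assume f: "word_bounded Y f"
  then have "word_bounded Y (\<lambda>i. cscale (A i) c (z i \<otimes>\<^bsub>A i\<^esub> f i))"
    using assms unfolding multiplier_def by (intro word_bounded_cscale) auto
  moreover have "cscale (A i) c (z i \<otimes>\<^bsub>A i\<^esub> f i) = cscale (A i) c (z i) \<otimes>\<^bsub>A i\<^esub> f i"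
    if i: "i \<in> I" for i
    using assms f i
    by (simp add: star_algebra.cscale_mult_left[OF star_alg] multiplier_carrier word_bounded_carrier)
  ultimately show "word_bounded Y (\<lambda>i. cscale (A i) c (z i) \<otimes>\<^bsub>A i\<^esub> f i)"
    by (subst word_bounded_cong) auto
qed

lemma multiplier_pow:
  assumes Y: "letter_family Y" and z: "multiplier Y z"
  shows "multiplier Y (\<lambda>i. z i [^]\<^bsub>A i\<^esub> (q::nat))"
proof (induction q)
  case 0
  show ?case
    using multiplier_letter[OF Y, of "\<lambda>i. \<one>\<^bsub>A i\<^esub>"] letter_familyD(3)[OF Y]
    by (simp add: nat_pow_def)
next
  case (Suc q)
  then show ?case using multiplier_mult[OF Suc z] by (simp add: nat_pow_def)
qed

text \<open>The bound is the multiplier property at the constant family one, read against the empty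
  word.\<close>

lemma multiplier_trace_bounded:
  assumes Y: "letter_family Y" and z: "multiplier Y z"
  shows "\<exists>C. \<forall>i\<in>I. cmod (\<tau> i (z i)) \<le> C"
proof -
  have "word_bounded Y (\<lambda>i. z i \<otimes>\<^bsub>A i\<^esub> \<one>\<^bsub>A i\<^esub>)"
    using z word_bounded_one[OF Y] unfolding multiplier_def by blast
  then obtain C where C: "\<And>i. i \<in> I \<Longrightarrow>
      cmod (\<tau> i (list_prod (A i) [] \<otimes>\<^bsub>A i\<^esub> (z i \<otimes>\<^bsub>A i\<^esub> \<one>\<^bsub>A i\<^esub>))) \<le> C"
    unfolding word_bounded_def by (metis empty_subsetI list.set(1))
  have "cmod (\<tau> i (z i)) \<le> C" if i: "i \<in> I" for i
  proof -
    interpret tracial_star_algebra "A i" "\<tau> i" using i by (rule tracial)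
    show ?thesis using C[OF i] multiplier_carrier[OF z i] by simp
  qed
  then show ?thesis by blast
qed

lemma BP_memI:
  assumes Y: "letter_family Y" and z: "multiplier Y z" and sz: "multiplier Y (\<lambda>i. star (A i) (z i))"
  shows "restrict z I \<in> carrier BP"
  unfolding carrier_BP_iff
proof (intro conjI allI impI)
  show "restrict z I \<in> (\<Pi>\<^sub>E i\<in>I. carrier (A i))" using z by (auto dest: multiplier_carrier)
  fix q :: nat
  obtain C where C: "\<And>i. i \<in> I \<Longrightarrow>
      cmod (\<tau> i ((star (A i) (z i) \<otimes>\<^bsub>A i\<^esub> z i) [^]\<^bsub>A i\<^esub> q)) \<le> C"
    using multiplier_trace_bounded[OF Y multiplier_pow[OF Y multiplier_mult[OF sz z], of q]] by blast
  then show "\<exists>C. \<forall>i\<in>I. \<bar>Re (\<tau> i ((star (A i) (restrict z I i) \<otimes>\<^bsub>A i\<^esub> restrict z I i)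
      [^]\<^bsub>A i\<^esub> q))\<bar> \<le> C"
    by (intro exI[of _ C] ballI order_trans[OF abs_Re_le_cmod]) simp
qed

text \<open>A letter and its adjoint have equal moments by \<open>trace_star_power\<close>, and all
  moments of the letter one are 1; hence the constant \<open>max 1 (max C D)\<close>.\<close>

lemma letter_family_pair:
  assumes a: "a \<in> carrier BP" and b: "b \<in> carrier BP"
  shows "letter_family (\<lambda>i. {\<one>\<^bsub>A i\<^esub>, a i, star (A i) (a i), b i, star (A i) (b i)})"
    (is "letter_family ?Y")
  unfolding letter_family_def
proof (intro conjI ballI allI impI)
  fix q :: nat assume q: "1 \<le> q"
  obtain C where C: "\<And>i. i \<in> I \<Longrightarrow>
      \<bar>Re (\<tau> i ((star (A i) (a i) \<otimes>\<^bsub>A i\<^esub> a i) [^]\<^bsub>A i\<^esub> q))\<bar> \<le> C"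
    using a q unfolding carrier_BP_iff by blast
  obtain D where D: "\<And>i. i \<in> I \<Longrightarrow>
      \<bar>Re (\<tau> i ((star (A i) (b i) \<otimes>\<^bsub>A i\<^esub> b i) [^]\<^bsub>A i\<^esub> q))\<bar> \<le> D"
    using b q unfolding carrier_BP_iff by blast
  have "Re (\<tau> i ((star (A i) y \<otimes>\<^bsub>A i\<^esub> y) [^]\<^bsub>A i\<^esub> q)) \<le> max 1 (max C D)"
    if i: "i \<in> I" and y: "y \<in> ?Y i" for i y
  proof -
    interpret tracial_star_algebra "A i" "\<tau> i" using i by (rule tracial)
    have ab: "a i \<in> carrier (A i)" "b i \<in> carrier (A i)" using a b i by (auto simp: BP_mem)
    show ?thesis
      using y C[OF i] D[OF i] ab trace_star_power[OF ab(1), of q] trace_star_power[OF ab(2), of q]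
      by (auto simp: star_one trace_one star_star star_closed)
  qed
  then show "\<exists>C. \<forall>i\<in>I. \<forall>y\<in>?Y i. Re (\<tau> i ((star (A i) y \<otimes>\<^bsub>A i\<^esub> y) [^]\<^bsub>A i\<^esub> q)) \<le> C"
    by blast
next
  fix i assume i: "i \<in> I"
  interpret tracial_star_algebra "A i" "\<tau> i" using i by (rule tracial)
  have ab: "a i \<in> carrier (A i)" "b i \<in> carrier (A i)" using a b i by (auto simp: BP_mem)
  then show "?Y i \<subseteq> carrier (A i)" by (auto simp: star_closed)
  show "star (A i) y \<in> ?Y i" if "y \<in> ?Y i" for y using that ab by (auto simp: star_one star_star)
qed auto

lemma multiplier_cong:
  "(\<And>i. i \<in> I \<Longrightarrow> f i = g i) \<Longrightarrow> multiplier Y f \<longleftrightarrow> multiplier Y g"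
  unfolding multiplier_def by (intro conj_cong all_cong imp_cong refl word_bounded_cong) auto

text \<open>Here the multipliers replace Hoelder's inequality: the results are multipliers over the
  alphabet formed by one, \<open>a\<close>, \<open>b\<close> and their adjoints, so all their
  moments are bounded.\<close>

lemma BP_closed:
  assumes a: "a \<in> carrier BP" and b: "b \<in> carrier BP"
  shows "a \<oplus>\<^bsub>BP\<^esub> b \<in> carrier BP" "a \<otimes>\<^bsub>BP\<^esub> b \<in> carrier BP" "cscale BP c a \<in> carrier BP"
    "star BP a \<in> carrier BP"
proof -
  let ?Y = "\<lambda>i. {\<one>\<^bsub>A i\<^esub>, a i, star (A i) (a i), b i, star (A i) (b i)}"
  note Y = letter_family_pair[OF a b]
  have mem: "a i \<in> carrier (A i)" "b i \<in> carrier (A i)" if "i \<in> I" for i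
    using a b that by (auto simp: BP_mem)
  have m: "multiplier ?Y a" "multiplier ?Y b"
    "multiplier ?Y (\<lambda>i. star (A i) (a i))" "multiplier ?Y (\<lambda>i. star (A i) (b i))"
    by (rule multiplier_letter[OF Y]; simp)+
  note ops = star_algebra.star_add[OF star_alg] star_algebra.star_mult[OF star_alg]
    star_algebra.star_cscale[OF star_alg] star_algebra.star_star[OF star_alg]
  show "a \<oplus>\<^bsub>BP\<^esub> b \<in> carrier BP"
    unfolding BP_simps
    using multiplier_add[OF Y m(3,4)]
    by (intro BP_memI[OF Y multiplier_add[OF Y m(1,2)]])
      (subst multiplier_cong, auto simp: ops mem)
  show "a \<otimes>\<^bsub>BP\<^esub> b \<in> carrier BP"
    unfolding BP_simps
    using multiplier_mult[OF m(4,3)]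
    by (intro BP_memI[OF Y multiplier_mult[OF m(1,2)]])
      (subst multiplier_cong, auto simp: ops mem)
  show "cscale BP c a \<in> carrier BP"
    unfolding BP_simps
    using multiplier_cscale[OF Y m(3), of "cnj c"]
    by (intro BP_memI[OF Y multiplier_cscale[OF Y m(1)]])
      (subst multiplier_cong, auto simp: ops mem)
  show "star BP a \<in> carrier BP"
    unfolding BP_simps
    using m(1)
    by (intro BP_memI[OF Y m(3)])
      (subst multiplier_cong, auto simp: ops mem)
qed

lemma BP_one_closed: "\<one>\<^bsub>BP\<^esub> \<in> carrier BP"
  unfolding carrier_BP_iff
proof (intro conjI allI impI)
  show "\<one>\<^bsub>BP\<^esub> \<in> (\<Pi>\<^sub>E i\<in>I. carrier (A i))"
    by (auto simp: BP_simps mon monoid.one_closed)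
  fix q :: nat
  have "\<tau> i ((star (A i) (\<one>\<^bsub>BP\<^esub> i) \<otimes>\<^bsub>A i\<^esub> \<one>\<^bsub>BP\<^esub> i) [^]\<^bsub>A i\<^esub> q) = 1" if i: "i \<in> I" for i
  proof -
    interpret tracial_star_algebra "A i" "\<tau> i" using i by (rule tracial)
    show ?thesis using i by (simp add: BP_simps star_one trace_one)
  qed
  then show "\<exists>C. \<forall>i\<in>I. \<bar>Re (\<tau> i ((star (A i) (\<one>\<^bsub>BP\<^esub> i) \<otimes>\<^bsub>A i\<^esub> \<one>\<^bsub>BP\<^esub> i) [^]\<^bsub>A i\<^esub> q))\<bar> \<le> C"
    by (intro exI[of _ 1]) simp
qed

lemma BP_zero_closed: "\<zero>\<^bsub>BP\<^esub> \<in> carrier BP"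
proof -
  have "\<zero>\<^bsub>BP\<^esub> = cscale BP 0 \<one>\<^bsub>BP\<^esub>"
    by (rule ext) (simp add: BP_simps star_algebra.cscale_zero_left[OF star_alg] mon monoid.one_closed)
  then show ?thesis using BP_closed(3)[OF BP_one_closed BP_one_closed, of 0] by simp
qed

lemma BP_apply:
  assumes "i \<in> I"
  shows "\<one>\<^bsub>BP\<^esub> i = \<one>\<^bsub>A i\<^esub>" "\<zero>\<^bsub>BP\<^esub> i = \<zero>\<^bsub>A i\<^esub>" "(a \<otimes>\<^bsub>BP\<^esub> b) i = a i \<otimes>\<^bsub>A i\<^esub> b i"
    "(a \<oplus>\<^bsub>BP\<^esub> b) i = a i \<oplus>\<^bsub>A i\<^esub> b i" "cscale BP c a i = cscale (A i) c (a i)"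
    "star BP a i = star (A i) (a i)"
  using assms by (simp_all add: BP_simps)

lemma star_algebra_BP: "star_algebra BP"
proof -
  have closed: "u \<oplus>\<^bsub>BP\<^esub> v \<in> carrier BP" "u \<otimes>\<^bsub>BP\<^esub> v \<in> carrier BP" "cscale BP c u \<in> carrier BP"
    "star BP u \<in> carrier BP" if "u \<in> carrier BP" "v \<in> carrier BP" for u v c
    using that by (rule BP_closed)+
  note closed' = closed(1,2) closed(3,4)[OF _ BP_one_closed] BP_one_closed BP_zero_closed
  note R = ring.ring_simprules(7,8,9,11-13,23)[OF rng] ring.ring_simprules(1,3,5)[OF rng]
    monoid.r_one[OF mon] star_algebra.cscale_minus_one[OF star_alg]
    star_algebra.cscale_add_left[OF star_alg] star_algebra.cscale_add_right[OF star_alg]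
    star_algebra.cscale_assoc[OF star_alg] star_algebra.cscale_one[OF star_alg]
    star_algebra.cscale_mult_left[OF star_alg] star_algebra.cscale_mult_right[OF star_alg]
    star_algebra.star_star[OF star_alg] star_algebra.star_add[OF star_alg]
    star_algebra.star_cscale[OF star_alg] star_algebra.star_mult[OF star_alg]
  have ring_BP: "ring BP"
  proof (rule ringI)
    show "abelian_group BP"
    proof (rule abelian_groupI)
      fix u assume "u \<in> carrier BP"
      then show "\<exists>v\<in>carrier BP. v \<oplus>\<^bsub>BP\<^esub> u = \<zero>\<^bsub>BP\<^esub>"
        by (intro bexI[of _ "cscale BP (-1) u"] BP_ext closed') (simp_all add: BP_apply BP_mem R)
    next
      fix u v assume "u \<in> carrier BP" "v \<in> carrier BP"
      then show "u \<oplus>\<^bsub>BP\<^esub> v = v \<oplus>\<^bsub>BP\<^esub> u"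
        using ring.ring_simprules(10)[OF rng]
        by (intro BP_ext closed') (simp_all add: BP_apply BP_mem)
    qed (auto intro!: closed' BP_ext simp: BP_apply BP_mem R)
    show "monoid BP"
      by (rule monoidI) (auto intro!: closed' BP_ext simp: BP_apply BP_mem R)
  qed (auto intro!: closed' BP_ext simp: BP_apply BP_mem R)
  show ?thesis
    by (intro star_algebra.intro ring_BP star_algebra_axioms.intro)
      (auto intro!: closed' BP_ext simp: BP_apply BP_mem R)
qed

lemma BP_trace_bounded:
  assumes "a \<in> carrier BP"
  shows "\<exists>C. \<forall>i\<in>I. cmod (\<tau> i (a i)) \<le> C"
  using multiplier_trace_bounded[OF letter_family_pair[OF assms assms] multiplier_letter]
    letter_family_pair[OF assms assms] by simp

end

text \<open>An ultrafilter is a maximal proper filter, so a cluster point of the image filter is a limit.\<close>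

lemma ultrafilter_convergent_real:
  fixes f :: "'i \<Rightarrow> real"
  assumes \<omega>: "ultrafilter_on I \<omega>" and bd: "\<forall>i\<in>I. \<bar>f i\<bar> \<le> C"
  shows "\<exists>l. (f \<longlongrightarrow> l) \<omega>"
proof -
  have "\<omega> \<noteq> bot" and I: "\<forall>\<^sub>F i in \<omega>. i \<in> I"
    and ultra: "eventually P \<omega> \<or> (\<forall>\<^sub>F i in \<omega>. \<not> P i)" for P
    using \<omega> by (auto simp: ultrafilter_on_def)
  have "filtermap f \<omega> \<noteq> bot" using \<open>\<omega> \<noteq> bot\<close> by (simp add: filtermap_bot_iff)
  moreover have "\<forall>\<^sub>F x in filtermap f \<omega>. x \<in> {-C..C}"
    unfolding eventually_filtermap using I
    by (rule eventually_mono) (use bd in \<open>auto simp: abs_le_iff minus_le_iff\<close>)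
  ultimately obtain l where l: "inf (nhds l) (filtermap f \<omega>) \<noteq> bot"
    using compact_Icc[of "-C" C] unfolding compact_filter by blast
  have "\<forall>\<^sub>F i in \<omega>. f i \<in> S" if S: "open S" "l \<in> S" for S
  proof (rule ccontr)
    assume "\<not> ?thesis"
    then have "\<forall>\<^sub>F x in filtermap f \<omega>. x \<notin> S"
      using ultra[of "\<lambda>i. f i \<in> S"] by (simp add: eventually_filtermap)
    moreover have "\<forall>\<^sub>F x in nhds l. x \<in> S" using S by (rule eventually_nhds_in_open)
    ultimately have "eventually (\<lambda>_. False) (inf (nhds l) (filtermap f \<omega>))"
      unfolding eventually_inf by blast
    then show False using l by (simp add: trivial_limit_def)
  qed
  then show ?thesis by (blast intro: topological_tendstoI)
qed

lemma ultrafilter_convergent_complex: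
  fixes f :: "'i \<Rightarrow> complex"
  assumes \<omega>: "ultrafilter_on I \<omega>" and bd: "\<forall>i\<in>I. cmod (f i) \<le> C"
  shows "\<exists>l. (f \<longlongrightarrow> l) \<omega>"
proof -
  have "\<forall>i\<in>I. \<bar>Re (f i)\<bar> \<le> C" "\<forall>i\<in>I. \<bar>Im (f i)\<bar> \<le> C"
    using bd abs_Re_le_cmod abs_Im_le_cmod order_trans by blast+
  then obtain a b where "((\<lambda>i. Re (f i)) \<longlongrightarrow> a) \<omega>" "((\<lambda>i. Im (f i)) \<longlongrightarrow> b) \<omega>"
    using ultrafilter_convergent_real[OF \<omega>] by meson
  then have "((\<lambda>i. Complex (Re (f i)) (Im (f i))) \<longlongrightarrow> Complex a b) \<omega>" by (rule tendsto_Complex)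
  then show ?thesis by auto
qed

section \<open>Limits of traces along the ultrafilter\<close>

locale tracial_ultraproduct = tracial_family +
  fixes \<omega>
  assumes ultrafilter: "ultrafilter_on I \<omega>"
begin

lemma limit_traceI:
  assumes "(f \<longlongrightarrow> l) \<omega>" "\<And>i. i \<in> I \<Longrightarrow> \<tau> i (a i) = f i"
  shows "limit_trace \<omega> \<tau> a = l"
proof -
  have "((\<lambda>i. \<tau> i (a i)) \<longlongrightarrow> l) \<omega>"
    using assms(1)
    by (rule Lim_transform_eventually)
      (use ultrafilter assms(2) in \<open>auto simp: ultrafilter_on_def elim: eventually_mono\<close>)
  then show ?thesis
    using ultrafilter by (auto simp: limit_trace_def ultrafilter_on_def intro: tendsto_Lim)
qed

lemma limit_trace_tendsto:
  assumes "a \<in> carrier BP"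
  shows "((\<lambda>i. \<tau> i (a i)) \<longlongrightarrow> limit_trace \<omega> \<tau> a) \<omega>"
proof -
  obtain l where "((\<lambda>i. \<tau> i (a i)) \<longlongrightarrow> l) \<omega>"
    using ultrafilter_convergent_complex[OF ultrafilter, of "\<lambda>i. \<tau> i (a i)"]
      BP_trace_bounded[OF assms] by blast
  then show ?thesis using limit_traceI by blast
qed

lemma tracial_BP: "tracial_star_algebra BP (limit_trace \<omega> \<tau>)"
proof (intro tracial_star_algebra.intro star_algebra_BP tracial_star_algebra_axioms.intro)
  fix a c assume a: "a \<in> carrier BP"
  show "limit_trace \<omega> \<tau> (cscale BP c a) = c * limit_trace \<omega> \<tau> a"
    by (rule limit_traceI[OF tendsto_mult_left[OF limit_trace_tendsto[OF a]]])
      (simp add: BP_apply BP_mem[OF a] tracial_star_algebra.trace_cscale[OF tracial])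
  have "limit_trace \<omega> \<tau> (star BP a \<otimes>\<^bsub>BP\<^esub> a) \<in> {z. 0 \<le> z}"
  proof (rule Lim_in_closed_set)
    have "{z. 0 \<le> z} = {z. 0 \<le> Re z} \<inter> {z. Im z = 0}" by (auto simp: less_eq_complex_def)
    then show "closed {z::complex. 0 \<le> z}"
      by (simp add: closed_Int closed_Collect_le closed_Collect_eq continuous_intros)
    show "\<forall>\<^sub>F i in \<omega>. \<tau> i ((star BP a \<otimes>\<^bsub>BP\<^esub> a) i) \<in> {z. 0 \<le> z}"
      using ultrafilter tracial_star_algebra.trace_pos[OF tracial BP_mem[OF a]]
      by (auto simp: ultrafilter_on_def BP_apply elim!: eventually_mono)
    show "((\<lambda>i. \<tau> i ((star BP a \<otimes>\<^bsub>BP\<^esub> a) i)) \<longlongrightarrow> limit_trace \<omega> \<tau> (star BP a \<otimes>\<^bsub>BP\<^esub> a)) \<omega>"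
      using BP_closed[OF a a] BP_closed(2)[of "star BP a" a] a by (intro limit_trace_tendsto)
    show "\<omega> \<noteq> bot" using ultrafilter by (simp add: ultrafilter_on_def)
  qed
  then show "0 \<le> limit_trace \<omega> \<tau> (star BP a \<otimes>\<^bsub>BP\<^esub> a)" by simp
  fix b assume b: "b \<in> carrier BP"
  show "limit_trace \<omega> \<tau> (a \<oplus>\<^bsub>BP\<^esub> b) = limit_trace \<omega> \<tau> a + limit_trace \<omega> \<tau> b"
    by (rule limit_traceI[OF tendsto_add[OF limit_trace_tendsto[OF a] limit_trace_tendsto[OF b]]])
      (simp add: BP_apply BP_mem[OF a] BP_mem[OF b] tracial_star_algebra.trace_add[OF tracial])
  show "limit_trace \<omega> \<tau> (a \<otimes>\<^bsub>BP\<^esub> b) = limit_trace \<omega> \<tau> (b \<otimes>\<^bsub>BP\<^esub> a)"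
    by (rule limit_traceI[OF limit_trace_tendsto[OF BP_closed(2)[OF b a]]])
      (simp add: BP_apply tracial_star_algebra.trace_comm[OF tracial BP_mem[OF a] BP_mem[OF b]])
qed (auto intro!: limit_traceI[OF tendsto_const] simp: BP_apply tracial_star_algebra.trace_one[OF tracial])

sublocale BP: tracial_star_algebra BP "limit_trace \<omega> \<tau>"
  by (rule tracial_BP)

lemma null_ideal_eq: "null_ideal I \<omega> A \<tau> = BP.trace_kernel"
  by (simp add: null_ideal_def BP.trace_kernel_def)

sublocale null: tracial_star_ideal BP "limit_trace \<omega> \<tau>" "null_ideal I \<omega> A \<tau>"
  unfolding null_ideal_eq by (rule BP.tracial_star_ideal_trace_kernel)

lemma ultraproduct_trace_eq: "ultraproduct_trace \<omega> \<tau> = null.quotient_trace"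
  by (rule ext) (simp add: ultraproduct_trace_def null.quotient_trace_def)

lemma tracial_ultraproduct:
  "tracial_star_algebra (ultraproduct I \<omega> A \<tau>) (ultraproduct_trace \<omega> \<tau>)"
  unfolding ultraproduct_def ultraproduct_trace_eq by (rule null.tracial_quotient)

end

section \<open>Non-commutative polynomials\<close>

abbreviation wlen :: "word \<Rightarrow> nat" where
  "wlen w \<equiv> length (letters w)"

definition words :: "nat \<Rightarrow> word set" where
  "words n = {w. set (letters w) \<subseteq> {..<n}}"

lemma letters_zero [simp]: "letters 0 = []"
  by (simp add: zero_word_def)

lemma letters_add [simp]: "letters (v + w) = letters v @ letters w"
  by (simp add: plus_word_def)

lemma letters_rev_word [simp]: "letters (rev_word w) = rev (letters w)"
  by (simp add: rev_word_def)

lemma rev_word_rev_word [simp]: "rev_word (rev_word w) = w"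
  by (simp add: rev_word_def)

lemma rev_word_zero [simp]: "rev_word 0 = 0"
  by (simp add: rev_word_def zero_word_def)

lemma rev_word_add: "rev_word (v + w) = rev_word w + rev_word v"
  by (simp add: rev_word_def plus_word_def)

lemma inj_rev_word: "inj rev_word"
  by (metis injI rev_word_rev_word)

lemma words_closed [simp]:
  "0 \<in> words n" "v + w \<in> words n \<longleftrightarrow> v \<in> words n \<and> w \<in> words n"
  "rev_word w \<in> words n \<longleftrightarrow> w \<in> words n" "Word [] \<in> words n"
  "Word (i # xs) \<in> words n \<longleftrightarrow> i < n \<and> Word xs \<in> words n"
  by (auto simp: words_def)

lemma finite_words: "finite {w \<in> words n. wlen w \<le> l}"
proof -
  have "{w \<in> words n. wlen w \<le> l} \<subseteq> Word ` {xs. set xs \<subseteq> {..<n} \<and> length xs \<le> l}"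
    by (auto simp: words_def image_iff) (metis word.collapse)
  then show ?thesis using finite_lists_length_le[of "{..<n}" l] finite_subset by blast
qed

text \<open>The linear functional with moments \<open>t\<close>. Traces and single matrix entries of
  an evaluation are both treated in this form.\<close>

definition lin :: "(word \<Rightarrow> complex) \<Rightarrow> ncpoly \<Rightarrow> complex" where
  "lin t P = (\<Sum>w\<in>Poly_Mapping.keys P. Poly_Mapping.lookup P w * t w)"

lemma lin_superset:
  "finite S \<Longrightarrow> Poly_Mapping.keys P \<subseteq> S \<Longrightarrow> lin t P = (\<Sum>w\<in>S. Poly_Mapping.lookup P w * t w)"
  unfolding lin_def by (rule sum.mono_neutral_left) (auto simp: in_keys_iff)

lemma lin_zero [simp]: "lin t 0 = 0"
  by (simp add: lin_def)

lemma lin_single [simp]: "lin t (Poly_Mapping.single w c) = c * t w"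
  by (simp add: lin_def)

lemma lin_add: "lin t (P + Q) = lin t P + lin t Q"
proof -
  have "finite (Poly_Mapping.keys P \<union> Poly_Mapping.keys Q)" by simp
  note S = lin_superset[OF this]
  show ?thesis
    using Poly_Mapping.keys_add[of P Q]
    by (simp add: S lookup_add distrib_right sum.distrib)
qed

lemma lin_sum: "lin t (\<Sum>i\<in>S. f i) = (\<Sum>i\<in>S. lin t (f i))"
  by (induction S rule: infinite_finite_induct) (simp_all add: lin_add)

lemma ncpoly_expand:
  fixes P :: ncpoly
  shows "P = (\<Sum>w\<in>Poly_Mapping.keys P. Poly_Mapping.single w (Poly_Mapping.lookup P w))"
  by (rule poly_mapping_eqI) (simp add: lookup_sum lookup_single when_def in_keys_iff)

lemma ncpoly_induct [consumes 1, case_names zero single_add]: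
  fixes P :: ncpoly
  assumes "Poly_Mapping.keys P \<subseteq> S" and zero: "\<Phi> 0"
    and step: "\<And>w c Q. w \<in> S \<Longrightarrow> Poly_Mapping.keys Q \<subseteq> S \<Longrightarrow> \<Phi> Q \<Longrightarrow> \<Phi> (Poly_Mapping.single w c + Q)"
  shows "\<Phi> P"
proof -
  have "\<Phi> (\<Sum>w\<in>F. Poly_Mapping.single w (Poly_Mapping.lookup P w))" if "finite F" "F \<subseteq> S" for F
    using that
  proof (induction F)
    case (insert w F)
    have "Poly_Mapping.keys (\<Sum>w\<in>F. Poly_Mapping.single w (Poly_Mapping.lookup P w)) \<subseteq> S"
      using insert.prems keys_sum[of "\<lambda>w. Poly_Mapping.single w (Poly_Mapping.lookup P w)" F]
      by (fastforce split: if_splits)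
    then show ?case using insert by (simp add: step)
  qed (simp add: zero)
  from this[of "Poly_Mapping.keys P"] assms(1) show ?thesis by (simp flip: ncpoly_expand)
qed

definition ncstar :: "ncpoly \<Rightarrow> ncpoly" where
  "ncstar P = Poly_Mapping.map_key rev_word (Poly_Mapping.map cnj P)"

lemma lookup_ncstar: "Poly_Mapping.lookup (ncstar P) w = cnj (Poly_Mapping.lookup P (rev_word w))"
  by (simp add: ncstar_def map_key.rep_eq[OF inj_rev_word] map.rep_eq when_def)

lemma keys_ncstar: "Poly_Mapping.keys (ncstar P) = rev_word ` Poly_Mapping.keys P"
proof (rule subset_antisym; rule subsetI)
  fix w assume "w \<in> Poly_Mapping.keys (ncstar P)"
  then show "w \<in> rev_word ` Poly_Mapping.keys P"
    by (intro image_eqI[of _ _ "rev_word w"]) (simp_all add: in_keys_iff lookup_ncstar)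
qed (auto simp: in_keys_iff lookup_ncstar)

lemma ncstar_ncstar [simp]: "ncstar (ncstar P) = P"
  by (rule poly_mapping_eqI) (simp add: lookup_ncstar)

lemma ncstar_add: "ncstar (P + Q) = ncstar P + ncstar Q"
  by (rule poly_mapping_eqI) (simp add: lookup_ncstar lookup_add)

lemma ncstar_zero [simp]: "ncstar 0 = 0"
  by (rule poly_mapping_eqI) (simp add: lookup_ncstar)

lemma ncstar_single: "ncstar (Poly_Mapping.single w c) = Poly_Mapping.single (rev_word w) (cnj c)"
  by (rule poly_mapping_eqI) (auto simp: lookup_ncstar lookup_single when_def)

lemma ncstar_mult: "ncstar (P * Q) = ncstar Q * ncstar P"
proof -
  have "ncstar (Poly_Mapping.single w c * Q) = ncstar Q * ncstar (Poly_Mapping.single w c)" for w c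
    using subset_UNIV
    by (induction Q rule: ncpoly_induct)
      (simp_all add: distrib_left distrib_right ncstar_add mult_single ncstar_single rev_word_add
        mult.commute)
  note single = this
  show ?thesis
    using subset_UNIV
    by (induction P rule: ncpoly_induct)
      (simp_all add: distrib_left distrib_right ncstar_add single)
qed

lemma single_zero_commute: "Poly_Mapping.single 0 c * (P :: ncpoly) = P * Poly_Mapping.single 0 c"
  using subset_UNIV
  by (induction P rule: ncpoly_induct)
    (simp_all add: distrib_left distrib_right mult_single mult.commute)

lemma lin_mult:
  "lin t (P * Q) = (\<Sum>v\<in>Poly_Mapping.keys P. \<Sum>w\<in>Poly_Mapping.keys Q.
    Poly_Mapping.lookup P v * Poly_Mapping.lookup Q w * t (v + w))"
  by (subst (1) ncpoly_expand[of P], subst (1) ncpoly_expand[of Q])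
    (simp add: sum_product lin_sum mult_single)

lemma lin_ncstar_mult:
  "lin t (ncstar P * Q) = (\<Sum>v\<in>Poly_Mapping.keys P. \<Sum>w\<in>Poly_Mapping.keys Q.
    cnj (Poly_Mapping.lookup P v) * Poly_Mapping.lookup Q w * t (rev_word v + w))"
  unfolding lin_mult keys_ncstar
  by (subst sum.reindex) (auto simp: lookup_ncstar intro: inj_on_subset[OF inj_rev_word])

lemma lin_ncstar_mult_sum:
  fixes g :: "word \<Rightarrow> complex" and S :: "word set"
  defines "P \<equiv> \<Sum>w\<in>S. Poly_Mapping.single w (g w)"
  shows "lin t (ncstar P * P) = (\<Sum>v\<in>S. \<Sum>w\<in>S. cnj (g v) * g w * t (rev_word v + w))"
proof -
  have "ncstar P = (\<Sum>w\<in>S. Poly_Mapping.single (rev_word w) (cnj (g w)))"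
    unfolding P_def
    by (induction S rule: infinite_finite_induct) (simp_all add: ncstar_add ncstar_single)
  then show ?thesis by (simp add: P_def sum_product lin_sum mult_single)
qed

lemma lin_ncstar:
  "lin t (ncstar P) = (\<Sum>w\<in>Poly_Mapping.keys P. cnj (Poly_Mapping.lookup P w) * t (rev_word w))"
  using lin_ncstar_mult[of t P 1] by simp

lemma nc_polys_simps:
  "carrier (nc_polys n) = {P. Poly_Mapping.keys P \<subseteq> words n}"
  "P \<otimes>\<^bsub>nc_polys n\<^esub> Q = P * Q" "P \<oplus>\<^bsub>nc_polys n\<^esub> Q = P + Q"
  "\<one>\<^bsub>nc_polys n\<^esub> = 1" "\<zero>\<^bsub>nc_polys n\<^esub> = 0"
  "cscale (nc_polys n) c P = Poly_Mapping.single 0 c * P"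
  "star (nc_polys n) P = ncstar P"
  by (auto simp: nc_polys_def words_def mult_map_scale_conv_mult ncstar_def)

lemma keys_mult_words:
  assumes "Poly_Mapping.keys P \<subseteq> words n" "Poly_Mapping.keys Q \<subseteq> words n"
  shows "Poly_Mapping.keys (P * Q) \<subseteq> words n"
proof
  fix w assume "w \<in> Poly_Mapping.keys (P * Q)"
  then obtain u v where "w = u + v" "u \<in> Poly_Mapping.keys P" "v \<in> Poly_Mapping.keys Q"
    using keys_mult[of P Q] by blast
  then show "w \<in> words n" using assms by auto
qed

lemma keys_single_subset_iff [simp]: "(if c = 0 then {} else {w}) \<subseteq> S \<longleftrightarrow> c = 0 \<or> w \<in> S"
  by simp

lemma keys_add_words:
  "Poly_Mapping.keys P \<subseteq> words n \<Longrightarrow> Poly_Mapping.keys Q \<subseteq> words n \<Longrightarrow>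
    Poly_Mapping.keys (P + Q) \<subseteq> words n"
  using Poly_Mapping.keys_add[of P Q] by blast

lemma keys_ncstar_words: "Poly_Mapping.keys P \<subseteq> words n \<Longrightarrow> Poly_Mapping.keys (ncstar P) \<subseteq> words n"
  by (auto simp: keys_ncstar)

lemma star_algebra_nc_polys: "star_algebra (nc_polys n)"
proof -
  note closed = keys_mult_words keys_add_words keys_ncstar_words
  have s: "Poly_Mapping.single 0 (c * d) = Poly_Mapping.single 0 c * (Poly_Mapping.single 0 d :: ncpoly)"
    "Poly_Mapping.single 0 (c + d) = Poly_Mapping.single 0 c + (Poly_Mapping.single 0 d :: ncpoly)"
    for c d by (simp_all add: mult_single single_add)
  have "ring (nc_polys n)"
  proof (rule ringI)
    show "abelian_group (nc_polys n)"
    proof (rule abelian_groupI)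
      fix P assume "P \<in> carrier (nc_polys n)"
      then show "\<exists>Q\<in>carrier (nc_polys n). Q \<oplus>\<^bsub>nc_polys n\<^esub> P = \<zero>\<^bsub>nc_polys n\<^esub>"
        by (intro bexI[of _ "- P"]) (auto simp: nc_polys_simps in_keys_iff)
    qed (auto simp: nc_polys_simps add_ac intro: closed[THEN subsetD])
    show "monoid (nc_polys n)"
      by (rule monoidI)
        (auto simp: nc_polys_simps mult.assoc intro: closed[THEN subsetD])
  qed (auto simp: nc_polys_simps distrib_left distrib_right)
  then show ?thesis
  proof (intro star_algebra.intro star_algebra_axioms.intro)
    fix P c assume "P \<in> carrier (nc_polys n)"
    then show "cscale (nc_polys n) c P \<in> carrier (nc_polys n)"
      "star (nc_polys n) P \<in> carrier (nc_polys n)"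
      by (simp_all add: nc_polys_simps closed)
  next
    fix P Q c
    show "P \<otimes>\<^bsub>nc_polys n\<^esub> cscale (nc_polys n) c Q = cscale (nc_polys n) c (P \<otimes>\<^bsub>nc_polys n\<^esub> Q)"
      unfolding nc_polys_simps by (metis mult.assoc single_zero_commute)
    show "star (nc_polys n) (cscale (nc_polys n) c P) = cscale (nc_polys n) (cnj c) (star (nc_polys n) P)"
      by (simp add: nc_polys_simps ncstar_mult ncstar_single single_zero_commute)
  qed (auto simp: nc_polys_simps s distrib_left distrib_right mult.assoc ncstar_add ncstar_mult)
qed

text \<open>The trace axioms read on monomials; the last clause is positive semidefiniteness of the
  moment kernel. Constructing a trace thus becomes a problem about functions on words.\<close>

definition word_trace :: "nat \<Rightarrow> (word \<Rightarrow> complex) \<Rightarrow> bool" where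
  "word_trace n t \<longleftrightarrow> t 0 = 1 \<and> (\<forall>v\<in>words n. \<forall>w\<in>words n. t (v + w) = t (w + v)) \<and>
    (\<forall>S g. finite S \<longrightarrow> S \<subseteq> words n \<longrightarrow>
      0 \<le> (\<Sum>v\<in>S. \<Sum>w\<in>S. cnj (g v) * g w * t (rev_word v + w)))"

lemma tracial_nc_polys:
  assumes "word_trace n t"
  shows "tracial_star_algebra (nc_polys n) (lin t)"
proof -
  have comm: "lin t (P * Q) = lin t (Q * P)"
    if "Poly_Mapping.keys P \<subseteq> words n" "Poly_Mapping.keys Q \<subseteq> words n" for P Q
  proof -
    have "lin t (P * Q) = (\<Sum>v\<in>Poly_Mapping.keys P. \<Sum>w\<in>Poly_Mapping.keys Q.
        Poly_Mapping.lookup Q w * Poly_Mapping.lookup P v * t (w + v))"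
      unfolding lin_mult using assms that
      by (intro sum.cong refl) (auto simp: word_trace_def mult.commute subset_iff)
    then show ?thesis by (simp add: lin_mult sum.swap[of _ "Poly_Mapping.keys Q"])
  qed
  show ?thesis
  proof (intro tracial_star_algebra.intro star_algebra_nc_polys tracial_star_algebra_axioms.intro)
    fix P c
    show "lin t (cscale (nc_polys n) c P) = c * lin t P"
    proof (cases "c = 0")
      case False
      then show ?thesis
        by (simp add: nc_polys_simps lin_mult lin_def[of t P] sum_distrib_left mult.assoc)
    qed (simp add: nc_polys_simps)
    show "lin t \<one>\<^bsub>nc_polys n\<^esub> = 1"
      using assms by (simp add: nc_polys_simps word_trace_def lin_def)
  qed (use assms in \<open>auto simp: nc_polys_simps lin_add lin_ncstar_mult word_trace_def intro: comm\<close>)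
qed

section \<open>Evaluation of polynomials in a star-algebra\<close>

locale nc_evaluation = star_algebra A for A :: "('a, 'm) star_alg_scheme" (structure) +
  fixes n :: nat and x :: "nat \<Rightarrow> 'a"
  assumes x_closed: "i < n \<Longrightarrow> x i \<in> carrier A" and x_star: "i < n \<Longrightarrow> star A (x i) = x i"
begin

definition word_ev :: "word \<Rightarrow> 'a" where
  "word_ev w = list_prod A (map x (letters w))"

definition poly_ev :: "ncpoly \<Rightarrow> 'a" where
  "poly_ev P = finsum A (\<lambda>w. cscale A (Poly_Mapping.lookup P w) (word_ev w)) (Poly_Mapping.keys P)"

lemma letters_closed: "w \<in> words n \<Longrightarrow> set (map x (letters w)) \<subseteq> carrier A"
  by (auto simp: words_def x_closed)

lemma word_ev_closed: "w \<in> words n \<Longrightarrow> word_ev w \<in> carrier A"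
  unfolding word_ev_def by (rule list_prod_closed[OF letters_closed])

lemma word_ev_add:
  assumes "v \<in> words n" "w \<in> words n"
  shows "word_ev (v + w) = word_ev v \<otimes> word_ev w"
  using list_prod_append[OF letters_closed[OF assms(1)] letters_closed[OF assms(2)]]
  by (simp add: word_ev_def)

lemma word_ev_zero: "word_ev 0 = \<one>"
  by (simp add: word_ev_def)

lemma word_ev_rev:
  assumes "w \<in> words n"
  shows "word_ev (rev_word w) = star A (word_ev w)"
proof -
  have "map (star A) (map x (letters w)) = map x (letters w)"
    using assms by (auto simp: words_def x_star)
  then have "map x (letters (rev_word w)) = star_list (map x (letters w))"
    by (simp add: star_list_def rev_map)
  then show ?thesis
    unfolding word_ev_def using list_prod_star_list[OF letters_closed[OF assms]] by simp
qed

lemma term_closed: "w \<in> words n \<Longrightarrow> cscale A c (word_ev w) \<in> carrier A"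
  by (simp add: word_ev_closed cscale_closed)

lemma poly_ev_closed: "Poly_Mapping.keys P \<subseteq> words n \<Longrightarrow> poly_ev P \<in> carrier A"
  unfolding poly_ev_def by (rule finsum_closed) (auto intro: term_closed)

lemma poly_ev_superset:
  assumes "finite S" "Poly_Mapping.keys P \<subseteq> S" "S \<subseteq> words n"
  shows "poly_ev P = finsum A (\<lambda>w. cscale A (Poly_Mapping.lookup P w) (word_ev w)) S"
proof -
  let ?f = "\<lambda>w. cscale A (Poly_Mapping.lookup P w) (word_ev w)"
  have "finsum A ?f S = finsum A ?f (Poly_Mapping.keys P) \<oplus> finsum A ?f (S - Poly_Mapping.keys P)"
    using assms finsum_Un_disjoint[of "Poly_Mapping.keys P" "S - Poly_Mapping.keys P" ?f]
    by (auto simp: Un_absorb1 intro: term_closed)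
  also have "finsum A ?f (S - Poly_Mapping.keys P) = finsum A (\<lambda>w. \<zero>) (S - Poly_Mapping.keys P)"
    using assms by (intro finsum_cong') (auto simp: in_keys_iff cscale_zero_left word_ev_closed subset_iff)
  finally show ?thesis
    using assms by (simp add: poly_ev_def finsum_zero finsum_closed Pi_def term_closed subset_iff)
qed

lemma poly_ev_zero: "poly_ev 0 = \<zero>"
  by (simp add: poly_ev_def)

lemma poly_ev_single:
  assumes "w \<in> words n"
  shows "poly_ev (Poly_Mapping.single w c) = cscale A c (word_ev w)"
  using assms poly_ev_superset[of "{w}" "Poly_Mapping.single w c"]
  by (simp add: term_closed)

lemma poly_ev_add:
  assumes "Poly_Mapping.keys P \<subseteq> words n" "Poly_Mapping.keys Q \<subseteq> words n"
  shows "poly_ev (P + Q) = poly_ev P \<oplus> poly_ev Q"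
proof -
  let ?S = "Poly_Mapping.keys P \<union> Poly_Mapping.keys Q"
  have S: "finite ?S" "?S \<subseteq> words n" using assms by auto
  have "poly_ev (P + Q) = finsum A (\<lambda>w. cscale A (Poly_Mapping.lookup P w) (word_ev w) \<oplus>
      cscale A (Poly_Mapping.lookup Q w) (word_ev w)) ?S"
    unfolding poly_ev_superset[OF S(1) Poly_Mapping.keys_add S(2)]
    using S by (intro finsum_cong')
      (auto simp: lookup_add cscale_add_left word_ev_closed subset_iff intro!: term_closed a_closed)
  also have "\<dots> = poly_ev P \<oplus> poly_ev Q"
    using S poly_ev_superset[of ?S P] poly_ev_superset[of ?S Q]
    by (subst finsum_addf) (auto intro: term_closed)
  finally show ?thesis .
qed

lemma poly_ev_mult:
  assumes P: "Poly_Mapping.keys P \<subseteq> words n" and Q: "Poly_Mapping.keys Q \<subseteq> words n"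
  shows "poly_ev (P * Q) = poly_ev P \<otimes> poly_ev Q"
proof -
  note closed = keys_mult_words keys_add_words
  have single: "poly_ev (Poly_Mapping.single v c * Q) = poly_ev (Poly_Mapping.single v c) \<otimes> poly_ev Q"
    if v: "v \<in> words n" for v c
    using Q
  proof (induction Q rule: ncpoly_induct)
    case zero
    show ?case using v by (simp add: poly_ev_zero poly_ev_single term_closed)
  next
    case (single_add w d Q)
    have "poly_ev (Poly_Mapping.single (v + w) (c * d)) =
        poly_ev (Poly_Mapping.single v c) \<otimes> poly_ev (Poly_Mapping.single w d)"
      using v single_add.hyps
      by (simp add: poly_ev_single word_ev_add cscale_mult_left cscale_mult_right
        cscale_assoc[symmetric] mult.commute[of d] word_ev_closed cscale_closed)
    then show ?case
      using v single_add
      by (simp add: distrib_left poly_ev_add closed mult_single r_distr poly_ev_closed)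
  qed
  show ?thesis
    using P
  proof (induction P rule: ncpoly_induct)
    case zero
    show ?case using Q by (simp add: poly_ev_zero poly_ev_closed)
  next
    case (single_add w d P)
    then show ?case
      using Q by (simp add: distrib_right poly_ev_add closed single l_distr poly_ev_closed)
  qed
qed

lemma poly_ev_one: "poly_ev 1 = \<one>"
  using poly_ev_single[of 0 1] by (simp add: word_ev_zero cscale_one)

lemma poly_ev_cscale:
  assumes "Poly_Mapping.keys P \<subseteq> words n"
  shows "poly_ev (Poly_Mapping.single 0 c * P) = cscale A c (poly_ev P)"
  using assms
  by (simp add: poly_ev_mult poly_ev_single word_ev_zero cscale_mult_left poly_ev_closed)

lemma poly_ev_star:
  assumes "Poly_Mapping.keys P \<subseteq> words n"
  shows "poly_ev (ncstar P) = star A (poly_ev P)"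
  using assms
proof (induction P rule: ncpoly_induct)
  case (single_add w c P)
  then show ?case
    by (simp add: ncstar_add poly_ev_add keys_ncstar_words ncstar_single poly_ev_single star_add
      star_cscale word_ev_rev word_ev_closed term_closed poly_ev_closed)
qed (simp add: poly_ev_zero star_zero)

text \<open>Polynomial values are closed under every rule of generation. When the \<open>x i\<close>
  generate \<open>A\<close>, evaluation is therefore onto, and a homomorphism out of
  \<open>A\<close> can be defined on polynomials.\<close>

lemma generate_algebra_subset: "generate_algebra A (x ` {..<n}) \<subseteq> poly_ev ` carrier (nc_polys n)"
proof
  fix a assume "a \<in> generate_algebra A (x ` {..<n})"
  then show "a \<in> poly_ev ` carrier (nc_polys n)"
  proof induction
    case one
    show ?case by (rule image_eqI[of _ _ 1]) (simp_all add: poly_ev_one nc_polys_simps)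
  next
    case (incl a)
    then obtain i where i: "i < n" "a = x i" by auto
    then have "a = poly_ev (Poly_Mapping.single (Word [i]) 1)"
      by (simp add: poly_ev_single word_ev_def cscale_one x_closed)
    moreover have "Poly_Mapping.single (Word [i]) 1 \<in> carrier (nc_polys n)"
      using i by (simp add: nc_polys_simps)
    ultimately show ?case by (rule image_eqI)
  next
    case (cscale a c)
    then obtain P where "Poly_Mapping.keys P \<subseteq> words n" "a = poly_ev P" by (auto simp: nc_polys_simps)
    then show ?case
      by (intro image_eqI[of _ _ "Poly_Mapping.single 0 c * P"])
        (simp_all add: nc_polys_simps poly_ev_cscale keys_mult_words)
  next
    case (add a b)
    then obtain P Q where "Poly_Mapping.keys P \<subseteq> words n" "a = poly_ev P"
      "Poly_Mapping.keys Q \<subseteq> words n" "b = poly_ev Q" by (auto simp: nc_polys_simps)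
    then show ?case
      by (intro image_eqI[of _ _ "P + Q"]) (simp_all add: nc_polys_simps poly_ev_add keys_add_words)
  next
    case (mult a b)
    then obtain P Q where "Poly_Mapping.keys P \<subseteq> words n" "a = poly_ev P"
      "Poly_Mapping.keys Q \<subseteq> words n" "b = poly_ev Q" by (auto simp: nc_polys_simps)
    then show ?case
      by (intro image_eqI[of _ _ "P * Q"]) (simp_all add: nc_polys_simps poly_ev_mult keys_mult_words)
  qed
qed

lemma trace_poly_ev:
  assumes "tracial_star_algebra A \<tau>" and "Poly_Mapping.keys P \<subseteq> words n"
  shows "\<tau> (poly_ev P) = lin (\<lambda>w. \<tau> (word_ev w)) P"
proof -
  interpret tracial_star_algebra A \<tau> by fact
  show ?thesis
    using assms(2)
  proof (induction P rule: ncpoly_induct)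
    case (single_add w c P)
    then show ?case
      by (simp add: lin_add poly_ev_add poly_ev_single trace_add trace_cscale word_ev_closed
        term_closed poly_ev_closed)
  qed (simp add: poly_ev_zero trace_zero)
qed

lemma word_trace_word_ev:
  assumes "tracial_star_algebra A \<tau>"
  shows "word_trace n (\<lambda>w. \<tau> (word_ev w))"
proof -
  interpret tracial_star_algebra A \<tau> by fact
  have "0 \<le> (\<Sum>v\<in>S. \<Sum>w\<in>S. cnj (g v) * g w * \<tau> (word_ev (rev_word v + w)))"
    if S: "finite S" "S \<subseteq> words n" for S and g :: "word \<Rightarrow> complex"
  proof -
    define P where "P = (\<Sum>w\<in>S. Poly_Mapping.single w (g w))"
    have P: "Poly_Mapping.keys P \<subseteq> words n"
      using S keys_sum[of "\<lambda>w. Poly_Mapping.single w (g w)" S]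
      by (fastforce simp: P_def split: if_splits)
    then have "0 \<le> lin (\<lambda>w. \<tau> (word_ev w)) (ncstar P * P)"
      using trace_pos[OF poly_ev_closed[OF P]] trace_poly_ev[OF assms, of "ncstar P * P"]
      by (simp add: keys_mult_words keys_ncstar_words poly_ev_mult poly_ev_star)
    then show ?thesis by (simp add: P_def lin_ncstar_mult_sum)
  qed
  then show ?thesis
    by (auto simp: word_trace_def word_ev_zero trace_one word_ev_add word_ev_closed intro: trace_comm)
qed

end

section \<open>Generic self-adjoint matrices\<close>

definition self_adjoint_tuple :: "nat \<Rightarrow> nat \<Rightarrow> (nat \<Rightarrow> complex mat) \<Rightarrow> bool" where
  "self_adjoint_tuple n k M \<longleftrightarrow> (\<forall>i<n. M i \<in> carrier_mat k k \<and> mat_adjoint (M i) = M i)"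

lemma mat_adjoint_index:
  fixes A :: "complex mat"
  assumes "A \<in> carrier_mat k k" "i < k" "j < k"
  shows "mat_adjoint A $$ (i, j) = cnj (A $$ (j, i))"
  using assms by (simp add: mat_adjoint_def mat_of_rows_def)

lemma mat_adjoint_carrier:
  fixes A :: "complex mat"
  assumes "A \<in> carrier_mat k k"
  shows "mat_adjoint A \<in> carrier_mat k k"
  using assms by (auto simp: mat_adjoint_def mat_of_rows_def)

lemma mult_mat_index:
  fixes A B :: "complex mat"
  assumes "A \<in> carrier_mat k k" "B \<in> carrier_mat k k" "i < k" "j < k"
  shows "(A * B) $$ (i, j) = (\<Sum>l<k. A $$ (i, l) * B $$ (l, j))"
  using assms by (simp add: scalar_prod_def lessThan_atLeast0)

lemma word_mat_Cons: "word_mat k M (Word (i # xs)) = M i * word_mat k M (Word xs)"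
  by (simp add: word_mat_def)

lemma word_mat_Nil: "word_mat k M (Word []) = 1\<^sub>m k"
  by (simp add: word_mat_def)

lemma word_induct [case_names Nil Cons]:
  assumes "\<Phi> (Word [])" "\<And>i xs. \<Phi> (Word xs) \<Longrightarrow> \<Phi> (Word (i # xs))"
  shows "\<Phi> w"
proof -
  have "\<Phi> (Word xs)" for xs by (induction xs) (use assms in auto)
  from this[of "letters w"] show ?thesis by simp
qed

context
  fixes n k M
  assumes M: "self_adjoint_tuple n k M"
begin

lemma M_carrier: "i < n \<Longrightarrow> M i \<in> carrier_mat k k"
  using M by (simp add: self_adjoint_tuple_def)

lemma word_mat_carrier: "w \<in> words n \<Longrightarrow> word_mat k M w \<in> carrier_mat k k"
  by (induction w rule: word_induct) (auto simp: word_mat_Cons word_mat_Nil intro!: mult_carrier_mat M_carrier)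

lemma word_mat_add:
  assumes "v \<in> words n" "w \<in> words n"
  shows "word_mat k M (v + w) = word_mat k M v * word_mat k M w"
  using assms(1)
proof (induction v rule: word_induct)
  case Nil
  show ?case using word_mat_carrier[OF assms(2)] by (simp add: word_mat_Nil plus_word_def)
next
  case (Cons i xs)
  have "Word (i # xs) + w = Word (i # letters (Word xs + w))" by (simp add: plus_word_def)
  then show ?case
    using Cons assms(2) M_carrier[of i] word_mat_carrier[of "Word xs"] word_mat_carrier[of w]
    by (simp add: word_mat_Cons plus_word_def assoc_mult_mat[of _ k k _ k _ k])
qed

lemma word_mat_add_index:
  assumes "v \<in> words n" "w \<in> words n" "i < k" "j < k"
  shows "word_mat k M (v + w) $$ (i, j) = (\<Sum>l<k. word_mat k M v $$ (i, l) * word_mat k M w $$ (l, j))"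
  using assms by (simp add: word_mat_add mult_mat_index word_mat_carrier del: index_mult_mat)

lemma M_index:
  assumes "a < n" "i < k" "j < k"
  shows "M a $$ (i, j) = cnj (M a $$ (j, i))"
  using M mat_adjoint_index[OF M_carrier assms(2,3), of a] assms by (simp add: self_adjoint_tuple_def)

lemma word_mat_rev_index:
  assumes "w \<in> words n" "i < k" "j < k"
  shows "word_mat k M (rev_word w) $$ (i, j) = cnj (word_mat k M w $$ (j, i))"
  using assms
proof (induction w arbitrary: i j rule: word_induct)
  case Nil
  then show ?case by (simp add: rev_word_def word_mat_Nil)
next
  case (Cons a xs)
  have "rev_word (Word (a # xs)) = rev_word (Word xs) + Word [a]"
    by (simp add: rev_word_def plus_word_def)
  moreover have "word_mat k M (Word [a]) = M a"
    using M_carrier[of a] Cons.prems by (simp add: word_mat_Cons word_mat_Nil)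
  ultimately have "word_mat k M (rev_word (Word (a # xs))) $$ (i, j)
      = (\<Sum>l<k. word_mat k M (rev_word (Word xs)) $$ (i, l) * M a $$ (l, j))"
    using Cons.prems by (simp add: word_mat_add_index)
  also have "\<dots> = (\<Sum>l<k. cnj (M a $$ (j, l) * word_mat k M (Word xs) $$ (l, i)))"
    using Cons by (intro sum.cong refl) (simp add: M_index[of a _ j])
  also have "\<dots> = cnj (word_mat k M (Word (a # xs)) $$ (j, i))"
    using Cons.prems M_carrier[of a] word_mat_carrier[of "Word xs"]
    by (simp add: word_mat_Cons mult_mat_index del: index_mult_mat)
  finally show ?case .
qed

lemma lin_word_mat_mult:
  assumes "Poly_Mapping.keys P \<subseteq> words n" "Poly_Mapping.keys Q \<subseteq> words n" "i < k" "j < k"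
  shows "lin (\<lambda>w. word_mat k M w $$ (i, j)) (P * Q) =
    (\<Sum>l<k. lin (\<lambda>w. word_mat k M w $$ (i, l)) P * lin (\<lambda>w. word_mat k M w $$ (l, j)) Q)"
proof -
  let ?p = "Poly_Mapping.lookup P" and ?q = "Poly_Mapping.lookup Q" and ?W = "word_mat k M"
  have "lin (\<lambda>w. ?W w $$ (i, j)) (P * Q) = (\<Sum>v\<in>Poly_Mapping.keys P. \<Sum>w\<in>Poly_Mapping.keys Q.
      \<Sum>l<k. (?p v * ?W v $$ (i, l)) * (?q w * ?W w $$ (l, j)))"
    unfolding lin_mult using assms
    by (intro sum.cong refl) (auto simp: word_mat_add_index sum_distrib_left mult_ac subset_iff)
  also have "\<dots> = (\<Sum>v\<in>Poly_Mapping.keys P. \<Sum>l<k. \<Sum>w\<in>Poly_Mapping.keys Q.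
      (?p v * ?W v $$ (i, l)) * (?q w * ?W w $$ (l, j)))"
    by (intro sum.cong refl sum.swap)
  also have "\<dots> = (\<Sum>l<k. \<Sum>v\<in>Poly_Mapping.keys P. \<Sum>w\<in>Poly_Mapping.keys Q.
      (?p v * ?W v $$ (i, l)) * (?q w * ?W w $$ (l, j)))"
    by (rule sum.swap)
  finally show ?thesis by (simp add: lin_def sum_product)
qed

lemma lin_word_mat_ncstar:
  assumes "Poly_Mapping.keys P \<subseteq> words n" "i < k" "j < k"
  shows "lin (\<lambda>w. word_mat k M w $$ (i, j)) (ncstar P) = cnj (lin (\<lambda>w. word_mat k M w $$ (j, i)) P)"
  unfolding lin_ncstar using assms
  by (auto simp: lin_def word_mat_rev_index subset_iff intro!: sum.cong)

end

text \<open>Each entry of each substitution is a functional \<open>lin\<close>, so the ideal is an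
  intersection of kernels.\<close>

lemma vanishing_ideal_iff:
  "P \<in> vanishing_ideal n k \<longleftrightarrow> Poly_Mapping.keys P \<subseteq> words n \<and>
    (\<forall>M i j. self_adjoint_tuple n k M \<longrightarrow> i < k \<longrightarrow> j < k \<longrightarrow> lin (\<lambda>w. word_mat k M w $$ (i, j)) P = 0)"
proof -
  have "eval_mat k M P = 0\<^sub>m k k \<longleftrightarrow> (\<forall>i j. i < k \<longrightarrow> j < k \<longrightarrow> lin (\<lambda>w. word_mat k M w $$ (i, j)) P = 0)"
    for M by (auto simp: mat_eq_iff eval_mat_def lin_def)
  then show ?thesis
    by (auto simp: vanishing_ideal_def nc_polys_simps self_adjoint_tuple_def)
qed

lemma star_ideal_vanishing_ideal: "star_ideal (nc_polys n) (vanishing_ideal n k)"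
proof -
  interpret star_algebra "nc_polys n" by (rule star_algebra_nc_polys)
  let ?J = "vanishing_ideal n k"
  have left: "Q * P \<in> ?J" and right: "P * Q \<in> ?J"
    if "P \<in> ?J" "Poly_Mapping.keys Q \<subseteq> words n" for P Q
    using that by (auto simp: vanishing_ideal_iff lin_word_mat_mult intro: keys_mult_words[THEN subsetD])
  have "subgroup ?J (add_monoid (nc_polys n))"
  proof (rule add.subgroupI)
    show "?J \<subseteq> carrier (nc_polys n)" by (auto simp: vanishing_ideal_iff nc_polys_simps)
    have "0 \<in> ?J" by (simp add: vanishing_ideal_iff)
    then show "?J \<noteq> {}" by blast
    fix P assume P: "P \<in> ?J"
    then have "P \<in> carrier (nc_polys n)" by (simp add: vanishing_ideal_iff nc_polys_simps)
    then have "\<ominus>\<^bsub>nc_polys n\<^esub> P = Poly_Mapping.single 0 (-1) * P"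
      using cscale_minus_one[of P] by (simp add: nc_polys_simps)
    then show "\<ominus>\<^bsub>nc_polys n\<^esub> P \<in> ?J"
      using left[OF P, of "Poly_Mapping.single 0 (-1)"] by simp
    fix Q assume "Q \<in> ?J"
    then show "P \<oplus>\<^bsub>nc_polys n\<^esub> Q \<in> ?J"
      using P by (simp add: vanishing_ideal_iff nc_polys_simps lin_add keys_add_words)
  qed
  then have "ideal ?J (nc_polys n)"
    by (intro idealI ring_axioms) (auto simp: nc_polys_simps left right)
  moreover have "star (nc_polys n) P \<in> ?J" if "P \<in> ?J" for P
    using that by (simp add: vanishing_ideal_iff nc_polys_simps lin_word_mat_ncstar keys_ncstar_words)
  ultimately show ?thesis
    by (intro star_ideal.intro star_algebra_axioms star_ideal_axioms.intro)
qed

section \<open>Traces that descend to generic matrices, and homogeneity of the ideal\<close>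

definition matrix_trace :: "nat \<Rightarrow> nat \<Rightarrow> (word \<Rightarrow> complex) \<Rightarrow> bool" where
  "matrix_trace n k t \<longleftrightarrow> word_trace n t \<and> (\<forall>P\<in>vanishing_ideal n k. lin t P = 0)"

lemma tracial_star_ideal_vanishing_ideal:
  assumes "matrix_trace n k t"
  shows "tracial_star_ideal (nc_polys n) (lin t) (vanishing_ideal n k)"
  using assms
  by (intro tracial_star_ideal.intro tracial_nc_polys star_ideal_vanishing_ideal
    tracial_star_ideal_axioms.intro) (simp_all add: matrix_trace_def)

text \<open>Substituting \<open>t M\<close> for \<open>M\<close> with a real parameter \<open>t\<close> shows that the ideal is homogeneous.\<close>

lemma vanishing_ideal_homogeneous:
  assumes P: "P \<in> vanishing_ideal n k" and M: "self_adjoint_tuple n k M" and ij: "i < k" "j < k"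
  shows "(\<Sum>w | w \<in> Poly_Mapping.keys P \<and> wlen w = a. Poly_Mapping.lookup P w * word_mat k M w $$ (i, j)) = 0"
proof -
  let ?c = "\<lambda>w. Poly_Mapping.lookup P w * word_mat k M w $$ (i, j)"
  \<comment> \<open>The value of \<open>P\<close> at the scaled tuple, as a polynomial in the scale.
    It has every real number as a root, so it is zero, and its coefficients are the graded parts of
    \<open>P\<close>.\<close>
  define p where "p = (\<Sum>w\<in>Poly_Mapping.keys P. monom (?c w) (wlen w))"
  have "poly p (complex_of_real s) = 0" for s
  proof -
    define N where "N = (\<lambda>i. complex_of_real s \<cdot>\<^sub>m M i)"
    have Mc: "M a \<in> carrier_mat k k" if "a < n" for a using that M by (simp add: self_adjoint_tuple_def)
    have N: "self_adjoint_tuple n k N"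
      unfolding self_adjoint_tuple_def
    proof (intro allI impI conjI)
      fix a assume a: "a < n"
      show c: "N a \<in> carrier_mat k k" using Mc[OF a] by (simp add: N_def)
      show "mat_adjoint (N a) = N a"
      proof (rule eq_matI)
        fix i' j' assume "i' < dim_row (N a)" "j' < dim_col (N a)"
        then have l: "i' < k" "j' < k" using c by auto
        show "mat_adjoint (N a) $$ (i', j') = N a $$ (i', j')"
          unfolding mat_adjoint_index[OF c l] using Mc[OF a] l M_index[OF M a l]
          by (simp add: N_def)
      qed (use mat_adjoint_carrier[OF c] c in auto)
    qed
    have "word_mat k N w = complex_of_real s ^ wlen w \<cdot>\<^sub>m word_mat k M w" if "w \<in> words n" for w
      using that
    proof (induction w rule: word_induct)
      case Nil
      show ?case by (auto simp: word_mat_Nil mat_eq_iff)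
    next
      case (Cons a xs)
      have "r \<cdot>\<^sub>m (r' \<cdot>\<^sub>m B) = (r * r') \<cdot>\<^sub>m B" for r r' and B :: "complex mat"
        by (rule eq_matI) auto
      with Cons show ?case
        using Mc[of a] word_mat_carrier[OF M, of "Word xs"]
        by (simp add: word_mat_Cons N_def mult_smult_assoc_mat[of _ k k _ k]
          mult_smult_distrib[of _ k k _ k] mult.commute)
    qed
    then have "word_mat k N w $$ (i, j) = complex_of_real s ^ wlen w * word_mat k M w $$ (i, j)"
      if "w \<in> words n" for w
      using that word_mat_carrier[OF M that] ij by simp
    moreover have "lin (\<lambda>w. word_mat k N w $$ (i, j)) P = 0"
      using P N ij unfolding vanishing_ideal_iff by blast
    moreover have "Poly_Mapping.keys P \<subseteq> words n" using P by (simp add: vanishing_ideal_iff)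
    ultimately have "(\<Sum>w\<in>Poly_Mapping.keys P. ?c w * complex_of_real s ^ wlen w) = 0"
      by (simp add: lin_def subset_iff mult_ac cong: sum.cong)
    then show ?thesis by (simp add: p_def poly_sum poly_monom)
  qed
  then have "range complex_of_real \<subseteq> {z. poly p z = 0}" by auto
  moreover have "infinite (range complex_of_real)"
    using finite_imageD[of complex_of_real UNIV] infinite_UNIV_char_0 by (auto simp: inj_on_def)
  ultimately have "p = 0" using poly_roots_finite finite_subset by blast
  then have "coeff p a = 0" by simp
  then show ?thesis by (simp add: p_def coeff_sum sum.inter_filter[symmetric] if_distrib cong: if_cong)
qed

text \<open>The trace at the zero matrices.\<close>

lemma matrix_trace_zero:
  assumes "k \<ge> 1"
  shows "matrix_trace n k (\<lambda>w. of_bool (w = 0))"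
proof -
  have z: "letters w = [] \<longleftrightarrow> w = 0" for w by (cases w) (simp add: zero_word_def)
  have add_zero: "v + w = 0 \<longleftrightarrow> v = 0 \<and> w = 0" for v w :: word by (simp flip: z)
  have rev_zero: "rev_word v = 0 \<longleftrightarrow> v = 0" for v by (simp flip: z)
  have "(\<Sum>v\<in>S. \<Sum>w\<in>S. cnj (g v) * g w * of_bool (rev_word v + w = 0)) =
      (\<Sum>v\<in>S. \<Sum>w\<in>S. if v = 0 \<and> w = 0 then complex_of_real ((cmod (g 0))\<^sup>2) else 0)" for S and g :: "word \<Rightarrow> complex"
    by (intro sum.cong refl) (auto simp: add_zero rev_zero complex_norm_square mult.commute
        simp del: of_real_power)
  moreover have "0 \<le> (\<Sum>v\<in>S. \<Sum>w\<in>S. if v = 0 \<and> w = 0 then complex_of_real ((cmod (g 0))\<^sup>2) else 0)"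
    for S :: "word set" and g :: "word \<Rightarrow> complex"
    by (intro sum_nonneg) (auto simp: less_eq_complex_def)
  ultimately have "0 \<le> (\<Sum>v\<in>S. \<Sum>w\<in>S. cnj (g v) * g w * of_bool (rev_word v + w = 0))"
    for S and g :: "word \<Rightarrow> complex" by presburger
  then have "word_trace n (\<lambda>w. of_bool (w = 0))"
    unfolding word_trace_def by (intro conjI allI impI) (assumption | simp add: add_zero conj_commute)+
  moreover have "lin (\<lambda>w. of_bool (w = 0)) P = 0" if P: "P \<in> vanishing_ideal n k" for P
  proof -
    define M where "M = (\<lambda>i::nat. 0\<^sub>m k k :: complex mat)"
    have M: "self_adjoint_tuple n k M"
      by (auto simp: self_adjoint_tuple_def M_def mat_eq_iff mat_adjoint_index[of _ k]
          mat_adjoint_carrier[THEN carrier_matD(1)] mat_adjoint_carrier[THEN carrier_matD(2)])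
    \<comment> \<open>Since \<open>k \<ge> 1\<close> there is an entry \<open>(0, 0)\<close>, and at
      the zero tuple it realises the functional, which therefore kills the ideal.\<close>
    have "word_mat k M w $$ (0, 0) = of_bool (w = 0)" if "w \<in> words n" for w
    proof (cases w rule: word.exhaust)
      case (Word xs)
      then show ?thesis
      proof (cases xs)
        case (Cons a ys)
        then show ?thesis using Word assms that word_mat_carrier[OF M, of "Word ys"]
          by (simp add: word_mat_Cons M_def zero_word_def)
      qed (use Word assms in \<open>simp add: word_mat_Nil zero_word_def\<close>)
    qed
    moreover have "lin (\<lambda>w. word_mat k M w $$ (0, 0)) P = 0" "Poly_Mapping.keys P \<subseteq> words n"
      using P M assms by (auto simp: vanishing_ideal_iff)
    ultimately show ?thesis by (simp add: lin_def subset_iff cong: sum.cong)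
  qed
  ultimately show ?thesis by (simp add: matrix_trace_def)
qed

section \<open>A positive form by diagonal dominance\<close>

text \<open>The arithmetic-geometric mean inequality splits each product \<open>u a * u b\<close>;
  by symmetry of \<open>q\<close> both halves sum to the same weighted row sums.\<close>

lemma Schur_test:
  fixes u :: "nat \<Rightarrow> real" and q :: "nat \<Rightarrow> nat \<Rightarrow> real"
  assumes fin: "finite S" and nn: "\<And>a b. 0 \<le> q a b" and sym: "\<And>a b. q a b = q b a"
    and row: "\<And>a. a \<in> S \<Longrightarrow> (\<Sum>b\<in>S. q a b) \<le> C"
  shows "(\<Sum>a\<in>S. \<Sum>b\<in>S. q a b * (u a * u b)) \<le> C * (\<Sum>a\<in>S. (u a)\<^sup>2)"
proof -
  have "q a b * (u a * u b) \<le> q a b * (u a)\<^sup>2 / 2 + q b a * (u b)\<^sup>2 / 2" for a b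
  proof -
    have "u a * u b \<le> ((u a)\<^sup>2 + (u b)\<^sup>2) / 2"
      using sum_squares_bound[of "u a" "u b"] by simp
    from mult_left_mono[OF this nn[of a b]] show ?thesis by (simp add: sym[of b a] algebra_simps)
  qed
  then have "(\<Sum>a\<in>S. \<Sum>b\<in>S. q a b * (u a * u b)) \<le>
      (\<Sum>a\<in>S. \<Sum>b\<in>S. q a b * (u a)\<^sup>2 / 2 + q b a * (u b)\<^sup>2 / 2)"
    by (intro sum_mono)
  also have "\<dots> = (\<Sum>a\<in>S. \<Sum>b\<in>S. q a b * (u a)\<^sup>2 / 2) + (\<Sum>b\<in>S. \<Sum>a\<in>S. q b a * (u b)\<^sup>2 / 2)"
    by (simp add: sum.distrib sum.swap[of "\<lambda>a b. q b a * (u b)\<^sup>2 / 2"])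
  also have "\<dots> = (\<Sum>a\<in>S. (\<Sum>b\<in>S. q a b) * (u a)\<^sup>2)"
    by (simp add: sum_distrib_right sum.distrib[symmetric])
  also have "\<dots> \<le> (\<Sum>a\<in>S. C * (u a)\<^sup>2)"
    by (intro sum_mono mult_right_mono row) auto
  finally show ?thesis by (simp add: sum_distrib_left)
qed

text \<open>Powers of 1/5 contribute at most 1/4 on either side of the diagonal. The other half of
  the row budget 1 is reserved for the truncated moments.\<close>

lemma geometric_row_sum:
  "(\<Sum>b\<le>h. if a = b then 0 else (1/5::real) ^ ((a - b) + (b - a))) \<le> 1/2"
proof -
  have geo: "(\<Sum>m\<in>{1..N}. (1/5::real) ^ m) \<le> 1/4" for N
  proof -
    have "(\<Sum>m\<in>{1..N}. q ^ m) = (1 - q ^ N) / 4" if "5 * q = 1" for q :: real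
    proof (induction N)
      case (Suc N)
      have "5 * (q * q ^ N) = q ^ N" using that by (metis mult.assoc mult_1)
      then show ?case using Suc by simp
    qed simp
    from this[of "1/5"] have "(\<Sum>m\<in>{1..N}. (1/5::real) ^ m) = (1 - (1/5) ^ N) / 4" by simp
    also have "\<dots> \<le> 1/4" by simp
    finally show ?thesis .
  qed
  have "(\<Sum>b\<le>h. if a = b then 0 else (1/5::real) ^ ((a - b) + (b - a))) \<le>
    (\<Sum>b<a. (1/5::real) ^ (a - b)) + (\<Sum>b\<in>{a<..a+h}. (1/5::real) ^ (b - a))"
  proof -
    have "(\<Sum>b\<le>h. if a = b then 0 else (1/5::real) ^ ((a - b) + (b - a))) \<le>
      (\<Sum>b\<in>{..<a} \<union> {a<..a+h}. (1/5::real) ^ ((a - b) + (b - a)))"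
    proof -
      have "(\<Sum>b\<le>h. if a = b then 0 else (1/5::real) ^ ((a - b) + (b - a))) =
        (\<Sum>b\<in>{..h} - {a}. (1/5::real) ^ ((a - b) + (b - a)))"
        by (intro sum.mono_neutral_cong_right) auto
      also have "\<dots> \<le> (\<Sum>b\<in>{..<a} \<union> {a<..a+h}. (1/5::real) ^ ((a - b) + (b - a)))"
        by (intro sum_mono2) auto
      finally show ?thesis .
    qed
    also have "\<dots> = (\<Sum>b<a. (1/5::real) ^ (a - b)) + (\<Sum>b\<in>{a<..a+h}. (1/5::real) ^ (b - a))"
      by (subst sum.union_disjoint) (auto intro!: arg_cong2[where f = "(+)"] sum.cong)
    finally show ?thesis .
  qed
  also have "(\<Sum>b<a. (1/5::real) ^ (a - b)) = (\<Sum>m\<in>{1..a}. (1/5::real) ^ m)"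
    by (rule sum.reindex_bij_witness[of _ "\<lambda>m. a - m" "\<lambda>b. a - b"]) auto
  also have "(\<Sum>b\<in>{a<..a+h}. (1/5::real) ^ (b - a)) = (\<Sum>m\<in>{1..h}. (1/5::real) ^ m)"
    by (rule sum.reindex_bij_witness[of _ "\<lambda>m. m + a" "\<lambda>b. b - a"]) auto
  finally show ?thesis using geo[of a] geo[of h] by linarith
qed

text \<open>The growth of the weights \<open>c j = R ^ (2 j\<^sup>2)\<close> makes \<open>c ((a + b) / 2)\<close> negligible against
  \<open>(c (a) c (b)) ^ (1/2)\<close>, so that the graded form is dominated by its diagonal.\<close>

lemma Hankel_weight_le:
  fixes R :: real
  assumes R: "5 \<le> R" and ev: "even (a + b)"
  shows "R ^ (2 * ((a + b) div 2)\<^sup>2) \<le> (1/5) ^ ((a - b) + (b - a)) * (R ^ a\<^sup>2 * R ^ b\<^sup>2)"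
proof -
  have *: "R ^ (2 * ((a + b) div 2)\<^sup>2) \<le> (1/5) ^ (b - a) * (R ^ a\<^sup>2 * R ^ b\<^sup>2)"
    if le: "a \<le> b" and ev: "even (a + b)" for a b
  proof -
    obtain m where b: "b = a + 2 * m"
    proof -
      have "even (b - a)" using ev le by (simp add: even_diff_nat add.commute)
      then obtain m where "b - a = 2 * m" by (elim evenE)
      then have "b = a + 2 * m" using le by simp
      then show ?thesis by (rule that)
    qed
    \<comment> \<open>The parallelogram identity. The surplus exponent \<open>2 * m\<^sup>2\<close>
      is at least \<open>2 * m = b - a\<close>, which pays for the factor
      \<open>(1/5) ^ (b - a)\<close>.\<close>
    have sq: "a\<^sup>2 + b\<^sup>2 = 2 * ((a + b) div 2)\<^sup>2 + 2 * m\<^sup>2"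
      by (simp add: b power2_eq_square algebra_simps)
    have "m \<le> m\<^sup>2" by (simp add: power2_nat_le_imp_le power2_eq_square)
    then have "(5::real) ^ (2 * m) \<le> 5 ^ (2 * m\<^sup>2)" by (intro power_increasing) auto
    also have "\<dots> \<le> R ^ (2 * m\<^sup>2)" using R by (intro power_mono) auto
    finally have "1 \<le> (1/5) ^ (2 * m) * R ^ (2 * m\<^sup>2)" by (simp add: power_one_over field_simps)
    then have "R ^ (2 * ((a + b) div 2)\<^sup>2) * 1 \<le>
        R ^ (2 * ((a + b) div 2)\<^sup>2) * ((1/5) ^ (2 * m) * R ^ (2 * m\<^sup>2))"
      using R by (intro mult_left_mono) auto
    also have "\<dots> = (1/5) ^ (b - a) * (R ^ a\<^sup>2 * R ^ b\<^sup>2)"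
      unfolding power_add[symmetric] sq unfolding power_add by (simp add: b)
    finally show ?thesis by simp
  qed
  show ?thesis
  proof (cases "a \<le> b")
    case True
    then show ?thesis using *[OF True ev] by simp
  next
    case False
    then show ?thesis using *[of b a] ev by (simp add: add.commute mult.commute)
  qed
qed

text \<open>In the application \<open>F a b\<close> is the moment form between the parts of degree
  \<open>a\<close> and \<open>b\<close> of a polynomial, \<open>G a\<close> lists the entries of its
  degree \<open>a\<close> part at \<open>M\<close>, and \<open>N a\<close> is a Hilbert-Schmidt
  norm. Rescaling by \<open>u\<close> turns the diagonal of the correction into the identity; all
  remaining terms outside the positive block of degrees up to \<open>d\<close> then have row sums at
  most 1.\<close>

lemma graded_form_nonneg:
  fixes F :: "nat \<Rightarrow> nat \<Rightarrow> complex" and G :: "nat \<Rightarrow> 'x \<Rightarrow> complex" and X :: "'x set" and R \<kappa> :: real and d h :: nat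
  defines "N \<equiv> \<lambda>a. L2_set (\<lambda>x. cmod (G a x)) X"
  assumes fin: "finite X" and herm: "\<And>a b. F b a = cnj (F a b)"
    and pos: "0 \<le> Re (\<Sum>a\<le>d. \<Sum>b\<le>d. F a b)"
    and bound: "\<And>a b. a + b \<le> 2 * d \<Longrightarrow> cmod (F a b) \<le> \<kappa> * (N a * N b)"
    and \<kappa>: "0 \<le> \<kappa>" and R: "5 \<le> R" "2 * \<kappa> * (2 * d + 1) \<le> R" and h: "2 * d \<le> h"
  shows "0 \<le> (\<Sum>a\<le>h. \<Sum>b\<le>h. (if a + b \<le> 2 * d then F a b else 0) +
    (if even (a + b) then complex_of_real (R ^ (2 * ((a + b) div 2)\<^sup>2) / R ^ (2 * d)) *
      (\<Sum>x\<in>X. cnj (G a x) * G b x) else 0))"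
    (is "0 \<le> (\<Sum>a\<le>h. \<Sum>b\<le>h. ?E a b)")
proof -
  define c where "c a b = R ^ (2 * ((a + b) div 2)\<^sup>2) / R ^ (2 * d)" for a b
  define g where "g a b = (\<Sum>x\<in>X. cnj (G a x) * G b x)" for a b
  \<comment> \<open>The square root of the diagonal term
    \<open>c a a * (N a)\<^sup>2\<close>.\<close>
  define u where "u a = R ^ a\<^sup>2 * N a / R ^ d" for a
  \<comment> \<open>The first summand bounds truncated moments outside the positive block, the
    second the off-diagonal part of the correction.\<close>
  define q where "q a b = (if a \<le> 2 * d \<and> b \<le> 2 * d then \<kappa> / R else 0) +
    (if a = b then 0 else (1/5) ^ ((a - b) + (b - a)))" for a b
  have N: "0 \<le> N a" for a by (simp add: N_def)
  have u: "0 \<le> u a" for a using R N[of a] by (simp add: u_def)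
  have uu: "u a * u b = (R ^ a\<^sup>2 * R ^ b\<^sup>2) / R ^ (2 * d) * (N a * N b)" for a b
    by (simp add: u_def mult_2 power_add)
  have g_le: "cmod (g a b) \<le> N a * N b" for a b
  proof -
    have "cmod (g a b) \<le> (\<Sum>x\<in>X. \<bar>cmod (G a x)\<bar> * \<bar>cmod (G b x)\<bar>)"
      unfolding g_def by (rule order_trans[OF norm_sum]) (simp add: norm_mult)
    also have "\<dots> \<le> N a * N b" unfolding N_def by (rule L2_set_mult_ineq)
    finally show ?thesis .
  qed
  have g_diag: "Re (g a a) = (N a)\<^sup>2" for a
  proof -
    have "Re (cnj z * z) = (cmod z)\<^sup>2" for z
      using cmod_power2[of z] by (simp add: power2_eq_square)
    then show ?thesis
      unfolding g_def N_def L2_set_def Re_sum by (simp only: real_sqrt_pow2 sum_nonneg zero_le_power2)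
  qed
  have E: "?E a b = (if a + b \<le> 2 * d then F a b else 0) + (if even (a + b) then of_real (c a b) * g a b else 0)"
    for a b by (simp add: c_def g_def)
  have herm_E: "?E b a = cnj (?E a b)" for a b
    unfolding E using herm[of b a] by (simp add: c_def g_def add.commute mult.commute)
  \<comment> \<open>The order on complex numbers also demands reality, which hermitian symmetry
    provides.\<close>
  have Im: "Im (\<Sum>a\<le>h. \<Sum>b\<le>h. ?E a b) = 0"
  proof -
    have "cnj (\<Sum>a\<le>h. \<Sum>b\<le>h. ?E a b) = (\<Sum>a\<le>h. \<Sum>b\<le>h. ?E b a)"
      by (simp only: cnj_sum herm_E[symmetric])
    also have "\<dots> = (\<Sum>a\<le>h. \<Sum>b\<le>h. ?E a b)" by (rule sum.swap)
    finally have "cnj (\<Sum>a\<le>h. \<Sum>b\<le>h. ?E a b) = (\<Sum>a\<le>h. \<Sum>b\<le>h. ?E a b)" .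
    from arg_cong[OF this, of Im] show ?thesis by (simp only: cnj.simps(2) neg_equal_zero)
  qed
  have lower: "(if a \<le> d \<and> b \<le> d then Re (F a b) else 0) + (if a = b then (u a)\<^sup>2 else 0)
      - q a b * (u a * u b) \<le> Re (?E a b)" for a b
  proof -
    have "- ((if a \<le> 2 * d \<and> b \<le> 2 * d then \<kappa> / R else 0) * (u a * u b)) \<le>
      Re (if a + b \<le> 2 * d then F a b else 0) - (if a \<le> d \<and> b \<le> d then Re (F a b) else 0)"
    proof (cases "a + b \<le> 2 * d \<and> \<not> (a \<le> d \<and> b \<le> d)")
      case True
      \<comment> \<open>Leaving the block forces a degree of at least \<open>d + 1\<close>, and (d +
        1)^2 is at least 2 d + 1. So after division by \<open>R ^ (2 * d)\<close> one factor
        \<open>R\<close> remains, and the moments are small against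
        \<open>u a * u b\<close>.\<close>
      then have "d + 1 \<le> max a b" by auto
      then have "(d + 1)\<^sup>2 \<le> (max a b)\<^sup>2" by (rule power_mono) simp
      also have "\<dots> \<le> a\<^sup>2 + b\<^sup>2" by (simp add: max_def)
      finally have "2 * d + 1 \<le> a\<^sup>2 + b\<^sup>2" by (simp add: power2_eq_square)
      then have "R ^ (2 * d) * R \<le> R ^ (a\<^sup>2 + b\<^sup>2)"
        using R power_increasing[of "2 * d + 1" "a\<^sup>2 + b\<^sup>2" R] by (simp add: mult.commute)
      then have "R \<le> (R ^ a\<^sup>2 * R ^ b\<^sup>2) / R ^ (2 * d)"
        using R by (simp add: field_simps power_add)
      then have "N a * N b * R \<le> u a * u b"
        unfolding uu using N[of a] N[of b] by (metis mult.commute mult_left_mono mult_nonneg_nonneg)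
      then have "\<kappa> * (N a * N b) * R \<le> \<kappa> * (u a * u b)"
        using \<kappa> by (metis mult.assoc mult_left_mono)
      then have "\<kappa> * (N a * N b) \<le> \<kappa> / R * (u a * u b)" using R by (simp add: field_simps)
      moreover have "- Re (F a b) \<le> \<kappa> * (N a * N b)"
        using bound[of a b] True abs_Re_le_cmod[of "F a b"] by linarith
      ultimately show ?thesis using True by auto
    next
      case False
      have "0 \<le> \<kappa> / R * (u a * u b)" using \<kappa> R u[of a] u[of b] by simp
      then show ?thesis using False by auto
    qed
    moreover have "(if a = b then (u a)\<^sup>2 else 0)
        - (if a = b then 0 else (1/5) ^ ((a - b) + (b - a))) * (u a * u b)
        \<le> Re (if even (a + b) then of_real (c a b) * g a b else 0)"
    proof (cases "a = b")
      case True
      have "(u a)\<^sup>2 = c a a * (N a)\<^sup>2"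
        using uu[of a a] by (simp add: c_def power2_eq_square mult_2 power_add)
      then show ?thesis using True g_diag[of a] by (simp add: mult_2[symmetric])
    next
      case False
      show ?thesis
      proof (cases "even (a + b)")
        case True
        have "c a b \<le> (1/5) ^ ((a - b) + (b - a)) * (R ^ a\<^sup>2 * R ^ b\<^sup>2) / R ^ (2 * d)"
          unfolding c_def using Hankel_weight_le[OF R(1) True] R by (intro divide_right_mono) auto
        from mult_right_mono[OF this, of "N a * N b"]
        have "c a b * (N a * N b) \<le> (1/5) ^ ((a - b) + (b - a)) * (u a * u b)"
          using N[of a] N[of b] by (simp add: uu mult.assoc)
        moreover have "c a b * cmod (g a b) \<le> c a b * (N a * N b)"
          using R by (intro mult_left_mono g_le) (simp add: c_def)
        moreover have "- (c a b * Re (g a b)) \<le> c a b * cmod (g a b)"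
          using R abs_Re_le_cmod[of "g a b"] mult_left_mono[of "- Re (g a b)" "cmod (g a b)" "c a b"]
          by (simp add: c_def)
        ultimately show ?thesis using False True by simp
      next
        case odd: False
        show ?thesis using False odd u[of a] u[of b] by simp
      qed
    qed
    ultimately show ?thesis unfolding E plus_complex.sel q_def distrib_right by linarith
  qed
  have row: "(\<Sum>b\<le>h. q a b) \<le> 1" for a
  proof -
    have "(\<Sum>b\<le>h. if a \<le> 2 * d \<and> b \<le> 2 * d then \<kappa> / R else 0) \<le> (\<Sum>b\<le>h. if b \<le> 2 * d then \<kappa> / R else 0)"
      using \<kappa> R by (intro sum_mono) auto
    also have "\<dots> = (\<Sum>b\<in>{..2 * d}. \<kappa> / R)"
      using h by (intro sum.mono_neutral_cong_right) auto
    also have "\<dots> = (2 * d + 1) * \<kappa> / R" by simp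
    \<comment> \<open>The second lower bound on \<open>R\<close> is made for this half of the row
      budget.\<close>
    also have "\<dots> \<le> 1/2" using R by (simp add: field_simps)
    finally show ?thesis using geometric_row_sum[where a = a and h = h] by (simp add: q_def sum.distrib)
  qed
  have "(\<Sum>a\<le>h. \<Sum>b\<le>h. q a b * (u a * u b)) \<le> 1 * (\<Sum>a\<le>h. (u a)\<^sup>2)"
    by (rule Schur_test) (use \<kappa> R row in \<open>auto simp: q_def add.commute\<close>)
  moreover have "(\<Sum>a\<le>h. \<Sum>b\<le>h. if a = b then (u a)\<^sup>2 else 0) = (\<Sum>a\<le>h. (u a)\<^sup>2)"
    by (intro sum.cong refl) simp
  moreover have "(\<Sum>a\<le>h. \<Sum>b\<le>h. if a \<le> d \<and> b \<le> d then Re (F a b) else 0) = Re (\<Sum>a\<le>d. \<Sum>b\<le>d. F a b)"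
  proof -
    have "(\<Sum>a\<le>h. \<Sum>b\<le>h. if a \<le> d \<and> b \<le> d then Re (F a b) else 0) =
        (\<Sum>a\<le>d. \<Sum>b\<le>h. if a \<le> d \<and> b \<le> d then Re (F a b) else 0)"
      using h by (intro sum.mono_neutral_right) auto
    also have "\<dots> = (\<Sum>a\<le>d. \<Sum>b\<le>d. Re (F a b))"
      using h by (intro sum.cong[OF refl] sum.mono_neutral_cong_right) auto
    finally show ?thesis by simp
  qed
  moreover have "(\<Sum>a\<le>h. \<Sum>b\<le>h. (if a \<le> d \<and> b \<le> d then Re (F a b) else 0) +
      (if a = b then (u a)\<^sup>2 else 0) - q a b * (u a * u b)) \<le> (\<Sum>a\<le>h. \<Sum>b\<le>h. Re (?E a b))"
    by (intro sum_mono lower)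
  ultimately have "0 \<le> (\<Sum>a\<le>h. \<Sum>b\<le>h. Re (?E a b))"
    using pos by (simp add: sum.distrib sum_subtractf)
  then show ?thesis using Im unfolding less_eq_complex_def by simp
qed

section \<open>Traces on generic matrices\<close>

text \<open>\<open>word_trace\<close> does not postulate this symmetry; it is forced by positivity,
  as in \<open>trace_star\<close>.\<close>

lemma word_trace_rev:
  assumes "word_trace n t" "w \<in> words n"
  shows "t (rev_word w) = cnj (t w)"
proof -
  interpret tracial_star_algebra "nc_polys n" "lin t" by (rule tracial_nc_polys[OF assms(1)])
  show ?thesis
    using trace_star[of "Poly_Mapping.single w 1"] assms(2)
    by (simp add: nc_polys_simps ncstar_single)
qed

text \<open>The condition on the entries makes all words of equal length, at most \<open>l\<close>, in \<open>M\<close> linearly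
  independent: column \<open>col\<close> separates them.\<close>

locale independent_words =
  fixes n k l :: nat and M :: "nat \<Rightarrow> complex mat" and row :: "word \<Rightarrow> nat" and col :: nat
  assumes M: "self_adjoint_tuple n k M"
    and row: "v \<in> words n \<Longrightarrow> wlen v \<le> l \<Longrightarrow> row v < k" and col: "col < k"
    and entry: "v \<in> words n \<Longrightarrow> w \<in> words n \<Longrightarrow> wlen v = wlen w \<Longrightarrow> wlen w \<le> l \<Longrightarrow>
      word_mat k M w $$ (row v, col) = of_bool (v = w)"

text \<open>Sums of creation and annihilation operators on the full Fock space, compressed to the span of
  the words of length at most \<open>l\<close>. Applied to the vacuum, a word \<open>w\<close> in these operators gives the
  basis vector \<open>w\<close> plus terms of smaller degree.\<close>

lemma independent_words_exist:
  assumes k: "card {w \<in> words n. wlen w \<le> l} \<le> k"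
  shows "\<exists>M row col. independent_words n k l M row col"
proof -
  define B where "B = {w \<in> words n. wlen w \<le> l}"
  have "finite B" unfolding B_def by (rule finite_words)
  then obtain e where e: "bij_betw e B {0..<card B}" using ex_bij_betw_finite_nat by blast
  have inj: "e v = e w \<longleftrightarrow> v = w" if "v \<in> B" "w \<in> B" for v w
    using e that by (auto simp: bij_betw_def inj_on_def)
  have e_less: "e v < k" if "v \<in> B" for v
  proof -
    have "e v \<in> {0..<card B}" using e that by (auto simp: bij_betw_def)
    then show ?thesis using k by (simp add: B_def)
  qed
  define c where "c i v = Word (i # letters v)" for i v
  have c_inj: "c i v = c j w \<longleftrightarrow> i = j \<and> v = w" for i j v w
    by (cases v; cases w) (simp add: c_def)
  have c_len: "wlen (c i v) = Suc (wlen v)" for i v by (simp add: c_def)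
  \<comment> \<open>Creation of the letter \<open>i\<close> plus its transpose, in the basis
    numbered by \<open>e\<close>. Surplus dimensions when \<open>k\<close> exceeds
    \<open>card B\<close> are filled with zeros.\<close>
  define M where "M i = mat k k (\<lambda>(p, q). of_bool (\<exists>v\<in>B. c i v \<in> B \<and>
      (p = e (c i v) \<and> q = e v \<or> q = e (c i v) \<and> p = e v)) :: complex)" for i
  have M: "self_adjoint_tuple n k M"
    unfolding self_adjoint_tuple_def
  proof (intro allI impI conjI)
    fix i
    show c: "M i \<in> carrier_mat k k" by (simp add: M_def)
    show "mat_adjoint (M i) = M i"
    proof (rule eq_matI)
      fix p q assume "p < dim_row (M i)" "q < dim_col (M i)"
      then have "p < k" "q < k" using c by auto
      then show "mat_adjoint (M i) $$ (p, q) = M i $$ (p, q)"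
        unfolding mat_adjoint_index[OF c \<open>p < k\<close> \<open>q < k\<close>]
        by (simp add: M_def) (meson disj_commute)
    qed (use mat_adjoint_carrier[OF c] c in auto)
  qed
  have zero: "0 \<in> B" by (simp add: B_def)
  \<comment> \<open>Strengthened from equal lengths to \<open>wlen w \<le> wlen v\<close>, since the
    induction meets longer words \<open>v\<close> through annihilation.\<close>
  have entry: "word_mat k M w $$ (e v, e 0) = of_bool (v = w)"
    if "w \<in> B" "v \<in> B" "wlen w \<le> wlen v" for v w
    using that
  proof (induction w arbitrary: v rule: word_induct)
    case Nil
    then show ?case using inj[OF Nil(2) zero] e_less[OF Nil(2)] e_less[OF zero]
      by (simp add: word_mat_Nil zero_word_def)
  next
    case (Cons i xs)
    define u where "u = Word xs"
    have w: "Word (i # xs) = c i u" by (simp add: u_def c_def)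
    have i: "i < n" and u: "u \<in> words n" "u \<in> B"
      using Cons.prems(1) by (auto simp: B_def u_def)
    have len: "Suc (wlen u) \<le> wlen v" using Cons.prems(3) unfolding w c_len .
    have summand: "M i $$ (e v, q) * word_mat k M u $$ (q, e 0) = of_bool (q = e u \<and> v = c i u)"
      if q: "q < k" for q
    proof (cases "\<exists>v'\<in>B. c i v' \<in> B \<and> (e v = e (c i v') \<and> q = e v' \<or> q = e (c i v') \<and> e v = e v')")
      case True
      then have M1: "M i $$ (e v, q) = 1" using q e_less[OF Cons.prems(2)] by (simp add: M_def)
      from True obtain v' where v': "v' \<in> B" "c i v' \<in> B"
        "e v = e (c i v') \<and> q = e v' \<or> q = e (c i v') \<and> e v = e v'" by blast
      from v'(3) show ?thesis
      proof
        assume "e v = e (c i v') \<and> q = e v'"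
        then have "v = c i v'" "q = e v'" using inj Cons.prems(2) v' by auto
        then show ?thesis
          using M1 Cons.IH[of v'] u v' len inj[OF v'(1) u(2)] by (auto simp: u_def c_inj c_len)
      next
        assume "q = e (c i v') \<and> e v = e v'"
        then have "v = v'" "q = e (c i v)" using inj Cons.prems(2) v' by auto
        \<comment> \<open>The annihilation term involves a component longer than \<open>u\<close>,
          which is zero by the induction hypothesis.\<close>
        moreover have "c i v \<noteq> u" using len c_len[of i v] by auto
        ultimately show ?thesis
          using M1 Cons.IH[of "c i v"] u v' len inj[OF _ u(2), of "c i v"]
          by (auto simp: u_def[symmetric] c_len)
      qed
    next
      case False
      then have "M i $$ (e v, q) = 0" using q e_less[OF Cons.prems(2)] by (simp add: M_def)
      moreover have "\<not> (q = e u \<and> v = c i u)" using False u Cons.prems(2) by blast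
      ultimately show ?thesis by simp
    qed
    have "word_mat k M (Word (i # xs)) $$ (e v, e 0) =
        (\<Sum>q<k. M i $$ (e v, q) * word_mat k M u $$ (q, e 0))"
      using M_carrier[OF M i] word_mat_carrier[OF M u(1)] e_less[OF zero] e_less[OF Cons.prems(2)]
      by (simp add: word_mat_Cons u_def mult_mat_index del: index_mult_mat)
    also have "\<dots> = (\<Sum>q<k. of_bool (q = e u \<and> v = c i u))"
      by (intro sum.cong refl) (simp add: summand)
    also have "\<dots> = of_bool (v = c i u)" using e_less[OF u(2)] by simp
    finally show ?case by (simp add: w)
  qed
  have "independent_words n k l M e (e 0)"
    by unfold_locales (use M e_less zero entry in \<open>auto simp: B_def\<close>)
  then show ?thesis by blast
qed

section \<open>Separation of short words and the matrix trace\<close>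

context independent_words
begin

lemma coefficient_eq:
  assumes "finite S" "S \<subseteq> words n" "v \<in> S" "wlen v \<le> l"
  shows "(\<Sum>w | w \<in> S \<and> wlen w = wlen v. g w * word_mat k M w $$ (row v, col)) = g v"
proof -
  have "(\<Sum>w | w \<in> S \<and> wlen w = wlen v. g w * word_mat k M w $$ (row v, col)) =
      (\<Sum>w | w \<in> S \<and> wlen w = wlen v. if w = v then g v else 0)"
    using assms by (intro sum.cong refl) (auto simp: entry subset_iff)
  also have "\<dots> = g v" using assms by simp
  finally show ?thesis .
qed

text \<open>Homogeneity isolates the words as long as \<open>v\<close>, and the separating entry
  then reads off the coefficient of \<open>v\<close>, which must be zero. Moments of words of length
  up to \<open>l\<close> can therefore be prescribed without regard to the ideal.\<close>

lemma vanishing_ideal_no_short_words: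
  assumes P: "P \<in> vanishing_ideal n k" and v: "v \<in> Poly_Mapping.keys P"
  shows "l < wlen v"
proof (rule ccontr)
  assume "\<not> l < wlen v"
  moreover have S: "Poly_Mapping.keys P \<subseteq> words n" using P by (simp add: vanishing_ideal_iff)
  ultimately have "Poly_Mapping.lookup P v = 0" "v \<in> words n"
    using vanishing_ideal_homogeneous[OF P M row col, of v "wlen v"] v
      coefficient_eq[of "Poly_Mapping.keys P" v "Poly_Mapping.lookup P"] by auto
  then show False using v by (simp add: in_keys_iff)
qed

definition mat_tr :: "word \<Rightarrow> complex" where
  "mat_tr w = (\<Sum>i<k. word_mat k M w $$ (i, i))"

lemma mat_tr_add:
  assumes "v \<in> words n" "w \<in> words n"
  shows "mat_tr (v + w) = mat_tr (w + v)"
proof -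
  have "mat_tr (v + w) = (\<Sum>i<k. \<Sum>j<k. word_mat k M w $$ (j, i) * word_mat k M v $$ (i, j))"
    using assms by (simp add: mat_tr_def word_mat_add_index[OF M] mult.commute)
  also have "\<dots> = mat_tr (w + v)"
    using assms by (subst sum.swap) (simp add: mat_tr_def word_mat_add_index[OF M])
  finally show ?thesis .
qed

text \<open>The Hilbert-Schmidt inner product of two words in \<open>M\<close>; in this form the
  correction is the Gram form of \<open>graded_form_nonneg\<close>.\<close>

lemma mat_tr_rev_add:
  assumes "v \<in> words n" "w \<in> words n"
  shows "mat_tr (rev_word v + w) =
    (\<Sum>x\<in>{..<k} \<times> {..<k}. cnj (word_mat k M v $$ x) * word_mat k M w $$ x)"
proof -
  have "mat_tr (rev_word v + w) = (\<Sum>i<k. \<Sum>j<k. cnj (word_mat k M v $$ (j, i)) * word_mat k M w $$ (j, i))"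
    using assms by (simp add: mat_tr_def word_mat_add_index[OF M] word_mat_rev_index[OF M])
  also have "\<dots> = (\<Sum>j<k. \<Sum>i<k. cnj (word_mat k M v $$ (j, i)) * word_mat k M w $$ (j, i))"
    by (rule sum.swap)
  finally show ?thesis by (simp add: sum.cartesian_product)
qed

end

text \<open>Independence is required up to length \<open>2 * d\<close> because a truncated block may
  involve any degree up to \<open>2 * d\<close>. The bound on \<open>R\<close> is that of
  \<open>graded_form_nonneg\<close> with \<open>\<kappa>\<close> equal to \<open>K\<close> times the
  square of the number of such words.\<close>

locale trace_approximation = independent_words n k "2 * d" M row col
  for n k d M row col +
  fixes f :: "word \<Rightarrow> complex" and K R :: real
  assumes f: "word_trace n f"
    and K: "w \<in> words n \<Longrightarrow> wlen w \<le> 2 * d \<Longrightarrow> cmod (f w) \<le> K"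
    and R5: "5 \<le> R"
    and R: "2 * (K * (real (card {w \<in> words n. wlen w \<le> 2 * d}))\<^sup>2) * (2 * d + 1) \<le> R"
begin

text \<open>Odd lengths get weight zero: homogeneity of the ideal permits it, and they occur only in
  off-diagonal blocks.\<close>

definition perturbed :: "word \<Rightarrow> complex" where
  "perturbed w = (if wlen w \<le> 2 * d then f w else 0) +
    (if even (wlen w) then complex_of_real (R ^ (2 * (wlen w div 2)\<^sup>2) / R ^ (2 * d)) * mat_tr w else 0)"

lemma K_nonneg: "0 \<le> K"
  by (rule order_trans[OF norm_ge_zero K[of 0]]) simp_all

lemma perturbed_comm:
  assumes "v \<in> words n" "w \<in> words n"
  shows "perturbed (v + w) = perturbed (w + v)"
proof -
  have "f (v + w) = f (w + v)" using f assms by (simp add: word_trace_def)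
  then show ?thesis using mat_tr_add[OF assms] by (simp add: perturbed_def add.commute)
qed

lemma perturbed_pos:
  assumes S: "finite S" "S \<subseteq> words n"
  shows "0 \<le> (\<Sum>v\<in>S. \<Sum>w\<in>S. cnj (g v) * g w * perturbed (rev_word v + w))"
proof -
  \<comment> \<open>A convenient bound for all lengths in \<open>S\<close> that also satisfies
    \<open>2 * d \<le> h\<close>.\<close>
  define h where "h = 2 * d + (\<Sum>w\<in>S. wlen w)"
  define S' where "S' a = {w. w \<in> S \<and> wlen w = a}" for a
  define F where "F a b = (\<Sum>v\<in>S' a. \<Sum>w\<in>S' b. cnj (g v) * g w * f (rev_word v + w))" for a b
  define G where "G a x = (\<Sum>w\<in>S' a. g w * word_mat k M w $$ x)" for a x
  define X where "X = {..<k} \<times> {..<k}"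
  define N where "N a = L2_set (\<lambda>x. cmod (G a x)) X" for a
  define c where "c a b = complex_of_real (R ^ (2 * ((a + b) div 2)\<^sup>2) / R ^ (2 * d))" for a b :: nat
  define m where "m = card {w \<in> words n. wlen w \<le> 2 * d}"
  have finS': "finite (S' a)" for a using S by (simp add: S'_def)
  have S'_words: "v \<in> S' a \<Longrightarrow> v \<in> words n" "v \<in> S' a \<Longrightarrow> wlen v = a" "v \<in> S' a \<Longrightarrow> v \<in> S" for v a
    using S by (auto simp: S'_def)
  have group: "(\<Sum>v\<in>T. E v) = (\<Sum>a\<le>r. \<Sum>v | v \<in> T \<and> wlen v = a. E v)"
    if "finite T" "\<And>v. v \<in> T \<Longrightarrow> wlen v \<le> r" for T r and E :: "word \<Rightarrow> complex"
    using that by (intro sum.group[symmetric]) auto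
  have group2: "(\<Sum>v\<in>T. \<Sum>w\<in>T. E v w) =
      (\<Sum>a\<le>r. \<Sum>b\<le>r. \<Sum>v | v \<in> T \<and> wlen v = a. \<Sum>w | w \<in> T \<and> wlen w = b. E v w)"
    if T: "finite T" "\<And>v. v \<in> T \<Longrightarrow> wlen v \<le> r" for T r and E :: "word \<Rightarrow> word \<Rightarrow> complex"
  proof -
    have "(\<Sum>v\<in>T. \<Sum>w\<in>T. E v w) = (\<Sum>a\<le>r. \<Sum>v | v \<in> T \<and> wlen v = a. \<Sum>w\<in>T. E v w)"
      by (rule group[OF T])
    also have "\<dots> = (\<Sum>a\<le>r. \<Sum>v | v \<in> T \<and> wlen v = a. \<Sum>b\<le>r. \<Sum>w | w \<in> T \<and> wlen w = b. E v w)"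
      by (intro sum.cong refl group[OF T])
    also have "\<dots> = (\<Sum>a\<le>r. \<Sum>b\<le>r. \<Sum>v | v \<in> T \<and> wlen v = a. \<Sum>w | w \<in> T \<and> wlen w = b. E v w)"
      by (intro sum.cong refl sum.swap)
    finally show ?thesis .
  qed
  have "wlen v \<le> h" if "v \<in> S" for v
    using member_le_sum[OF that, of wlen] S(1) by (simp add: h_def)
  then have "(\<Sum>v\<in>S. \<Sum>w\<in>S. cnj (g v) * g w * perturbed (rev_word v + w)) =
      (\<Sum>a\<le>h. \<Sum>b\<le>h. \<Sum>v\<in>S' a. \<Sum>w\<in>S' b. cnj (g v) * g w * perturbed (rev_word v + w))"
    unfolding S'_def by (rule group2[OF S(1)])
  also have "\<dots> = (\<Sum>a\<le>h. \<Sum>b\<le>h. (if a + b \<le> 2 * d then F a b else 0) +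
      (if even (a + b) then c a b * (\<Sum>x\<in>X. cnj (G a x) * G b x) else 0))"
  proof (intro sum.cong refl)
    fix a b
    have GG: "(\<Sum>x\<in>X. cnj (G a x) * G b x) =
        (\<Sum>v\<in>S' a. \<Sum>w\<in>S' b. cnj (g v) * g w * mat_tr (rev_word v + w))"
    proof -
      have "(\<Sum>x\<in>X. cnj (G a x) * G b x) = (\<Sum>x\<in>X. \<Sum>v\<in>S' a. \<Sum>w\<in>S' b.
          cnj (g v) * g w * (cnj (word_mat k M v $$ x) * word_mat k M w $$ x))"
        unfolding G_def cnj_sum sum_product by (intro sum.cong refl) (simp add: mult_ac)
      also have "\<dots> = (\<Sum>v\<in>S' a. \<Sum>x\<in>X. \<Sum>w\<in>S' b.
          cnj (g v) * g w * (cnj (word_mat k M v $$ x) * word_mat k M w $$ x))"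
        by (rule sum.swap)
      also have "\<dots> = (\<Sum>v\<in>S' a. \<Sum>w\<in>S' b. \<Sum>x\<in>X.
          cnj (g v) * g w * (cnj (word_mat k M v $$ x) * word_mat k M w $$ x))"
        by (intro sum.cong refl sum.swap)
      also have "\<dots> = (\<Sum>v\<in>S' a. \<Sum>w\<in>S' b. cnj (g v) * g w * mat_tr (rev_word v + w))"
        by (intro sum.cong refl) (simp add: S'_words mat_tr_rev_add X_def sum_distrib_left)
      finally show ?thesis .
    qed
    have "(\<Sum>v\<in>S' a. \<Sum>w\<in>S' b. cnj (g v) * g w * perturbed (rev_word v + w)) =
      (\<Sum>v\<in>S' a. \<Sum>w\<in>S' b. (if a + b \<le> 2 * d then cnj (g v) * g w * f (rev_word v + w) else 0) +
        (if even (a + b) then c a b * (cnj (g v) * g w * mat_tr (rev_word v + w)) else 0))"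
      by (intro sum.cong refl)
        (simp add: perturbed_def S'_words c_def distrib_left mult_ac)
    also have "\<dots> = (if a + b \<le> 2 * d then F a b else 0) +
      (if even (a + b) then c a b * (\<Sum>x\<in>X. cnj (G a x) * G b x) else 0)"
      unfolding GG by (simp add: F_def sum.distrib sum_distrib_left)
    finally show "(\<Sum>v\<in>S' a. \<Sum>w\<in>S' b. cnj (g v) * g w * perturbed (rev_word v + w)) =
      (if a + b \<le> 2 * d then F a b else 0) +
      (if even (a + b) then c a b * (\<Sum>x\<in>X. cnj (G a x) * G b x) else 0)" .
  qed
  also have "0 \<le> \<dots>"
    unfolding c_def
  proof (rule graded_form_nonneg[where \<kappa> = "K * (real m)\<^sup>2"])
    show "finite X" by (simp add: X_def)
    show "F b a = cnj (F a b)" for a b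
    proof -
      have "f (rev_word v + w) = cnj (f (rev_word w + v))" if "v \<in> S' b" "w \<in> S' a" for v w
        using word_trace_rev[OF f, of "rev_word w + v"] S'_words(1)[OF that(1)] S'_words(1)[OF that(2)]
        by (simp add: rev_word_add)
      then have "F b a = (\<Sum>v\<in>S' b. \<Sum>w\<in>S' a. cnj (cnj (g w) * g v * f (rev_word w + v)))"
        unfolding F_def by (intro sum.cong refl) (simp add: mult_ac)
      also have "\<dots> = cnj (F a b)" unfolding F_def cnj_sum by (rule sum.swap)
      finally show ?thesis .
    qed
    \<comment> \<open>Positivity of \<open>f\<close> itself, applied to the part of the polynomial
      of degree at most \<open>d\<close>.\<close>
    show "0 \<le> Re (\<Sum>a\<le>d. \<Sum>b\<le>d. F a b)"
    proof -
      define T where "T = {w \<in> S. wlen w \<le> d}"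
      have T: "finite T" "T \<subseteq> words n" "\<And>v. v \<in> T \<Longrightarrow> wlen v \<le> d" using S by (auto simp: T_def)
      have "{v. v \<in> T \<and> wlen v = a} = S' a" if "a \<le> d" for a using that by (auto simp: T_def S'_def)
      then have "(\<Sum>a\<le>d. \<Sum>b\<le>d. \<Sum>v | v \<in> T \<and> wlen v = a. \<Sum>w | w \<in> T \<and> wlen w = b.
          cnj (g v) * g w * f (rev_word v + w)) = (\<Sum>a\<le>d. \<Sum>b\<le>d. F a b)"
        unfolding F_def by (intro sum.cong refl) simp_all
      then have "(\<Sum>v\<in>T. \<Sum>w\<in>T. cnj (g v) * g w * f (rev_word v + w)) = (\<Sum>a\<le>d. \<Sum>b\<le>d. F a b)"
        using group2[OF T(1,3), of "\<lambda>v w. cnj (g v) * g w * f (rev_word v + w)"] by simp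
      moreover have "0 \<le> (\<Sum>v\<in>T. \<Sum>w\<in>T. cnj (g v) * g w * f (rev_word v + w))"
        using f T(1,2) unfolding word_trace_def by blast
      ultimately show ?thesis by (simp add: less_eq_complex_def)
    qed
    fix a b assume ab: "a + b \<le> 2 * d"
    \<comment> \<open>Independence enters here: the coefficient is an entry of the matrix value
      \<open>G a'\<close>, hence bounded by its Hilbert-Schmidt norm.\<close>
    have coeff: "cmod (g v) \<le> N a'" if v: "v \<in> S' a'" and a': "a' \<le> 2 * d" for v a'
    proof -
      have "G a' (row v, col) = g v"
        using coefficient_eq[OF S S'_words(3)[OF v], of g] S'_words(2)[OF v] a'
        by (simp add: G_def S'_def)
      moreover have "(row v, col) \<in> X"
        using row[OF S'_words(1)[OF v]] S'_words(2)[OF v] a' col by (simp add: X_def)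
      ultimately show ?thesis
        using member_le_L2_set[of X "(row v, col)" "\<lambda>x. cmod (G a' x)"] by (simp add: N_def X_def)
    qed
    have N0: "0 \<le> N a'" for a' by (simp add: N_def)
    have card: "real (card (S' a')) \<le> m" if "a' \<le> 2 * d" for a'
      unfolding m_def using that finite_words S'_words
      by (intro of_nat_mono card_mono) auto
    \<comment> \<open>Used once for each argument of \<open>F\<close>, which accounts for the square
      of \<open>m\<close> in the constant.\<close>
    have l1: "(\<Sum>v\<in>S' a'. cmod (g v)) \<le> m * N a'" if a': "a' \<le> 2 * d" for a'
    proof -
      have "(\<Sum>v\<in>S' a'. cmod (g v)) \<le> real (card (S' a')) * N a'"
        by (rule sum_bounded_above) (rule coeff[OF _ a'])
      also have "\<dots> \<le> m * N a'" using card[OF a'] N0 by (rule mult_right_mono)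
      finally show ?thesis .
    qed
    have "cmod (F a b) \<le> (\<Sum>v\<in>S' a. \<Sum>w\<in>S' b. cmod (cnj (g v) * g w * f (rev_word v + w)))"
      unfolding F_def by (intro order_trans[OF norm_sum] sum_mono norm_sum)
    also have "\<dots> \<le> (\<Sum>v\<in>S' a. \<Sum>w\<in>S' b. K * (cmod (g v) * cmod (g w)))"
    proof (intro sum_mono)
      fix v w assume v: "v \<in> S' a" and w: "w \<in> S' b"
      have "cmod (f (rev_word v + w)) \<le> K"
        using K[of "rev_word v + w"] S'_words[OF v] S'_words[OF w] ab by simp
      from mult_left_mono[OF this, of "cmod (g v) * cmod (g w)"]
      show "cmod (cnj (g v) * g w * f (rev_word v + w)) \<le> K * (cmod (g v) * cmod (g w))"
        by (simp add: norm_mult mult_ac)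
    qed
    also have "\<dots> = K * ((\<Sum>v\<in>S' a. cmod (g v)) * (\<Sum>w\<in>S' b. cmod (g w)))"
      unfolding sum_product by (simp only: sum_distrib_left)
    also have "\<dots> \<le> K * ((m * N a) * (m * N b))"
      using ab N0 by (intro mult_left_mono[OF mult_mono K_nonneg] l1 sum_nonneg) auto
    finally show "cmod (F a b) \<le> K * (real m)\<^sup>2 *
        (L2_set (\<lambda>x. cmod (G a x)) X * L2_set (\<lambda>x. cmod (G b x)) X)"
      by (simp add: N_def power2_eq_square mult_ac)
  qed (use R5 R K_nonneg in \<open>auto simp: h_def m_def\<close>)
  finally show ?thesis .
qed

text \<open>An element of the ideal has no words of length up to \<open>2 * d\<close>, so the
  truncated moments contribute nothing. On each graded part the weight is constant and factors out
  of a sum that vanishes by homogeneity.\<close>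

lemma perturbed_vanishes:
  assumes P: "P \<in> vanishing_ideal n k"
  shows "lin perturbed P = 0"
proof -
  let ?p = "Poly_Mapping.lookup P"
  define S' where "S' a = {w. w \<in> Poly_Mapping.keys P \<and> wlen w = a}" for a
  define r where "r = (\<Sum>w\<in>Poly_Mapping.keys P. wlen w)"
  have "wlen v \<le> r" if "v \<in> Poly_Mapping.keys P" for v
    using member_le_sum[OF that, of wlen] by (simp add: r_def)
  then have "lin perturbed P = (\<Sum>a\<le>r. \<Sum>w\<in>S' a. ?p w * perturbed w)"
    unfolding lin_def S'_def by (intro sum.group[symmetric]) auto
  also have "\<dots> = 0"
  proof (rule sum.neutral, rule ballI)
    fix a
    define c where "c = (if even a then complex_of_real (R ^ (2 * (a div 2)\<^sup>2) / R ^ (2 * d)) else 0)"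
    have "?p w * perturbed w = c * (?p w * mat_tr w)" if "w \<in> S' a" for w
      using that vanishing_ideal_no_short_words[OF P, of w] by (auto simp: S'_def perturbed_def c_def)
    then have "(\<Sum>w\<in>S' a. ?p w * perturbed w) = c * (\<Sum>w\<in>S' a. ?p w * mat_tr w)"
      unfolding sum_distrib_left by (intro sum.cong refl)
    also have "(\<Sum>w\<in>S' a. ?p w * mat_tr w) = (\<Sum>i<k. \<Sum>w\<in>S' a. ?p w * word_mat k M w $$ (i, i))"
      unfolding mat_tr_def sum_distrib_left by (rule sum.swap)
    also have "\<dots> = 0"
    proof (rule sum.neutral, rule ballI)
      fix i assume "i \<in> {..<k}"
      then show "(\<Sum>w\<in>S' a. ?p w * word_mat k M w $$ (i, i)) = 0"
        unfolding S'_def by (intro vanishing_ideal_homogeneous[OF P M]) auto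
    qed
    finally show "(\<Sum>w\<in>S' a. ?p w * perturbed w) = 0" by simp
  qed
  finally show ?thesis .
qed

lemma perturbed_zero: "perturbed 0 = complex_of_real (1 + real k / R ^ (2 * d))"
  using f by (simp add: perturbed_def word_trace_def mat_tr_def word_mat_Nil[folded zero_word_def])

definition approx_trace :: "word \<Rightarrow> complex" where
  "approx_trace w = perturbed w / perturbed 0"

lemma matrix_trace_approx_trace: "matrix_trace n k approx_trace"
proof -
  define r where "r = 1 / (1 + real k / R ^ (2 * d))"
  have r: "0 < r" using R5 by (simp add: r_def add_pos_nonneg)
  have eq: "approx_trace w = complex_of_real r * perturbed w" for w
    by (simp add: approx_trace_def perturbed_zero r_def)
  have "0 \<le> (\<Sum>v\<in>S. \<Sum>w\<in>S. cnj (g v) * g w * approx_trace (rev_word v + w))"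
    if "finite S" "S \<subseteq> words n" for S g
  proof -
    have "(\<Sum>v\<in>S. \<Sum>w\<in>S. cnj (g v) * g w * approx_trace (rev_word v + w)) =
        complex_of_real r * (\<Sum>v\<in>S. \<Sum>w\<in>S. cnj (g v) * g w * perturbed (rev_word v + w))"
      by (simp add: eq sum_distrib_left mult_ac)
    then show ?thesis using perturbed_pos[OF that, of g] r
      by (simp add: less_eq_complex_def)
  qed
  moreover have "approx_trace 0 = 1"
  proof -
    have "perturbed 0 \<noteq> 0" unfolding perturbed_zero of_real_eq_0_iff using r by (auto simp: r_def)
    then show ?thesis by (simp add: approx_trace_def)
  qed
  moreover have "lin approx_trace P = complex_of_real r * lin perturbed P" for P
    by (simp add: lin_def eq sum_distrib_left mult_ac)
  ultimately show ?thesis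
    using perturbed_comm perturbed_vanishes by (simp add: matrix_trace_def word_trace_def eq)
qed

text \<open>The gap 3 in the exponents supplies three powers of \<open>R\<close>: one absorbs
  \<open>mat_tr w\<close>, one absorbs \<open>1 + K\<close>, and the last is the error bound. The
  normalising factor is controlled in the same way at the empty word.\<close>

lemma approx_trace_close:
  assumes w: "w \<in> words n" "wlen w \<le> 2 * d" "2 * (wlen w div 2)\<^sup>2 + 3 \<le> 2 * d" "3 \<le> 2 * d"
    and R1: "1 + K \<le> R" "cmod (mat_tr w) \<le> R" "cmod (mat_tr 0) \<le> R"
  shows "cmod (approx_trace w - f w) \<le> 1 / R"
proof -
  have small: "R ^ (2 * (wlen v div 2)\<^sup>2) / R ^ (2 * d) * cmod (mat_tr v) \<le> 1 / R\<^sup>2"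
    if v: "2 * (wlen v div 2)\<^sup>2 + 3 \<le> 2 * d" "cmod (mat_tr v) \<le> R" for v
  proof -
    let ?e = "2 * (wlen v div 2)\<^sup>2"
    have "R ^ ?e * cmod (mat_tr v) * R\<^sup>2 \<le> R ^ ?e * R * R\<^sup>2"
      using v R5 by (intro mult_right_mono mult_left_mono) auto
    also have "\<dots> = R ^ (?e + 3)" by (simp add: power_add numeral_eq_Suc)
    also have "\<dots> \<le> R ^ (2 * d)" using v R5 by (intro power_increasing) auto
    finally show ?thesis using R5 by (simp add: field_simps)
  qed
  define \<delta> where "\<delta> = (if even (wlen w)
    then complex_of_real (R ^ (2 * (wlen w div 2)\<^sup>2) / R ^ (2 * d)) * mat_tr w else 0)"
  define \<epsilon> where "\<epsilon> = real k / R ^ (2 * d)"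
  have \<delta>: "cmod \<delta> \<le> 1 / R\<^sup>2"
    using small[OF w(3) R1(2)] R5 by (simp add: \<delta>_def norm_mult norm_divide norm_power)
  have "mat_tr 0 = complex_of_real (real k)"
    by (simp add: mat_tr_def word_mat_Nil[folded zero_word_def])
  then have \<epsilon>: "0 \<le> \<epsilon>" "\<epsilon> \<le> 1 / R\<^sup>2"
    using small[of 0] w(4) R1(3) R5 by (simp_all add: \<epsilon>_def)
  have "approx_trace w - f w = (\<delta> - complex_of_real \<epsilon> * f w) / complex_of_real (1 + \<epsilon>)"
  proof -
    have "complex_of_real (1 + \<epsilon>) \<noteq> 0" using \<epsilon>(1) by (metis add_nonneg_eq_0_iff of_real_eq_0_iff zero_le_one zero_neq_one)
    moreover have "perturbed w = f w + \<delta>" using w(2) by (simp add: perturbed_def \<delta>_def)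
    ultimately show ?thesis
      unfolding approx_trace_def perturbed_zero \<epsilon>_def[symmetric] by (simp add: field_simps)
  qed
  then have "cmod (approx_trace w - f w) = cmod (\<delta> - complex_of_real \<epsilon> * f w) / (1 + \<epsilon>)"
    using \<epsilon>(1) by (simp only: norm_divide norm_of_real)
  also have "\<dots> \<le> cmod (\<delta> - complex_of_real \<epsilon> * f w)"
    using \<epsilon>(1) divide_left_mono[of 1 "1 + \<epsilon>" "cmod (\<delta> - complex_of_real \<epsilon> * f w)"] by simp
  also have "\<dots> \<le> cmod \<delta> + \<epsilon> * cmod (f w)"
    using norm_triangle_ineq4[of \<delta> "complex_of_real \<epsilon> * f w"] \<epsilon>(1) by (simp add: norm_mult)
  also have "\<dots> \<le> 1 / R\<^sup>2 + 1 / R\<^sup>2 * K"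
    using \<delta> \<epsilon> K[OF w(1,2)] by (intro add_mono mult_mono) auto
  also have "\<dots> = (1 + K) / R\<^sup>2" by (simp add: add_divide_distrib)
  also have "\<dots> \<le> R / R\<^sup>2" using R1(1) by (intro divide_right_mono) auto
  also have "\<dots> = 1 / R" by (simp add: power2_eq_square)
  finally show ?thesis .
qed

end

section \<open>Convergence of the moments\<close>

lemma matrix_trace_approximation:
  assumes f: "word_trace n f"
    and k: "card {w \<in> words n. wlen w \<le> 2 * (D\<^sup>2 + 2)} \<le> k"
  shows "\<exists>t. matrix_trace n k t \<and> (\<forall>w\<in>words n. wlen w \<le> D \<longrightarrow> cmod (t w - f w) \<le> 1 / (real D + 1))"
proof -
  \<comment> \<open>A word of length at most \<open>D\<close> has weight exponent at most
    \<open>2 * D\<^sup>2\<close> before the offset, so \<open>2 * d\<close> leaves a gap of at least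
    4.\<close>
  define d where "d = D\<^sup>2 + 2"
  define B where "B = {w \<in> words n. wlen w \<le> 2 * d}"
  obtain M row col where "independent_words n k (2 * d) M row col"
    using independent_words_exist[OF k] by (auto simp: d_def)
  then interpret independent_words n k "2 * d" M row col .
  have fin: "finite B" unfolding B_def by (rule finite_words)
  define K where "K = (\<Sum>w\<in>B. cmod (f w))"
  define T where "T = (\<Sum>w\<in>B. cmod (mat_tr w))"
  \<comment> \<open>The sum dominates every lower bound required of \<open>R\<close>. As
    \<open>T\<close> depends on the matrices, \<open>R\<close> is chosen only after \<open>k\<close>
    and \<open>M\<close>.\<close>
  define R where "R = 5 + 2 * (K * (real (card B))\<^sup>2) * (2 * d + 1) + K + T + D"
  have K: "cmod (f w) \<le> K" if "w \<in> B" for w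
    unfolding K_def using that fin by (intro member_le_sum) auto
  have T: "cmod (mat_tr w) \<le> T" if "w \<in> B" for w
    unfolding T_def using that fin by (intro member_le_sum) auto
  have nn: "0 \<le> K" "0 \<le> T" unfolding K_def T_def by (intro sum_nonneg; simp)+
  then have nn': "0 \<le> 2 * (K * (real (card B))\<^sup>2) * (2 * d + 1)" by simp
  have R_ge: "5 \<le> R" "1 + K \<le> R" "T \<le> R" "real D + 1 \<le> R"
    "2 * (K * (real (card B))\<^sup>2) * (2 * d + 1) \<le> R"
    using nn nn' unfolding R_def by linarith+
  interpret trace_approximation n k d M row col f K R
    by unfold_locales (use f K R_ge in \<open>auto simp: B_def\<close>)
  have "cmod (approx_trace w - f w) \<le> 1 / (real D + 1)" if w: "w \<in> words n" "wlen w \<le> D" for w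
  proof -
    have "wlen w div 2 \<le> D" using w by simp
    then have "(wlen w div 2)\<^sup>2 \<le> D\<^sup>2" by (rule power_mono) simp
    moreover have "2 * p + 3 \<le> 2 * (q + 2)" if "p \<le> q" for p q :: nat using that by simp
    ultimately have "2 * (wlen w div 2)\<^sup>2 + 3 \<le> 2 * d" unfolding d_def by blast
    moreover have "wlen w \<le> 2 * d" "3 \<le> 2 * d"
      using order_trans[OF w(2) le_square[of D]] by (simp_all add: d_def power2_eq_square)
    moreover have "w \<in> B" "0 \<in> B" using w(1) calculation by (auto simp: B_def)
    ultimately have "cmod (approx_trace w - f w) \<le> 1 / R"
      using w R_ge T[of w] T[of 0] by (intro approx_trace_close) auto
    also have "\<dots> \<le> 1 / (real D + 1)" using R_ge by (intro divide_left_mono) auto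
    finally show ?thesis .
  qed
  then show ?thesis
    by (intro exI[of _ approx_trace] conjI ballI impI matrix_trace_approx_trace)
qed

text \<open>Every size \<open>k\<close> needs a trace, but precision \<open>D\<close> is available
  only from size \<open>\<kappa> D\<close> on. Taking the largest admissible \<open>D\<close> for
  each \<open>k\<close> makes the precision tend to infinity.\<close>

lemma matrix_trace_sequence:
  assumes f: "word_trace n f"
  shows "\<exists>t. (\<forall>k\<ge>1. matrix_trace n k (t k)) \<and> (\<forall>w\<in>words n. (\<lambda>k. t k w) \<longlonglongrightarrow> f w)"
proof -
  define \<kappa> where "\<kappa> D = card {w \<in> words n. wlen w \<le> 2 * (D\<^sup>2 + 2)}" for D
  \<comment> \<open>The clause \<open>D \<le> k\<close> keeps the set finite also for
    \<open>n = 0\<close>, where \<open>\<kappa>\<close> is constantly 1.\<close>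
  define Ds where "Ds k = {D. D \<le> k \<and> \<kappa> D \<le> k}" for k
  have "\<exists>t. matrix_trace n k t \<and>
      (\<forall>D\<in>Ds k. \<forall>w\<in>words n. wlen w \<le> D \<longrightarrow> cmod (t w - f w) \<le> 1 / (real D + 1))"
    if k: "k \<ge> 1" for k
  proof (cases "Ds k = {}")
    case True
    \<comment> \<open>For small \<open>k\<close> no precision is demanded and any trace will
      do.\<close>
    then show ?thesis using matrix_trace_zero[OF k] by blast
  next
    case False
    have fin: "finite (Ds k)" by (simp add: Ds_def)
    define m where "m = Max (Ds k)"
    have "m \<in> Ds k" unfolding m_def using fin False by (rule Max_in)
    then obtain t where t: "matrix_trace n k t"
      "\<And>w. w \<in> words n \<Longrightarrow> wlen w \<le> m \<Longrightarrow> cmod (t w - f w) \<le> 1 / (real m + 1)"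
      using matrix_trace_approximation[OF f, of m k] by (auto simp: Ds_def \<kappa>_def)
    show ?thesis
    proof (intro exI conjI ballI impI)
      fix D w assume D: "D \<in> Ds k" and w: "w \<in> words n" "wlen w \<le> D"
      have "D \<le> m" unfolding m_def using fin D by simp
      then show "cmod (t w - f w) \<le> 1 / (real D + 1)"
        using t(2)[of w] w by (auto intro!: order_trans[OF t(2)] divide_left_mono)
    qed (rule t(1))
  qed
  then have "\<forall>k. \<exists>t. k \<ge> 1 \<longrightarrow> matrix_trace n k t \<and>
      (\<forall>D\<in>Ds k. \<forall>w\<in>words n. wlen w \<le> D \<longrightarrow> cmod (t w - f w) \<le> 1 / (real D + 1))" by blast
  then obtain t where t: "\<And>k. k \<ge> 1 \<Longrightarrow> matrix_trace n k (t k)"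
    "\<And>k D w. k \<ge> 1 \<Longrightarrow> D \<in> Ds k \<Longrightarrow> w \<in> words n \<Longrightarrow> wlen w \<le> D \<Longrightarrow> cmod (t k w - f w) \<le> 1 / (real D + 1)"
    by metis
  have "(\<lambda>k. t k w) \<longlonglongrightarrow> f w" if w: "w \<in> words n" for w
  proof (rule LIMSEQ_I)
    fix e :: real assume "0 < e"
    then obtain j where j: "inverse (real (Suc j)) < e" using reals_Archimedean by blast
    define D where "D = max j (wlen w)"
    have "norm (t k w - f w) < e" if k: "k \<ge> max 1 (max D (\<kappa> D))" for k
    proof -
      have "cmod (t k w - f w) \<le> 1 / (real D + 1)"
        using k w by (intro t(2)) (auto simp: Ds_def D_def)
      also have "\<dots> \<le> inverse (real (Suc j))"
        unfolding inverse_eq_divide by (intro divide_left_mono) (auto simp: D_def)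
      also note j
      finally show ?thesis .
    qed
    then show "\<exists>no. \<forall>k\<ge>no. norm (t k w - f w) < e" by blast
  qed
  then show ?thesis using t(1) by blast
qed

text \<open>An ultrafilter that does not avoid a point is principal there; one that avoids every
  point avoids every finite set. Ordinary limits of sequences thus become limits along
  \<open>\<omega>\<close>.\<close>

lemma nonprincipal_ultrafilter_le_sequentially:
  assumes \<omega>: "ultrafilter_on I \<omega>" "nonprincipal \<omega>"
  shows "\<omega> \<le> sequentially"
proof -
  have ne: "\<forall>\<^sub>F i in \<omega>. i \<noteq> j" for j
  proof (rule ccontr)
    assume "\<not> ?thesis"
    then have "\<not> (\<forall>\<^sub>F i in \<omega>. \<not> i = j)" .
    then have ev: "\<forall>\<^sub>F i in \<omega>. i = j" using \<omega>(1) unfolding ultrafilter_on_def by blast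
    have "\<omega> = principal {j}"
    proof (rule filter_eq_iff[THEN iffD2], intro allI iffI)
      fix P assume P: "eventually P \<omega>"
      have "\<exists>i. P i \<and> i = j"
        using eventually_happens[OF eventually_conj[OF P ev]] \<omega>(1) by (auto simp: ultrafilter_on_def)
      then show "eventually P (principal {j})" by (simp add: eventually_principal)
    next
      fix P assume "eventually P (principal {j})"
      then show "eventually P \<omega>" using ev by (auto simp: eventually_principal elim: eventually_mono)
    qed
    then show False using \<omega>(2) by (simp add: nonprincipal_def)
  qed
  have "\<forall>\<^sub>F i in \<omega>. N \<le> i" for N
  proof -
    have "\<forall>\<^sub>F i in \<omega>. \<forall>j\<in>{..<N}. i \<noteq> j" by (rule eventually_ball_finite) (use ne in auto)
    then show ?thesis by (rule eventually_mono) (metis lessThan_iff not_le)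
  qed
  then have "filterlim (\<lambda>i. i) at_top \<omega>" unfolding filterlim_at_top by blast
  then show ?thesis by (simp add: filterlim_def filtermap_ident)
qed

section \<open>The homomorphism into the ultraproduct\<close>

theorem theorem3p1:
  fixes A :: "'a star_alg" and \<tau> :: "'a \<Rightarrow> complex"
    and n :: nat and x :: "nat \<Rightarrow> 'a" and \<omega> :: "nat filter"
  assumes "tracial_star_algebra A \<tau>"
    and "\<And>i. i < n \<Longrightarrow> x i \<in> carrier A \<and> star A (x i) = x i"
    and "generate_algebra A (x ` {..<n}) = carrier A"
    and "ultrafilter_on {1..} \<omega>" and "nonprincipal \<omega>"
  shows "\<exists>\<tau>k :: nat \<Rightarrow> ncpoly set \<Rightarrow> complex.
    (\<forall>k\<ge>1. tracial_star_algebra (generic_matrices n k) (\<tau>k k)) \<and>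
    (\<exists>\<phi>. tracial_star_hom A \<tau>
       (ultraproduct {1..} \<omega> (generic_matrices n) \<tau>k) (ultraproduct_trace \<omega> \<tau>k) \<phi>)"
proof -
  note One_nat_def [simp del]
  interpret A: tracial_star_algebra A \<tau> by fact
  interpret ev: nc_evaluation A n x by unfold_locales (use assms(2) in auto)
  define f where "f = (\<lambda>w. \<tau> (ev.word_ev w))"
  have "word_trace n f" unfolding f_def by (rule ev.word_trace_word_ev[OF assms(1)])
  then obtain t where t: "\<And>k. k \<ge> 1 \<Longrightarrow> matrix_trace n k (t k)"
    "\<And>w. w \<in> words n \<Longrightarrow> (\<lambda>k. t k w) \<longlonglongrightarrow> f w"
    using matrix_trace_sequence by blast
  define J where "J k = vanishing_ideal n k" for k
  define \<tau>k where "\<tau>k k = tracial_star_ideal.quotient_trace (lin (t k))" for k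
  have J: "tracial_star_ideal (nc_polys n) (lin (t k)) (J k)" if "k \<ge> 1" for k
    unfolding J_def by (rule tracial_star_ideal_vanishing_ideal[OF t(1)[OF that]])
  have J': "star_ideal (nc_polys n) (J k)" if "k \<ge> 1" for k
    unfolding J_def by (rule star_ideal_vanishing_ideal)
  have tracial: "tracial_star_algebra (generic_matrices n k) (\<tau>k k)" if "k \<ge> 1" for k
    using tracial_star_ideal.tracial_quotient[OF J[OF that]]
    by (simp add: generic_matrices_def J_def \<tau>k_def)
  interpret U: tracial_ultraproduct "{1..}" "generic_matrices n" \<tau>k \<omega>
    by (intro tracial_ultraproduct.intro tracial_family.intro tracial_ultraproduct_axioms.intro
      tracial assms(4)) simp
  let ?B = "bounded_product {1..} (generic_matrices n) \<tau>k"
  let ?N = "null_ideal {1..} \<omega> (generic_matrices n) \<tau>k"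
  let ?U = "ultraproduct {1..} \<omega> (generic_matrices n) \<tau>k"
  interpret P: star_algebra "nc_polys n" by (rule star_algebra_nc_polys)

  have \<omega>: "\<omega> \<le> sequentially"
    by (rule nonprincipal_ultrafilter_le_sequentially[OF assms(4,5)])
  have lim: "(\<lambda>k. lin (t k) Q) \<longlonglongrightarrow> \<tau> (ev.poly_ev Q)" if "Q \<in> carrier (nc_polys n)" for Q
  proof -
    have Q: "Poly_Mapping.keys Q \<subseteq> words n" using that by (simp add: nc_polys_simps)
    have "(\<lambda>k. lin (t k) Q) \<longlonglongrightarrow> lin f Q"
      unfolding lin_def using Q by (intro tendsto_sum tendsto_mult tendsto_const t(2)) auto
    then show ?thesis by (simp add: ev.trace_poly_ev[OF assms(1) Q] f_def)
  qed

  \<comment> \<open>The same polynomial is read as a generic matrix of every size.\<close>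
  define \<psi> where "\<psi> Q = (\<lambda>k\<in>{1..}. J k +>\<^bsub>nc_polys n\<^esub> Q)" for Q
  have coset: "J k +>\<^bsub>nc_polys n\<^esub> Q \<in> carrier (generic_matrices n k)"
    "\<tau>k k (J k +>\<^bsub>nc_polys n\<^esub> Q) = lin (t k) Q"
    if "k \<ge> 1" "Q \<in> carrier (nc_polys n)" for k Q
    using star_ideal.star_quotient_simps(1)[OF J'[OF that(1)]]
      tracial_star_ideal.quotient_trace_coset[OF J[OF that(1)] that(2)] that(2)
    by (auto simp: generic_matrices_def J_def \<tau>k_def)
  have gen: "generic_matrices n k = star_quotient (nc_polys n) (J k)" for k
    by (simp add: generic_matrices_def J_def)
  have \<psi>_ops: "\<psi> (P \<oplus>\<^bsub>nc_polys n\<^esub> Q) = \<psi> P \<oplus>\<^bsub>?B\<^esub> \<psi> Q" "\<psi> (P \<otimes>\<^bsub>nc_polys n\<^esub> Q) = \<psi> P \<otimes>\<^bsub>?B\<^esub> \<psi> Q"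
    "\<psi> (cscale (nc_polys n) c P) = cscale ?B c (\<psi> P)" "\<psi> (star (nc_polys n) P) = star ?B (\<psi> P)"
    "\<psi> \<one>\<^bsub>nc_polys n\<^esub> = \<one>\<^bsub>?B\<^esub>"
    if "P \<in> carrier (nc_polys n)" "Q \<in> carrier (nc_polys n)" for P Q c
    unfolding \<psi>_def U.BP_simps gen using that
    by (auto intro!: restrict_ext simp: star_ideal.star_quotient_simps[OF J'])
  have \<psi>_mem: "\<psi> Q \<in> carrier ?B" if Q: "Q \<in> carrier (nc_polys n)" for Q
    unfolding U.carrier_BP_iff
  proof (intro conjI allI impI)
    show "\<psi> Q \<in> (\<Pi>\<^sub>E i\<in>{1..}. carrier (generic_matrices n i))"
      using coset(1)[OF _ Q] by (auto simp: \<psi>_def)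
    fix q :: nat
    define Qq where "Qq = (star (nc_polys n) Q \<otimes>\<^bsub>nc_polys n\<^esub> Q) [^]\<^bsub>nc_polys n\<^esub> q"
    have sQ: "star (nc_polys n) Q \<in> carrier (nc_polys n)" using Q by (rule P.star_closed)
    have Qq: "Qq \<in> carrier (nc_polys n)" using Q sQ by (simp add: Qq_def)
    \<comment> \<open>The norms of \<open>\<psi> Q\<close> are governed by moments of the fixed
      polynomials \<open>Qq\<close>, which converge and are therefore bounded in
      \<open>k\<close>.\<close>
    have "Bseq (\<lambda>k. lin (t k) Qq)" by (rule convergent_imp_Bseq[OF convergentI[OF lim[OF Qq]]])
    then obtain C where C: "\<And>k. cmod (lin (t k) Qq) \<le> C" unfolding Bseq_def by blast
    have "(star (generic_matrices n k) (\<psi> Q k) \<otimes>\<^bsub>generic_matrices n k\<^esub> \<psi> Q k)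
        [^]\<^bsub>generic_matrices n k\<^esub> q = J k +>\<^bsub>nc_polys n\<^esub> Qq" if k: "k \<in> {1..}" for k
    proof -
      interpret Jk: star_ideal "nc_polys n" "J k" using k by (intro J') simp
      show ?thesis
        using k Q sQ by (simp add: \<psi>_def gen Qq_def Jk.star_quotient_simps Jk.coset_nat_pow)
    qed
    then have "\<bar>Re (\<tau>k k ((star (generic_matrices n k) (\<psi> Q k) \<otimes>\<^bsub>generic_matrices n k\<^esub> \<psi> Q k)
        [^]\<^bsub>generic_matrices n k\<^esub> q))\<bar> \<le> C" if k: "k \<in> {1..}" for k
      using k order_trans[OF abs_Re_le_cmod C[of k]] by (simp add: coset(2) Qq)
    then show "\<exists>C. \<forall>k\<in>{1..}. \<bar>Re (\<tau>k k ((star (generic_matrices n k) (\<psi> Q k)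
        \<otimes>\<^bsub>generic_matrices n k\<^esub> \<psi> Q k) [^]\<^bsub>generic_matrices n k\<^esub> q))\<bar> \<le> C" by blast
  qed
  have \<psi>_trace: "limit_trace \<omega> \<tau>k (\<psi> Q) = \<tau> (ev.poly_ev Q)" if Q: "Q \<in> carrier (nc_polys n)" for Q
    by (rule U.limit_traceI[OF tendsto_mono[OF \<omega> lim[OF Q]]]) (simp add: \<psi>_def coset(2)[OF _ Q])

  have ev_ops: "ev.poly_ev (P \<oplus>\<^bsub>nc_polys n\<^esub> Q) = ev.poly_ev P \<oplus>\<^bsub>A\<^esub> ev.poly_ev Q"
    "ev.poly_ev (P \<otimes>\<^bsub>nc_polys n\<^esub> Q) = ev.poly_ev P \<otimes>\<^bsub>A\<^esub> ev.poly_ev Q"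
    "ev.poly_ev (cscale (nc_polys n) c P) = cscale A c (ev.poly_ev P)"
    "ev.poly_ev (star (nc_polys n) P) = star A (ev.poly_ev P)"
    "ev.poly_ev \<one>\<^bsub>nc_polys n\<^esub> = \<one>\<^bsub>A\<^esub>" "ev.poly_ev P \<in> carrier A"
    if "P \<in> carrier (nc_polys n)" "Q \<in> carrier (nc_polys n)" for P Q c
    using that ev.poly_ev_cscale[of P c]
    by (simp_all add: nc_polys_simps ev.poly_ev_add ev.poly_ev_mult ev.poly_ev_star ev.poly_ev_one ev.poly_ev_closed)
  \<comment> \<open>Any polynomial with value \<open>a\<close> may represent it; the next fact shows
    that the coset does not depend on the choice.\<close>
  define \<phi> where "\<phi> a = ?N +>\<^bsub>?B\<^esub> \<psi> (SOME P. P \<in> carrier (nc_polys n) \<and> ev.poly_ev P = a)" for a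
  have \<phi>: "\<phi> (ev.poly_ev P) = ?N +>\<^bsub>?B\<^esub> \<psi> P" if P: "P \<in> carrier (nc_polys n)" for P
  proof -
    define Q where "Q = (SOME Q. Q \<in> carrier (nc_polys n) \<and> ev.poly_ev Q = ev.poly_ev P)"
    have Q: "Q \<in> carrier (nc_polys n)" "ev.poly_ev Q = ev.poly_ev P"
      unfolding Q_def by (rule someI2[of _ P], simp add: P, simp)+
    \<comment> \<open>Two representatives differ by a polynomial with value zero in
      \<open>A\<close>. The limit trace of \<open>star D D\<close> is then the trace of zero, so
      \<open>\<psi> D\<close> lies in the null ideal.\<close>
    define D where "D = Q \<oplus>\<^bsub>nc_polys n\<^esub> cscale (nc_polys n) (-1) P"
    have D: "D \<in> carrier (nc_polys n)" using P Q by (simp add: D_def P.cscale_closed)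
    have "\<psi> Q \<ominus>\<^bsub>?B\<^esub> \<psi> P = \<psi> D"
      using U.BP.cscale_minus_one[OF \<psi>_mem[OF P]] P Q
      by (simp add: D_def a_minus_def \<psi>_ops P.cscale_closed)
    moreover have "ev.poly_ev D = \<zero>\<^bsub>A\<^esub>"
      using P Q ev_ops(6)[OF P P]
      by (simp add: D_def ev_ops P.cscale_closed A.cscale_minus_one A.r_neg)
    then have "limit_trace \<omega> \<tau>k (star ?B (\<psi> D) \<otimes>\<^bsub>?B\<^esub> \<psi> D) = 0"
      using D \<psi>_trace[of "star (nc_polys n) D \<otimes>\<^bsub>nc_polys n\<^esub> D"]
      by (simp add: \<psi>_ops ev_ops P.star_closed A.star_zero A.trace_zero)
    then have "\<psi> D \<in> ?N" using \<psi>_mem[OF D] unfolding null_ideal_def by blast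
    ultimately have "?N +>\<^bsub>?B\<^esub> \<psi> Q = ?N +>\<^bsub>?B\<^esub> \<psi> P"
      using U.null.coset_eq_iff[OF \<psi>_mem[OF Q(1)] \<psi>_mem[OF P]] by simp
    then show ?thesis by (simp add: \<phi>_def Q_def)
  qed
  have surj: "\<exists>P\<in>carrier (nc_polys n). a = ev.poly_ev P" if "a \<in> carrier A" for a
    using that ev.generate_algebra_subset assms(3) by blast

  note quot = U.null.star_quotient_simps[folded ultraproduct_def]
  have "tracial_star_hom A \<tau> ?U (ultraproduct_trace \<omega> \<tau>k) \<phi>"
  proof (intro tracial_star_hom.intro assms(1) U.tracial_ultraproduct tracial_star_hom_axioms.intro)
    show "\<phi> \<in> Ring.ring_hom A ?U"
    proof (rule ring_hom_memI)
      fix a b assume "a \<in> carrier A" "b \<in> carrier A"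
      then obtain P Q where P: "P \<in> carrier (nc_polys n)" "a = ev.poly_ev P"
        and Q: "Q \<in> carrier (nc_polys n)" "b = ev.poly_ev Q" using surj by meson
      show "\<phi> a \<in> carrier ?U" using P by (simp add: \<phi> quot \<psi>_mem)
      show "\<phi> (a \<otimes>\<^bsub>A\<^esub> b) = \<phi> a \<otimes>\<^bsub>?U\<^esub> \<phi> b"
        using \<phi>[of "P \<otimes>\<^bsub>nc_polys n\<^esub> Q"] P Q by (simp add: \<phi> ev_ops \<psi>_ops quot \<psi>_mem)
      show "\<phi> (a \<oplus>\<^bsub>A\<^esub> b) = \<phi> a \<oplus>\<^bsub>?U\<^esub> \<phi> b"
        using \<phi>[of "P \<oplus>\<^bsub>nc_polys n\<^esub> Q"] P Q by (simp add: \<phi> ev_ops \<psi>_ops quot \<psi>_mem)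
    next
      show "\<phi> \<one>\<^bsub>A\<^esub> = \<one>\<^bsub>?U\<^esub>"
        using \<phi>[OF P.one_closed] ev_ops(5)[OF P.one_closed P.one_closed]
          \<psi>_ops(5)[OF P.one_closed P.one_closed]
        by (simp add: quot)
    qed
    fix a assume "a \<in> carrier A"
    then obtain P where P: "P \<in> carrier (nc_polys n)" "a = ev.poly_ev P" using surj by meson
    show "\<phi> (cscale A c a) = cscale ?U c (\<phi> a)" for c
      using \<phi>[of "cscale (nc_polys n) c P"] P by (simp add: \<phi> ev_ops \<psi>_ops quot \<psi>_mem P.cscale_closed)
    show "\<phi> (star A a) = star ?U (\<phi> a)"
      using \<phi>[of "star (nc_polys n) P"] P by (simp add: \<phi> ev_ops \<psi>_ops quot \<psi>_mem P.star_closed)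
    show "ultraproduct_trace \<omega> \<tau>k (\<phi> a) = \<tau> a"
      using P by (simp add: \<phi> U.ultraproduct_trace_eq U.null.quotient_trace_coset \<psi>_mem \<psi>_trace)
  qed
  then show ?thesis using tracial by blast
qed

end
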